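(* Let $D$ be a link diagram with $c_-$ negative crossings such that its all-$A$ state graph $G_A(D)$ has girth $g$ of at least two. If $-c_- \leq i \leq -c_- + g-1$, then (for every $j\in\mathbb{Z}$) all torsion in the integral Khovanov homology $Kh^{i,j}(D)$ is of order two, i.e. every torsion element $a\in Kh^{i,j}(D)$ satisfies $2a=0$.
   Context: State graph. Each crossing of a link diagram $D$ has an $A$-resolution and a $B$-resolution: the $A$-resolution joins the two regions swept out by rotating the over-strand counterclockwise to the under-strand, and the $B$-resolution joins the other two regions. (A crossing is positive/negative by the usual right-hand convention.) Resolving every crossing gives a collection of disjoint closed curves called a Kauffman state; each resolved crossing is recorded by a small line segment (its trace) joining the two resulting strands. The all-$A$ state uses the $A$-resolution at each crossing. The all-$A$ state graph $G_A(D)$ has one vertex for each component of the all-$A$ state and one edge for each crossing, joining the vertices of the components (possibly equal) which the trace connects. Loops and multiple edges are allowed. The girth of a graph is the length of its shortest cycle (a loop is a cycle of length 1, a pair of parallel edges a cycle of length 2), and is infinite if the graph is acyclic. Khovanov homology (over $\mathbb{Z}$). Let $D$ have crossings $c_1,\dots,c_n$, of which $c_+$ are positive and $c_-$ negative. For $I=(k_1,\dots,k_n)\in\{0,1\}^n$ let $h(I)=\sum_r k_r$ and let $D(I)$ be the Kauffman state with an $A$-resolution at $c_r$ if $k_r=0$ and a $B$-resolution if $k_r=1$; $|D(I)|$ is its number of components. Let $\mathcal{A}_2=\mathbb{Z}[x]/(x^2)$ with $1$ in bigrading $(0,1)$ and $x$ in bigrading $(0,-1)$ (homological grading, polynomial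 grading). For a bigraded module put $(M[r]\{s\})^{i,j}=M^{i-r,j-s}$. Let $C(D(I))=\mathcal{A}_2^{\otimes |D(I)|}[h(I)]\{h(I)\}$, with one tensor factor per component of $D(I)$, and $CKh(D)=\bigoplus_I C(D(I))[-c_-]\{c_+-2c_-\}$. For a hypercube edge $\xi$ from $I$ to $J$ ($J$ is obtained from $I$ by changing the $r$-th entry from $0$ to $1$), passing from $D(I)$ to $D(J)$ either merges two components, in which case $d_\xi$ is the multiplication $m(1\otimes1)=1$, $m(1\otimes x)=m(x\otimes 1)=x$, $m(x\otimes x)=0$ on the corresponding factors, or splits one component, in which case $d_\xi$ is $\Delta(1)=1\otimes x+x\otimes 1$, $\Delta(x)=x\otimes x$ on the corresponding factor; $d_\xi$ is the identity on other factors. With $(-1)^\xi=(-1)^{\sum_{l<r}k_l}$, the differential is $d=\sum_\xi(-1)^\xi d_\xi$, of bidegree $(1,0)$, and $Kh^{i,j}(D)$ is the homology of $(CKh(D),d)$ in bigrading $(i,j)$. *)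

theory Defs
  imports "HOL-Algebra.Free_Abelian_Groups" "HOL-Library.Extended_Nat"
begin

section \<open>Oriented link diagrams\<close>

text \<open>
  An oriented link diagram is given by an oriented planar diagram code.  Draw a crossing with its
  under-strand running upwards: \<open>under_in\<close>, \<open>right\<close>, \<open>under_out\<close>, \<open>left\<close> are the labels of the arcs
  meeting it, listed counterclockwise from the incoming end of the under-strand.  By the right-hand
  rule the over-strand of a positive crossing runs from left to right, and that of a negative one
  from right to left.
\<close>

datatype 'a crossing =
  Crossing (positive: bool) (under_in: 'a) (right: 'a) (under_out: 'a) (left: 'a)

definition incoming :: "'a crossing \<Rightarrow> 'a list" where
  "incoming c = [under_in c, if positive c then left c else right c]"

definition outgoing :: "'a crossing \<Rightarrow> 'a list" where
  "outgoing c = [under_out c, if positive c then right c else left c]"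

text \<open>
  Arcs run from crossing to crossing.  An arc which occurs at no crossing is a simple closed
  component of the link without crossings.
\<close>

record 'a diagram =
  arcs :: "'a set"
  crossings :: "'a crossing list"

definition generated_classes :: "'b set \<Rightarrow> ('b \<times> 'b) set \<Rightarrow> 'b set set" where
  "generated_classes A R = A // ((R \<union> R\<inverse>)\<^sup>* \<inter> A \<times> A)"

definition num_crossings :: "'a diagram \<Rightarrow> nat" where
  "num_crossings D = length (crossings D)"

definition neg_crossings :: "'a diagram \<Rightarrow> nat" where
  "neg_crossings D = card {r. r < num_crossings D \<and> \<not> positive (crossings D ! r)}"

definition pos_crossings :: "'a diagram \<Rightarrow> nat" where
  "pos_crossings D = card {r. r < num_crossings D \<and> positive (crossings D ! r)}"

text \<open>
  The pair \<open>(r, p)\<close> with \<open>p < 4\<close> denotes the \<open>p\<close>-th arc end at crossing \<open>r\<close> in counterclockwise order,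
  and also the corner at crossing \<open>r\<close> between the \<open>p\<close>-th and the next arc end.
\<close>

definition positions :: "'a diagram \<Rightarrow> (nat \<times> nat) set" where
  "positions D = {..<num_crossings D} \<times> {..<4}"

definition arc_at :: "'a diagram \<Rightarrow> nat \<times> nat \<Rightarrow> 'a" where
  "arc_at D = (\<lambda>(r, p). let c = crossings D ! r in [under_in c, right c, under_out c, left c] ! p)"

definition arc_ends :: "'a diagram \<Rightarrow> ((nat \<times> nat) \<times> (nat \<times> nat)) set" where
  "arc_ends D = {(e, e'). e \<in> positions D \<and> e' \<in> positions D \<and> e \<noteq> e' \<and> arc_at D e = arc_at D e'}"

text \<open>
  On the left of an arc leaving \<open>r\<close> at the end \<open>(r, p)\<close> and arriving at \<open>(s, q)\<close> lie the corners
  \<open>(r, p)\<close> and \<open>(s, q - 1)\<close>.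
\<close>

definition faces :: "'a diagram \<Rightarrow> (nat \<times> nat) set set" where
  "faces D = generated_classes (positions D)
     {((r, p), (s, (q + 3) mod 4)) | r p s q. ((r, p), (s, q)) \<in> arc_ends D}"

definition pieces :: "'a diagram \<Rightarrow> nat set set" where
  "pieces D = generated_classes {..<num_crossings D} {(r, s) | r p s q. ((r, p), (s, q)) \<in> arc_ends D}"

text \<open>
  The diagram is planar iff each connected piece of the underlying 4-valent graph, with its cyclic
  orders at the crossings, has genus zero.  The genera being nonnegative, this is expressed by the
  Euler characteristic \<open>V - E + F = 2 k\<close> with \<open>V = n\<close>, \<open>E = 2 n\<close> and \<open>k\<close> the number of pieces;
  the faces are counted separately for each piece.
\<close>

definition planar :: "'a diagram \<Rightarrow> bool" where
  "planar D \<longleftrightarrow> card (faces D) = num_crossings D + 2 * card (pieces D)"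

definition link_diagram :: "'a diagram \<Rightarrow> bool" where
  "link_diagram D \<longleftrightarrow>
     finite (arcs D) \<and>
     distinct (concat (map incoming (crossings D))) \<and>
     distinct (concat (map outgoing (crossings D))) \<and>
     set (concat (map incoming (crossings D))) = set (concat (map outgoing (crossings D))) \<and>
     set (concat (map incoming (crossings D))) \<subseteq> arcs D \<and>
     planar D"


section \<open>Kauffman states\<close>

text \<open>
  Rotating the over-strand counterclockwise to the under-strand sweeps out the corner between
  \<open>right\<close> and \<open>under_out\<close> and the one between \<open>left\<close> and \<open>under_in\<close>.  Joining these two regions
  connects \<open>under_in\<close> to \<open>right\<close> and \<open>under_out\<close> to \<open>left\<close>.
\<close>

definition A_resolution :: "'a crossing \<Rightarrow> ('a \<times> 'a) set" where
  "A_resolution c = {(under_in c, right c), (under_out c, left c)}"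

definition B_resolution :: "'a crossing \<Rightarrow> ('a \<times> 'a) set" where
  "B_resolution c = {(right c, under_out c), (left c, under_in c)}"

text \<open>
  A vertex of the cube is represented by the set \<open>I\<close> of the indices of the \<open>B\<close>-resolved crossings, and
  a component of the state by the set of the arcs that it traverses.
\<close>

definition components :: "'a diagram \<Rightarrow> nat set \<Rightarrow> 'a set set" where
  "components D I = generated_classes (arcs D)
     (\<Union>r<num_crossings D.
        if r \<in> I then B_resolution (crossings D ! r) else A_resolution (crossings D ! r))"


section \<open>Multigraphs, girth and the all-A state graph\<close>

record ('v, 'e) multigraph =
  vertices :: "'v set"
  edges :: "'e set"
  endpoints :: "'e \<Rightarrow> 'v set" \<comment> \<open>a singleton for a loop\<close>

definition is_cycle :: "('v, 'e) multigraph \<Rightarrow> 'v list \<Rightarrow> 'e list \<Rightarrow> bool" where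
  "is_cycle G vs es \<longleftrightarrow>
     es \<noteq> [] \<and> length vs = length es \<and> distinct vs \<and> distinct es \<and>
     set vs \<subseteq> vertices G \<and> set es \<subseteq> edges G \<and>
     (\<forall>t<length es. endpoints G (es ! t) = {vs ! t, vs ! ((t + 1) mod length es)})"

text \<open>The infimum of the empty set is \<open>\<infinity>\<close>.\<close>

definition girth :: "('v, 'e) multigraph \<Rightarrow> enat" where
  "girth G = Inf {enat (length es) | vs es. is_cycle G vs es}"

text \<open>
  The two strands of an \<open>A\<close>-resolved crossing, which its trace joins, pass through \<open>under_in\<close> and
  \<open>under_out\<close> respectively.
\<close>

definition A_state_graph :: "'a diagram \<Rightarrow> ('a set, nat) multigraph" where
  "A_state_graph D =
     \<lparr>vertices = components D {},
      edges = {..<num_crossings D},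
      endpoints = (\<lambda>r. {K \<in> components D {}.
        under_in (crossings D ! r) \<in> K \<or> under_out (crossings D ! r) \<in> K})\<rparr>"


section \<open>Integral Khovanov homology\<close>

text \<open>
  The module attached to the state \<open>I\<close> is a tensor power of \<open>\<int>[x]/(x\<^sup>2)\<close> with one factor for each
  component, hence free on the pure tensors of \<open>1\<close> and \<open>x\<close>.  The pair \<open>(I, X)\<close> stands for the pure
  tensor in it with \<open>x\<close> on the components in \<open>X\<close> and \<open>1\<close> on all the others.
\<close>

type_synonym 'a generator = "nat set \<times> 'a set set"

definition hom_degree :: "'a diagram \<Rightarrow> 'a generator \<Rightarrow> int" where
  "hom_degree D = (\<lambda>(I, X). int (card I) - int (neg_crossings D))"

definition poly_degree :: "'a diagram \<Rightarrow> 'a generator \<Rightarrow> int" where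
  "poly_degree D = (\<lambda>(I, X). int (card (components D I - X)) - int (card X) + int (card I)
     + int (pos_crossings D) - 2 * int (neg_crossings D))"

definition generators :: "'a diagram \<Rightarrow> int \<Rightarrow> int \<Rightarrow> 'a generator set" where
  "generators D i j = {(I, X). I \<subseteq> {..<num_crossings D} \<and> X \<subseteq> components D I \<and>
     hom_degree D (I, X) = i \<and> poly_degree D (I, X) = j}"

definition chain_group :: "'a diagram \<Rightarrow> int \<Rightarrow> int \<Rightarrow> ('a generator \<Rightarrow>\<^sub>0 int) monoid" where
  "chain_group D i j = free_Abelian_group (generators D i j)"

text \<open>
  The map along the cube edge from \<open>I\<close> to \<open>J = insert r I\<close>.  The components of \<open>I\<close> which do not
  persist in \<open>J\<close> either are two and merge, or are one and split; for planar diagrams there is no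
  other case.  With \<open>Y\<close> the labels \<open>x\<close> on the persisting components, the branches below are
  \<open>m(1 \<otimes> 1) = 1\<close>, \<open>m(1 \<otimes> x) = m(x \<otimes> 1) = x\<close>, \<open>m(x \<otimes> x) = 0\<close>, and
  \<open>\<Delta>(1) = 1 \<otimes> x + x \<otimes> 1\<close>, \<open>\<Delta>(x) = x \<otimes> x\<close>.
\<close>

definition edge_map :: "'a diagram \<Rightarrow> nat \<Rightarrow> 'a generator \<Rightarrow> ('a generator \<Rightarrow>\<^sub>0 int)" where
  "edge_map D r = (\<lambda>(I, X).
     let J = insert r I;
         old = components D I - components D J;
         new = components D J - components D I;
         Y = X - old
     in if card old = 2 \<and> card new = 1 then
          (if card (X \<inter> old) = 0 then frag_of (J, Y)
           else if card (X \<inter> old) = 1 then frag_of (J, Y \<union> new)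
           else 0)
        else if card old = 1 \<and> card new = 2 then
          (if card (X \<inter> old) = 0 then (\<Sum>K\<in>new. frag_of (J, insert K Y))
           else frag_of (J, Y \<union> new))
        else 0)"

definition differential ::
    "'a diagram \<Rightarrow> ('a generator \<Rightarrow>\<^sub>0 int) \<Rightarrow> ('a generator \<Rightarrow>\<^sub>0 int)" where
  "differential D = frag_extend (\<lambda>(I, X).
     \<Sum>r \<in> {..<num_crossings D} - I. frag_cmul ((-1) ^ card {l \<in> I. l < r}) (edge_map D r (I, X)))"

definition cycle_group :: "'a diagram \<Rightarrow> int \<Rightarrow> int \<Rightarrow> ('a generator \<Rightarrow>\<^sub>0 int) monoid" where
  "cycle_group D i j = (chain_group D i j)
     \<lparr>carrier := kernel (chain_group D i j) (chain_group D (i + 1) j) (differential D)\<rparr>"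

definition boundaries :: "'a diagram \<Rightarrow> int \<Rightarrow> int \<Rightarrow> ('a generator \<Rightarrow>\<^sub>0 int) set" where
  "boundaries D i j = differential D ` carrier (chain_group D (i - 1) j)"

text \<open>As everywhere in \<open>HOL-Algebra\<close>, the operation of this abelian group is written multiplicatively.\<close>

definition Khovanov_homology ::
    "'a diagram \<Rightarrow> int \<Rightarrow> int \<Rightarrow> ('a generator \<Rightarrow>\<^sub>0 int) set monoid" where
  "Khovanov_homology D i j = cycle_group D i j Mod boundaries D i j"

definition torsion_element :: "('g, 'm) monoid_scheme \<Rightarrow> 'g \<Rightarrow> bool" where
  "torsion_element G a \<longleftrightarrow> a \<in> carrier G \<and> (\<exists>n::nat. n > 0 \<and> a [^]\<^bsub>G\<^esub> n = \<one>\<^bsub>G\<^esub>)"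

end

theory Submission
  imports Defs
begin

text \<open>
  Torsion in homological degree \<open>k\<close> only depends on the differential \<open>C\<^sup>k\<^sup>-\<^sup>1 \<rightarrow> C\<^sup>k\<close>.  In the given range
  all sets of \<open>B\<close>-resolved crossings are forests of the all-A state graph, so that all cube maps
  are merges, and the differential is the one of the chromatic complex of that graph over
  \<open>\<int>[x]/(x\<^sup>2)\<close>.  It therefore suffices to show that the torsion of chromatic homology has order two.

  Let the graph be connected with base vertex \<open>v\<close>.  Setting \<open>x\<^sub>v = 0\<close> gives a based complex
  with differential \<open>d\<close>, whose homology is torsion-free and concentrated on one diagonal, by
  deletion and contraction of an edge at \<open>v\<close>.  Let \<open>\<Delta>\<close> be the part of the merge map that the relation
  \<open>x\<^sup>2 = x\<close> adds to \<open>x\<^sup>2 = 0\<close>.  In a basis of idempotents \<open>d + \<Delta>\<close> splits into complexes of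
  monochromatic edge sets, so it is exact in positive degrees; since \<open>d\<close> has its homology on one
  diagonal, \<open>\<Delta>\<close> is exact on the homology of \<open>d\<close>.  Up to homotopy the unbased complex is the cone of
  \<open>-2 \<Delta>\<close>, whence its torsion has order two.  Disconnected graphs yield tensor products of such
  complexes.
\<close>

section \<open>Chains\<close>

text \<open>The number \<open>lev\<close> of chosen edges plus labels \<open>x\<close> governs the
  argument. With x^2 = 0 an added edge keeps the labels, so \<open>d\<close> raises
  \<open>lev\<close> by one; the extra term \<Delta> of x^2 = x also loses a label and keeps
  \<open>lev\<close>. Thus \<open>d + \<Delta>\<close> is filtered by \<open>lev\<close>. As the
  homology of \<open>d\<close> sits at one level \<kappa>, leading terms at other levels are
  \<open>d\<close>-exact and can be removed, which transfers exactness of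
  \<open>d + \<Delta>\<close> to \<Delta> on the homology of \<open>d\<close>.

  Why the order is two: the kernel of \<Delta> on a torsion-free group is pure, so by exactness its
  image is pure in positive degree. If a multiple of a class lies in the image of 2 \<Delta>, the
  class lies in the image of \<Delta>, and its double in that of 2 \<Delta>. The factor 2 comes from
  the derivation x -> 1, which sends x^2 to 2 x and compares based and unbased complexes.

  The order of torsion does not pass to tensor products by its bare definition. A chain-level
  splitting is used there: the second factor is divided into a part on which twice the identity is
  null-homotopic and a part with zero differential.\<close>

definition frags :: "'g set \<Rightarrow> ('g \<Rightarrow>\<^sub>0 int) set" where
  "frags S = {c. Poly_Mapping.keys c \<subseteq> S}"

lemmas frag_extend_simps =
  frag_extend_add frag_extend_diff frag_extend_minus frag_extend_cmul frag_extend_0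

lemma frags_0 [simp]: "0 \<in> frags S"
  by (simp add: frags_def)

lemma frags_add: "a \<in> frags S \<Longrightarrow> b \<in> frags S \<Longrightarrow> a + b \<in> frags S"
  using keys_add by (fastforce simp: frags_def)

lemma frags_diff: "a \<in> frags S \<Longrightarrow> b \<in> frags S \<Longrightarrow> a - b \<in> frags S"
  using keys_diff by (fastforce simp: frags_def)

lemma frags_minus: "a \<in> frags S \<Longrightarrow> - a \<in> frags S"
  by (simp add: frags_def)

lemma frags_cmul: "a \<in> frags S \<Longrightarrow> frag_cmul c a \<in> frags S"
  using keys_cmul by (fastforce simp: frags_def)

lemma frags_frag_of [simp]: "frag_of g \<in> frags S \<longleftrightarrow> g \<in> S"
  by (simp add: frags_def)

lemma frags_sum: "(\<And>i. i \<in> I \<Longrightarrow> f i \<in> frags S) \<Longrightarrow> sum f I \<in> frags S"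
  by (induction I rule: infinite_finite_induct) (auto intro: frags_add)


lemma frags_mono: "a \<in> frags S \<Longrightarrow> S \<subseteq> T \<Longrightarrow> a \<in> frags T"
  by (auto simp: frags_def)

lemma frags_empty [simp]: "frags {} = {0}"
  by (auto simp: frags_def)

lemma frags_Int: "a \<in> frags S \<Longrightarrow> a \<in> frags T \<Longrightarrow> a \<in> frags (S \<inter> T)"
  by (auto simp: frags_def)

lemma frags_disjoint_eq_0: "a \<in> frags S \<Longrightarrow> a \<in> frags T \<Longrightarrow> S \<inter> T = {} \<Longrightarrow> a = 0"
  using frags_Int[of a S T] by simp

lemma frags_extend:
  "c \<in> frags S \<Longrightarrow> (\<And>g. g \<in> S \<Longrightarrow> f g \<in> frags T) \<Longrightarrow> frag_extend f c \<in> frags T"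
  unfolding frag_extend_def by (intro frags_sum frags_cmul) (auto simp: frags_def)

lemma extend_cong:
  "c \<in> frags S \<Longrightarrow> (\<And>g. g \<in> S \<Longrightarrow> f g = h g) \<Longrightarrow> frag_extend f c = frag_extend h c"
  by (rule frag_extend_eq) (auto simp: frags_def)

lemma extend_eq_0:
  "c \<in> frags S \<Longrightarrow> (\<And>g. g \<in> S \<Longrightarrow> f g = 0) \<Longrightarrow> frag_extend f c = 0"
  by (rule frag_extend_eq_0) (auto simp: frags_def)

lemma extend_compose: "frag_extend f (frag_extend h c) = frag_extend (\<lambda>g. frag_extend f (h g)) c"
  by (simp add: frag_extend_def[of h] frag_extend_sum frag_extend_cmul comp_def)
     (simp add: frag_extend_def)

lemma extend_add_fun: "frag_extend (\<lambda>g. f g + h g) c = frag_extend f c + frag_extend h c"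
  by (simp add: frag_extend_def frag_cmul_distrib2 sum.distrib)

lemma extend_cmul_fun: "frag_extend (\<lambda>g. frag_cmul k (f g)) c = frag_cmul k (frag_extend f c)"
  by (simp add: frag_extend_def frag_cmul_sum mult.commute)

lemma extend_diff_fun: "frag_extend (\<lambda>g. f g - h g) c = frag_extend f c - frag_extend h c"
  using extend_add_fun[of "\<lambda>g. f g - h g" h c] by simp

lemma extend_id: "c \<in> frags S \<Longrightarrow> (\<And>g. g \<in> S \<Longrightarrow> f g = frag_of g) \<Longrightarrow> frag_extend f c = c"
  using extend_cong[of c S f frag_of] frag_expansion[of c] by simp

lemma lookup_frag_extend:
  "Poly_Mapping.lookup (frag_extend f c) g =
    (\<Sum>x\<in>Poly_Mapping.keys c. Poly_Mapping.lookup c x * Poly_Mapping.lookup (f x) g)"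
  by (simp add: frag_extend_def lookup_sum)

lemma frag_cmul_2: "frag_cmul 2 a = a + a"
  using frag_cmul_distrib[of 1 1 a] by simp

lemma frag_cmul_minus2: "frag_cmul k (- a) = - frag_cmul k a"
  using frag_cmul_cmul[of k "-1" a] by simp

lemma frag_cmul_diff2: "frag_cmul k (a - b) = frag_cmul k a - frag_cmul k b"
  using frag_cmul_distrib2[of k a "- b"] frag_cmul_minus2[of k b] by simp

lemma frag_cmul_sign_sign: "s * s = 1 \<Longrightarrow> frag_cmul s (frag_cmul s a) = a"
  by simp

section \<open>Projection of chains to a set of generators\<close>

definition proj :: "'g set \<Rightarrow> ('g \<Rightarrow>\<^sub>0 int) \<Rightarrow> ('g \<Rightarrow>\<^sub>0 int)" where
  "proj S = frag_extend (\<lambda>g. if g \<in> S then frag_of g else 0)"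

lemma proj_simps: "proj S (a + b) = proj S a + proj S b" "proj S (a - b) = proj S a - proj S b"
  "proj S (- a) = - proj S a" "proj S (frag_cmul k a) = frag_cmul k (proj S a)" "proj S 0 = 0"
  by (simp_all add: proj_def frag_extend_simps)

lemma lookup_proj: "Poly_Mapping.lookup (proj S a) g = (if g \<in> S then Poly_Mapping.lookup a g else 0)"
proof -
  have "Poly_Mapping.lookup (proj S a) g =
     (\<Sum>x\<in>Poly_Mapping.keys a. if x = g then (if g \<in> S then Poly_Mapping.lookup a g else 0) else 0)"
    unfolding proj_def lookup_frag_extend by (rule sum.cong) auto
  then show ?thesis
    by (auto simp: in_keys_iff)
qed

lemma proj_eq: "a \<in> frags S \<Longrightarrow> S \<subseteq> T \<Longrightarrow> proj T a = a"
  unfolding proj_def by (erule extend_id) auto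

lemma proj_eq_0: "a \<in> frags S \<Longrightarrow> S \<inter> T = {} \<Longrightarrow> proj T a = 0"
  unfolding proj_def by (rule extend_eq_0) auto

lemma proj_frags: "a \<in> frags S \<Longrightarrow> proj T a \<in> frags (S \<inter> T)"
  unfolding proj_def by (rule frags_extend) auto

lemma proj_in: "proj T a \<in> frags T"
  using proj_frags[of a UNIV T] by (simp add: frags_def)

lemma proj_decomp: "proj S a + proj (- S) a = a"
  by (rule poly_mapping_eqI) (simp add: lookup_add lookup_proj)

lemma frags_split:
  assumes "c \<in> frags (S \<union> T)"
  obtains a b where "a \<in> frags S" "b \<in> frags T" "c = a + b"
  using assms frag_split[of c S T] unfolding frags_def mem_Collect_eq by metis

text \<open>Comparison of components in a direct sum; equations between chains are split in this way
  for cones, levels and bidegrees.\<close>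

lemma frags_disjoint_cancel:
  assumes "a \<in> frags S" "a' \<in> frags S" "b \<in> frags T" "b' \<in> frags T" "S \<inter> T = {}"
    and "a + b = a' + b'"
  shows "a = a'" "b = b'"
proof -
  have "a - a' = b' - b"
    using assms(6) by (simp add: algebra_simps)
  then have "a - a' = 0"
    by (metis assms(1-5) frags_diff frags_disjoint_eq_0)
  then show "a = a'" "b = b'"
    using assms(6) by auto
qed

section \<open>Complexes with homology on one diagonal\<close>

abbreviation level :: "'g set \<Rightarrow> ('g \<Rightarrow> nat) \<Rightarrow> nat \<Rightarrow> 'g set" where
  "level G lev N \<equiv> {g \<in> G. lev g = N}"

text \<open>Phrased with \<open>Suc\<close> so that nothing lies below level 0; with truncated
  subtraction level 0 would lie below itself.\<close>

abbreviation below :: "'g set \<Rightarrow> ('g \<Rightarrow> nat) \<Rightarrow> nat \<Rightarrow> 'g set" where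
  "below G lev N \<equiv> {g \<in> G. Suc (lev g) = N}"

text \<open>Vanishing homology away from \<kappa> and torsion-free homology at \<kappa>. The second
  clause speaks of the cokernel of the incoming differential; since chains are torsion-free, a chain
  with a multiple that is a boundary is closed, so this is the torsion of homology.\<close>

definition thin :: "'g set \<Rightarrow> ('g \<Rightarrow> nat) \<Rightarrow> nat \<Rightarrow> ('g \<Rightarrow> 'g \<Rightarrow>\<^sub>0 int) \<Rightarrow> bool" where
  "thin G lev \<kappa> F \<longleftrightarrow>
    (\<forall>N z. N \<noteq> \<kappa> \<longrightarrow> z \<in> frags (level G lev N) \<longrightarrow> frag_extend F z = 0 \<longrightarrow>
       (\<exists>y \<in> frags (below G lev N). z = frag_extend F y)) \<and>
    (\<forall>z y n. 0 < n \<longrightarrow> z \<in> frags (level G lev \<kappa>) \<longrightarrow> y \<in> frags (below G lev \<kappa>) \<longrightarrow>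
       frag_cmul n z = frag_extend F y \<longrightarrow> (\<exists>y' \<in> frags (below G lev \<kappa>). z = frag_extend F y'))"

lemma thin_exact:
  assumes "thin G lev \<kappa> F" "N \<noteq> \<kappa>" "z \<in> frags (level G lev N)" "frag_extend F z = 0"
  obtains y where "y \<in> frags (below G lev N)" "z = frag_extend F y"
  using assms unfolding thin_def by blast

lemma thin_torsion_free:
  assumes "thin G lev \<kappa> F" "0 < n" "z \<in> frags (level G lev \<kappa>)" "y \<in> frags (below G lev \<kappa>)"
    "frag_cmul n z = frag_extend F y"
  obtains y' where "y' \<in> frags (below G lev \<kappa>)" "z = frag_extend F y'"
  using assms unfolding thin_def by blast

definition graded_differential :: "'g set \<Rightarrow> ('g \<Rightarrow> nat) \<Rightarrow> ('g \<Rightarrow> 'g \<Rightarrow>\<^sub>0 int) \<Rightarrow> bool" where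
  "graded_differential G lev F \<longleftrightarrow>
     (\<forall>g\<in>G. F g \<in> frags (level G lev (Suc (lev g))) \<and> frag_extend F (F g) = 0)"

lemma graded_differential_square:
  assumes "graded_differential G lev F" "z \<in> frags G"
  shows "frag_extend F (frag_extend F z) = 0"
  unfolding extend_compose using assms(2)
  by (rule extend_eq_0) (use assms(1) in \<open>auto simp: graded_differential_def\<close>)

text \<open>A mapping cone: \<open>G1\<close> spans a subcomplex, \<open>G0\<close> with the
  differential \<open>F0\<close> is the quotient, and \<open>f\<close> is the attaching map.\<close>

locale cone =
  fixes G0 G1 :: "'g set" and lev :: "'g \<Rightarrow> nat" and \<kappa> :: nat
    and F F0 f :: "'g \<Rightarrow> 'g \<Rightarrow>\<^sub>0 int"
  assumes disj: "G0 \<inter> G1 = {}"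
    and F_diff: "graded_differential (G0 \<union> G1) lev F"
    and F_G0: "g \<in> G0 \<Longrightarrow> F g = F0 g + f g"
    and F0_lev: "g \<in> G0 \<Longrightarrow> F0 g \<in> frags (level G0 lev (Suc (lev g)))"
    and f_lev: "g \<in> G0 \<Longrightarrow> f g \<in> frags (level G1 lev (Suc (lev g)))"
    and F_G1: "g \<in> G1 \<Longrightarrow> F g \<in> frags (level G1 lev (Suc (lev g)))"
begin

lemma ext_G0: "z \<in> frags G0 \<Longrightarrow> frag_extend F z = frag_extend F0 z + frag_extend f z"
  using extend_cong[of z G0 F "\<lambda>g. F0 g + f g"] F_G0 by (simp add: extend_add_fun)

lemma F0_in: "z \<in> frags G0 \<Longrightarrow> frag_extend F0 z \<in> frags G0"
  by (erule frags_extend) (rule frags_mono[OF F0_lev], auto)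

lemma f_in: "z \<in> frags G0 \<Longrightarrow> frag_extend f z \<in> frags G1"
  by (erule frags_extend) (rule frags_mono[OF f_lev], auto)

lemma F1_in: "z \<in> frags G1 \<Longrightarrow> frag_extend F z \<in> frags G1"
  by (erule frags_extend) (rule frags_mono[OF F_G1], auto)

lemma split_level:
  assumes "z \<in> frags {g \<in> G0 \<union> G1. P g}"
  obtains z0 z1 where "z0 \<in> frags {g \<in> G0. P g}" "z1 \<in> frags {g \<in> G1. P g}" "z = z0 + z1"
proof -
  have "{g \<in> G0 \<union> G1. P g} = {g \<in> G0. P g} \<union> {g \<in> G1. P g}"
    by auto
  then show ?thesis
    using assms that frags_split[of z "{g \<in> G0. P g}" "{g \<in> G1. P g}"] by auto
qed

lemma components_eq:
  assumes "z0 \<in> frags G0" "z1 \<in> frags G1" "y0 \<in> frags G0" "y1 \<in> frags G1"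
    and "z0 + z1 = frag_extend F (y0 + y1)"
  shows "z0 = frag_extend F0 y0" "z1 = frag_extend f y0 + frag_extend F y1"
proof -
  have eq: "z0 + z1 = frag_extend F0 y0 + (frag_extend f y0 + frag_extend F y1)"
    using assms ext_G0 by (simp add: frag_extend_simps algebra_simps)
  show "z0 = frag_extend F0 y0" "z1 = frag_extend f y0 + frag_extend F y1"
    using frags_disjoint_cancel[OF _ _ _ _ disj eq] assms F0_in f_in F1_in frags_add by blast+
qed

lemma F_square: "z \<in> frags (G0 \<union> G1) \<Longrightarrow> frag_extend F (frag_extend F z) = 0"
  using graded_differential_square[OF F_diff] .

lemma F0_level: "y \<in> frags (below G0 lev N) \<Longrightarrow> frag_extend F0 y \<in> frags (level G0 lev N)"
  by (erule frags_extend) (use F0_lev in auto)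

lemma f_level: "y \<in> frags (below G0 lev N) \<Longrightarrow> frag_extend f y \<in> frags (level G1 lev N)"
  by (erule frags_extend) (use f_lev in auto)

lemma below_Un: "y \<in> frags (below G0 lev N) \<Longrightarrow> y \<in> frags (below (G0 \<union> G1) lev N)"
  "y \<in> frags (below G1 lev N) \<Longrightarrow> y \<in> frags (below (G0 \<union> G1) lev N)"
  by (erule frags_mono, auto)+

lemma in_G: "y \<in> frags {g \<in> G0. P g} \<Longrightarrow> y \<in> frags G0" "y \<in> frags {g \<in> G1. P g} \<Longrightarrow> y \<in> frags G1"
  "y \<in> frags {g \<in> G0. P g} \<Longrightarrow> y \<in> frags (G0 \<union> G1)" "y \<in> frags {g \<in> G1. P g} \<Longrightarrow> y \<in> frags (G0 \<union> G1)"
  by (erule frags_mono, auto)+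

text \<open>The long exact sequence of the cone, on chains. Off \<kappa> both outer groups vanish.
  At \<kappa> the connecting map starts from the homology of \<open>G0\<close> one level lower,
  which vanishes, so the homology is an extension of torsion-free groups.\<close>

lemma thin_cone:
  assumes t0: "thin G0 lev \<kappa> F0" and t1: "thin G1 lev \<kappa> F"
  shows "thin (G0 \<union> G1) lev \<kappa> F"
  unfolding thin_def
proof (intro conjI allI impI)
  fix N z assume N: "N \<noteq> \<kappa>" and z: "z \<in> frags (level (G0 \<union> G1) lev N)" and dz: "frag_extend F z = 0"
  obtain z0 z1 where z01: "z0 \<in> frags (level G0 lev N)" "z1 \<in> frags (level G1 lev N)" "z = z0 + z1"
    by (rule split_level[OF z])
  have "frag_extend F0 z0 = 0"
    using components_eq(1)[of 0 0 z0 z1] z01 dz in_G by auto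
  then obtain y0 where y0: "y0 \<in> frags (below G0 lev N)" "z0 = frag_extend F0 y0"
    using thin_exact[OF t0 N z01(1)] by blast
  let ?z1 = "z1 - frag_extend f y0"
  have eq: "z - frag_extend F y0 = ?z1"
    using y0 z01 ext_G0 in_G(1) by simp
  have "frag_extend F ?z1 = 0"
    unfolding eq[symmetric] using dz F_square y0 in_G(3) by (simp add: frag_extend_simps)
  moreover have "?z1 \<in> frags (level G1 lev N)"
    using z01 f_level[OF y0(1)] by (auto intro: frags_diff)
  ultimately obtain y1 where y1: "y1 \<in> frags (below G1 lev N)" "?z1 = frag_extend F y1"
    using thin_exact[OF t1 N] by blast
  then have "z = frag_extend F (y0 + y1)"
    using eq by (simp add: frag_extend_simps algebra_simps)
  then show "\<exists>y\<in>frags (below (G0 \<union> G1) lev N). z = frag_extend F y"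
    using y0 y1 below_Un frags_add by blast
next
  fix z y and n :: int
  assume n: "0 < n" and z: "z \<in> frags (level (G0 \<union> G1) lev \<kappa>)"
    and y: "y \<in> frags (below (G0 \<union> G1) lev \<kappa>)" and eq: "frag_cmul n z = frag_extend F y"
  obtain z0 z1 where z01: "z0 \<in> frags (level G0 lev \<kappa>)" "z1 \<in> frags (level G1 lev \<kappa>)" "z = z0 + z1"
    by (rule split_level[OF z])
  obtain y0 y1 where y01: "y0 \<in> frags (below G0 lev \<kappa>)" "y1 \<in> frags (below G1 lev \<kappa>)" "y = y0 + y1"
    by (rule split_level[OF y])
  have "frag_cmul n z0 = frag_extend F0 y0"
    using components_eq(1)[OF frags_cmul[OF in_G(1)[OF z01(1)]] frags_cmul[OF in_G(2)[OF z01(2)]]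
        in_G(1)[OF y01(1)] in_G(2)[OF y01(2)], of n n] z01(3) y01(3) eq
    by (simp add: frag_cmul_distrib2)
  then obtain u0 where u0: "u0 \<in> frags (below G0 lev \<kappa>)" "z0 = frag_extend F0 u0"
    using thin_torsion_free[OF t0 n z01(1) y01(1)] by blast
  \<comment> \<open>The ambiguity in the choice of the primitive \<open>u0\<close>. It is closed one
    level below \<kappa>, hence the boundary of some \<open>t0\<close>, and subtracting the full
    boundary of \<open>t0\<close> moves it into \<open>G1\<close>.\<close>
  define v0 where "v0 = y0 - frag_cmul n u0"
  have v0: "v0 \<in> frags (below G0 lev \<kappa>)" "frag_extend F0 v0 = 0"
    using u0 y01 \<open>frag_cmul n z0 = frag_extend F0 y0\<close>
    by (auto simp: v0_def frag_extend_simps intro: frags_diff frags_cmul)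
  have "\<exists>t0\<in>frags {g \<in> G0. Suc (Suc (lev g)) = \<kappa>}. v0 = frag_extend F0 t0"
  proof (cases \<kappa>)
    case 0
    then show ?thesis using v0 by auto
  next
    case (Suc M)
    then have "v0 \<in> frags (level G0 lev M)" using v0 by simp
    from thin_exact[OF t0 _ this v0(2)] Suc
    obtain y where "y \<in> frags (below G0 lev M)" "v0 = frag_extend F0 y" by auto
    moreover have "below G0 lev M = {g \<in> G0. Suc (Suc (lev g)) = \<kappa>}" using Suc by auto
    ultimately show ?thesis by auto
  qed
  then obtain t0 where t0': "t0 \<in> frags {g \<in> G0. Suc (Suc (lev g)) = \<kappa>}" "v0 = frag_extend F0 t0"
    by blast
  have ft0: "frag_extend f t0 \<in> frags (below G1 lev \<kappa>)"
    using t0'(1) by (rule frags_extend) (use f_lev in auto)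
  let ?z1 = "z1 - frag_extend f u0" and ?y1 = "y1 - frag_extend f t0"
  have "z - frag_extend F u0 = ?z1"
    using u0 z01 ext_G0 in_G(1) by simp
  have "y - frag_cmul n u0 - frag_extend F t0 = ?y1"
    using ext_G0[of t0] t0' in_G(1) y01 by (auto simp: v0_def algebra_simps)
  then have "frag_extend F ?y1 = frag_extend F y - frag_cmul n (frag_extend F u0) - frag_extend F (frag_extend F t0)"
    by (metis frag_extend_diff frag_extend_cmul)
  also have "\<dots> = frag_cmul n ?z1"
    using \<open>z - frag_extend F u0 = ?z1\<close> eq F_square[of t0] in_G(3) t0'
    by (metis diff_zero frag_cmul_diff2)
  finally have "frag_extend F ?y1 = frag_cmul n ?z1" .
  then have 3: "frag_cmul n ?z1 = frag_extend F ?y1" by (rule sym)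
  have 1: "?z1 \<in> frags (level G1 lev \<kappa>)" by (rule frags_diff[OF z01(2) f_level[OF u0(1)]])
  have 2: "?y1 \<in> frags (below G1 lev \<kappa>)" by (rule frags_diff[OF y01(2) ft0])
  obtain y' where y': "y' \<in> frags (below G1 lev \<kappa>)" "?z1 = frag_extend F y'"
    by (rule thin_torsion_free[OF t1 n 1 2 3])
  then have "z = frag_extend F (u0 + y')"
    using \<open>z - frag_extend F u0 = ?z1\<close> by (simp add: frag_extend_simps algebra_simps)
  then show "\<exists>y'\<in>frags (below (G0 \<union> G1) lev \<kappa>). z = frag_extend F y'"
    using u0 y' below_Un frags_add by blast
qed

text \<open>Here \<open>f\<close> cancels the generators in \<open>Ga\<close> against those in \<open>G1\<close>.\<close>

lemma thin_cancel:
  assumes G0: "G0 = Ga \<union> Gb" "Ga \<inter> Gb = {}"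
    and F0b: "\<And>g. g \<in> Gb \<Longrightarrow> F0 g \<in> frags Gb"
    and fb: "\<And>g. g \<in> Gb \<Longrightarrow> f g = 0"
    and \<phi>: "bij_betw \<phi> Ga G1"
    and fa: "\<And>g. g \<in> Ga \<Longrightarrow> f g = frag_cmul (s g) (frag_of (\<phi> g))"
    and s: "\<And>g. g \<in> Ga \<Longrightarrow> s g * s g = 1"
    and tb: "thin Gb lev \<kappa> F0"
  shows "thin (G0 \<union> G1) lev \<kappa> F"
proof -
  define \<psi> where "\<psi> = inv_into Ga \<phi>"
  have \<psi>: "\<psi> g \<in> Ga" "\<phi> (\<psi> g) = g" if "g \<in> G1" for g
    using that \<phi> by (auto simp: \<psi>_def bij_betw_def inv_into_into f_inv_into_f)
  have \<psi>\<phi>: "\<psi> (\<phi> g) = g" "\<phi> g \<in> G1" if "g \<in> Ga" for g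
    using that \<phi> by (auto simp: \<psi>_def bij_betw_def)
  define h where "h = (\<lambda>g. frag_cmul (s (\<psi> g)) (frag_of (\<psi> g)))"
  \<comment> \<open>The coefficient \<open>s\<close> is a unit, hence nonzero, so homogeneity of
    \<open>f\<close> forces \<phi> to raise the level by one.\<close>
  have lev\<psi>: "Suc (lev (\<psi> g)) = lev g" if "g \<in> G1" for g
  proof -
    have "f (\<psi> g) \<in> frags (level G1 lev (Suc (lev (\<psi> g))))"
      using \<psi>(1)[OF that] G0 f_lev by auto
    moreover have "s (\<psi> g) \<noteq> 0" using s[OF \<psi>(1)[OF that]] by auto
    ultimately show ?thesis
      using fa[OF \<psi>(1)[OF that]] \<psi>(2)[OF that] by (auto simp: frags_def)
  qed
  have fh: "frag_extend f (frag_extend h z) = z" if "z \<in> frags G1" for z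
    unfolding extend_compose using that
    by (rule extend_id) (simp add: h_def frag_extend_simps fa \<psi> s)
  have hf: "frag_extend h (frag_extend f z) = z" if "z \<in> frags Ga" for z
    unfolding extend_compose using that
    by (rule extend_id) (simp add: h_def frag_extend_simps fa \<psi>\<phi> s)
  have h_level: "frag_extend h z \<in> frags (below Ga lev N)" if "z \<in> frags (level G1 lev N)" for z N
    using that by (rule frags_extend) (use lev\<psi> in \<open>auto simp: h_def \<psi> intro!: frags_cmul\<close>)
  have sub: "y \<in> frags {g \<in> Ga. P g} \<Longrightarrow> y \<in> frags {g \<in> G0. P g}"
       "y \<in> frags {g \<in> Gb. P g} \<Longrightarrow> y \<in> frags {g \<in> G0. P g}"
       "y \<in> frags {g \<in> Ga. P g} \<Longrightarrow> y \<in> frags Ga"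
       "y \<in> frags {g \<in> Gb. P g} \<Longrightarrow> y \<in> frags Gb"
       "y \<in> frags {g \<in> G0. P g} \<Longrightarrow> y \<in> frags {g \<in> G0 \<union> G1. P g}" for y P
    using G0 by (auto elim!: frags_mono)
  have fb0: "frag_extend f z = 0" if "z \<in> frags Gb" for z
    using that fb by (rule extend_eq_0)
  have Fb: "frag_extend F z = frag_extend F0 z" if "z \<in> frags Gb" for z
    using ext_G0[of z] fb0[OF that] that G0 frags_mono by fastforce
  have split_b: "\<exists>za\<in>frags {g \<in> Ga. P g}. \<exists>zb\<in>frags {g \<in> Gb. P g}. z0 = za + zb"
    if "z0 \<in> frags {g \<in> G0. P g}" for z0 P
  proof -
    have "{g \<in> G0. P g} = {g \<in> Ga. P g} \<union> {g \<in> Gb. P g}" using G0 by auto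
    then have "z0 \<in> frags ({g \<in> Ga. P g} \<union> {g \<in> Gb. P g})" using that by simp
    then show ?thesis by (rule frags_split) blast
  qed
  \<comment> \<open>\<open>Gb\<close> is a subcomplex whose quotient is the cone of an isomorphism.
    Subtracting the boundary of a preimage of \<open>z1\<close> removes the part in
    \<open>G1\<close>; the part in \<open>Ga\<close> then vanishes because \<open>f\<close> is
    injective there.\<close>
  have reduce: "\<exists>y\<in>frags (below G0 lev N). \<exists>zb \<in> frags (level Gb lev N).
      z = zb + frag_extend F y \<and> frag_extend F0 zb = 0"
    if z: "z \<in> frags (level (G0 \<union> G1) lev N)" and dz: "frag_extend F z = 0" for z N
  proof -
    obtain z0 z1 where z01: "z0 \<in> frags (level G0 lev N)" "z1 \<in> frags (level G1 lev N)" "z = z0 + z1"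
      by (rule split_level[OF z])
    define y where "y = frag_extend h z1"
    have y: "y \<in> frags (below Ga lev N)" using h_level[OF z01(2)] by (simp add: y_def)
    have y': "y \<in> frags (below G0 lev N)" by (rule sub(1)[OF y])
    define z' where "z' = z0 - frag_extend F0 y"
    have z': "z' \<in> frags (level G0 lev N)"
      using z01 F0_level[OF y'] by (auto simp: z'_def intro: frags_diff)
    have "frag_extend f y = z1" using fh[OF in_G(2)[OF z01(2)]] by (simp add: y_def)
    then have zy: "z = z' + frag_extend F y"
      using ext_G0[OF in_G(1)[OF y']] z01(3) by (simp add: z'_def)
    have "frag_extend F z' = 0"
    proof -
      have "frag_extend F z' = frag_extend F z - frag_extend F (frag_extend F y)"
        by (simp add: zy frag_extend_simps)
      then show ?thesis using dz F_square[OF in_G(3)[OF y']] by simp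
    qed
    then have "0 = frag_extend F0 z'" "0 = frag_extend f z'"
      using components_eq[OF frags_0 frags_0 in_G(1)[OF z'] frags_0] by auto
    obtain za zb where zab: "za \<in> frags (level Ga lev N)" "zb \<in> frags (level Gb lev N)" "z' = za + zb"
      using split_b[OF z'] by blast
    have "frag_extend f za = 0"
      using \<open>0 = frag_extend f z'\<close> zab(3) fb0[OF sub(4)[OF zab(2)]] by (simp add: frag_extend_simps)
    then have "za = 0"
      using hf[OF sub(3)[OF zab(1)]] by simp
    with zab have "zb = z'" by simp
    then show ?thesis
      using zab(2) y' zy \<open>0 = frag_extend F0 z'\<close>
      by (intro bexI[of _ y] bexI[of _ zb] conjI) simp_all
  qed
  show ?thesis
    unfolding thin_def
  proof (intro conjI allI impI)
    fix N z assume N: "N \<noteq> \<kappa>" and z: "z \<in> frags (level (G0 \<union> G1) lev N)" and dz: "frag_extend F z = 0"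
    obtain y zb where yzb: "y\<in>frags (below G0 lev N)" "zb \<in> frags (level Gb lev N)"
       "z = zb + frag_extend F y" "frag_extend F0 zb = 0"
      using reduce[OF z dz] by blast
    obtain u where u: "u \<in> frags (below Gb lev N)" "zb = frag_extend F0 u"
      using thin_exact[OF tb N yzb(2,4)] by blast
    have "z = frag_extend F (u + y)"
      using yzb(3) u(2) Fb[OF sub(4)[OF u(1)]] by (simp add: frag_extend_simps)
    moreover have "u + y \<in> frags (below (G0 \<union> G1) lev N)"
      by (intro frags_add sub(5)[OF sub(2)[OF u(1)]] sub(5)[OF yzb(1)])
    ultimately show "\<exists>y\<in>frags (below (G0 \<union> G1) lev N). z = frag_extend F y" by blast
  next
    fix z y and n :: int
    assume n: "0 < n" and z: "z \<in> frags (level (G0 \<union> G1) lev \<kappa>)"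
      and y: "y \<in> frags (below (G0 \<union> G1) lev \<kappa>)" and eq: "frag_cmul n z = frag_extend F y"
    have "frag_cmul n (frag_extend F z) = 0"
      unfolding frag_extend_cmul[symmetric] eq by (rule F_square, rule frags_mono[OF y]) auto
    then have dz: "frag_extend F z = 0" using n by simp
    obtain y0 zb where yzb: "y0\<in>frags (below G0 lev \<kappa>)" "zb \<in> frags (level Gb lev \<kappa>)"
       "z = zb + frag_extend F y0" "frag_extend F0 zb = 0"
      using reduce[OF z dz] by blast
    define w where "w = y - frag_cmul n y0"
    have w: "w \<in> frags (below (G0 \<union> G1) lev \<kappa>)"
      unfolding w_def by (intro frags_diff frags_cmul y sub(5)[OF yzb(1)])
    have Fw: "frag_extend F w = frag_cmul n zb"
      using eq yzb(3) by (simp add: w_def frag_extend_simps frag_cmul_distrib2 algebra_simps)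
    \<comment> \<open>The same reduction for \<open>w\<close>, which need not be closed: it suffices
      that its boundary lies in \<open>Gb\<close>, so that the component of this boundary in
      \<open>G1\<close> is zero.\<close>
    have "\<exists>u \<in> frags (below Gb lev \<kappa>). frag_cmul n zb = frag_extend F0 u"
    proof -
      obtain w0 w1 where w01: "w0 \<in> frags (below G0 lev \<kappa>)" "w1 \<in> frags (below G1 lev \<kappa>)" "w = w0 + w1"
        by (rule split_level[OF w])
      \<comment> \<open>For \<kappa> = 0 no generator lies below, and \<open>w1\<close>
        vanishes.\<close>
      obtain M where M: "\<kappa> = Suc M \<or> w1 = 0"
        using w01(2) by (cases \<kappa>) auto
      define t where "t = frag_extend h w1"
      have t: "t \<in> frags {g \<in> Ga. Suc (Suc (lev g)) = \<kappa>}"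
        using M w01(2) h_level[of w1 M] by (auto simp: t_def)
      then have tG0: "t \<in> frags G0" "t \<in> frags (G0 \<union> G1)" using G0 by (auto elim!: frags_mono)
      have "frag_extend f t = w1" using fh[OF in_G(2)[OF w01(2)]] by (simp add: t_def)
      define w' where "w' = w0 - frag_extend F0 t"
      have "frag_extend F0 t \<in> frags (below G0 lev \<kappa>)"
        using t by (rule frags_extend) (use F0_lev G0 in auto)
      then have w': "w' \<in> frags (below G0 lev \<kappa>)"
        using w01 by (auto simp: w'_def intro: frags_diff)
      have "w = w' + frag_extend F t"
        using w01 ext_G0[OF tG0(1)] \<open>frag_extend f t = w1\<close> by (simp add: w'_def)
      then have Fw': "frag_extend F w' = frag_cmul n zb"
        using Fw F_square[OF tG0(2)] by (simp add: frag_extend_simps)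
      then have 1: "frag_cmul n zb = frag_extend F0 w'" "0 = frag_extend f w'"
        using components_eq[OF frags_cmul[OF in_G(1)[OF sub(2)[OF yzb(2)]]] frags_0 in_G(1)[OF w'] frags_0, of n]
        by auto
      obtain wa wb where wab: "wa \<in> frags (below Ga lev \<kappa>)" "wb \<in> frags (below Gb lev \<kappa>)" "w' = wa + wb"
        using split_b[OF w'] by blast
      have "frag_extend f wa = 0"
        using 1(2) wab(3) fb0[OF sub(4)[OF wab(2)]] by (simp add: frag_extend_simps)
      then have "wa = 0"
        using hf[OF sub(3)[OF wab(1)]] by simp
      with wab 1 show ?thesis by (metis add_0)
    qed
    then obtain u where u: "u \<in> frags (below Gb lev \<kappa>)" "zb = frag_extend F0 u"
      using thin_torsion_free[OF tb n yzb(2)] by blast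
    have "z = frag_extend F (u + y0)"
      using yzb(3) u(2) Fb[OF sub(4)[OF u(1)]] by (simp add: frag_extend_simps)
    moreover have "u + y0 \<in> frags (below (G0 \<union> G1) lev \<kappa>)"
      by (intro frags_add sub(5)[OF sub(2)[OF u(1)]] sub(5)[OF yzb(1)])
    ultimately show "\<exists>y'\<in>frags (below (G0 \<union> G1) lev \<kappa>). z = frag_extend F y'" by blast
  qed
qed

end

text \<open>A relabelling of generators that lowers the level by one. It is used to trade a label
  \<open>x\<close> at a cut-off vertex for a base point.\<close>

lemma thin_transport:
  assumes \<phi>: "bij_betw \<phi> G G'"
    and lev: "\<And>g. g \<in> G \<Longrightarrow> lev g = Suc (lev' (\<phi> g))"
    and F: "\<And>g. g \<in> G \<Longrightarrow> F g \<in> frags G \<and> frag_extend (frag_of \<circ> \<phi>) (F g) = F' (\<phi> g)"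
    and t: "thin G' lev' \<kappa> F'"
  shows "thin G lev (Suc \<kappa>) F"
proof -
  define \<psi> where "\<psi> = inv_into G \<phi>"
  have \<psi>: "\<psi> g \<in> G" "\<phi> (\<psi> g) = g" if "g \<in> G'" for g
    using that \<phi> by (auto simp: \<psi>_def bij_betw_def inv_into_into f_inv_into_f)
  have \<psi>\<phi>: "\<psi> (\<phi> g) = g" "\<phi> g \<in> G'" if "g \<in> G" for g
    using that \<phi> by (auto simp: \<psi>_def bij_betw_def)
  let ?p = "frag_extend (frag_of \<circ> \<phi>)" and ?q = "frag_extend (frag_of \<circ> \<psi>)"
  have pq: "?p (?q z) = z" if "z \<in> frags G'" for z
    unfolding extend_compose using that by (rule extend_id) (simp add: \<psi>)
  have qp: "?q (?p z) = z" if "z \<in> frags G" for z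
    unfolding extend_compose using that by (rule extend_id) (simp add: \<psi>\<phi>)
  have p: "?p z \<in> frags (level G' lev' N)" if "z \<in> frags (level G lev (Suc N))" for z N
    using that by (rule frags_extend) (auto simp: \<psi>\<phi> lev)
  have q: "?q z \<in> frags (level G lev (Suc N))" if "z \<in> frags (level G' lev' N)" for z N
    using that by (rule frags_extend) (auto simp: \<psi> lev)
  have q': "?q z \<in> frags (below G lev (Suc N))" if "z \<in> frags (below G' lev' N)" for z N
    using that by (rule frags_extend) (auto simp: \<psi> lev)
  have p': "?p z \<in> frags (below G' lev' N)" if "z \<in> frags (below G lev (Suc N))" for z N
    using that by (rule frags_extend) (auto simp: \<psi>\<phi> lev)
  have pF: "?p (frag_extend F z) = frag_extend F' (?p z)" if "z \<in> frags G" for z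
    unfolding extend_compose using that by (rule extend_cong) (simp add: F)
  have inG: "z \<in> frags {g \<in> G. P g} \<Longrightarrow> z \<in> frags G" "z' \<in> frags {g \<in> G'. Q g} \<Longrightarrow> z' \<in> frags G'"
    for z z' P Q by (auto elim: frags_mono)
  have FG: "frag_extend F z \<in> frags G" if "z \<in> frags G" for z
    using that by (rule frags_extend) (simp add: F)
  have lift: "z = frag_extend F (?q y)" if "z \<in> frags G" "y \<in> frags G'" "?p z = frag_extend F' y" for z y
  proof -
    have 1: "?q y \<in> frags G" using that(2) by (rule frags_extend) (simp add: \<psi>)
    then have "?p (frag_extend F (?q y)) = ?p z" using that pF pq by simp
    then show ?thesis using qp that FG 1 by metis
  qed
  show ?thesis
    unfolding thin_def
  proof (intro conjI allI impI)
    fix N z assume N: "N \<noteq> Suc \<kappa>" and z: "z \<in> frags (level G lev N)" and dz: "frag_extend F z = 0"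
    show "\<exists>y\<in>frags (below G lev N). z = frag_extend F y"
    proof (cases N)
      case 0
      have "level G lev N = {}" using lev 0 by auto
      then have "z = 0" using z by (metis frags_empty singletonD)
      then show ?thesis by (auto intro!: bexI[of _ 0])
    next
      case (Suc M)
      have 1: "M \<noteq> \<kappa>" using N Suc by simp
      have 2: "?p z \<in> frags (level G' lev' M)" by (rule p) (use z Suc in simp)
      have 3: "frag_extend F' (?p z) = 0" using pF[OF inG(1)[OF z]] dz by simp
      obtain y where y: "y \<in> frags (below G' lev' M)" "?p z = frag_extend F' y"
        by (rule thin_exact[OF t 1 2 3])
      show ?thesis
        using lift[OF inG(1)[OF z] inG(2)[OF y(1)] y(2)] q'[OF y(1)] Suc by auto
    qed
  next
    fix z y and n :: int
    assume n: "0 < n" and z: "z \<in> frags (level G lev (Suc \<kappa>))"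
      and y: "y \<in> frags (below G lev (Suc \<kappa>))" and eq: "frag_cmul n z = frag_extend F y"
    have "frag_cmul n (?p z) = frag_extend F' (?p y)"
      using pF[OF inG(1)[OF y]] eq by (metis frag_extend_cmul)
    from thin_torsion_free[OF t n p[OF z] p'[OF y] this]
    obtain y' where y': "y' \<in> frags (below G' lev' \<kappa>)" "?p z = frag_extend F' y'" .
    then show "\<exists>y'\<in>frags (below G lev (Suc \<kappa>)). z = frag_extend F y'"
      using lift[OF inG(1)[OF z] inG(2)[OF y'(1)] y'(2)] q'[OF y'(1)] by auto
  qed
qed

section \<open>The chromatic complex of a graph\<close>

text \<open>Swapping the indices negates the sum, and a chain equal to its own negative is
  zero.\<close>

lemma sum_antisym_eq_0:
  fixes F :: "nat \<Rightarrow> nat \<Rightarrow> 'g \<Rightarrow>\<^sub>0 int"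
  assumes "finite A" "\<And>r s. r \<in> A \<Longrightarrow> s \<in> A \<Longrightarrow> r \<noteq> s \<Longrightarrow> F r s = - F s r"
  shows "(\<Sum>r\<in>A. \<Sum>s\<in>A - {r}. F r s) = 0"
proof -
  let ?T = "{(r, s). r \<in> A \<and> s \<in> A \<and> r \<noteq> s}"
  have T: "?T = Sigma A (\<lambda>r. A - {r})" by auto
  have fin: "finite ?T" using assms(1) unfolding T by blast
  have 1: "(\<Sum>r\<in>A. \<Sum>s\<in>A - {r}. F r s) = (\<Sum>(r, s)\<in>?T. F r s)"
    unfolding T using assms(1) by (subst sum.Sigma) auto
  have "(\<Sum>(r, s)\<in>?T. F r s) = (\<Sum>(r, s)\<in>?T. F s r)"
    by (rule sum.reindex_bij_witness[of _ "\<lambda>(r, s). (s, r)" "\<lambda>(r, s). (s, r)"]) auto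
  also have "\<dots> = (\<Sum>(r, s)\<in>?T. - F r s)"
    by (rule sum.cong) (use assms(2) in auto)
  also have "\<dots> = - (\<Sum>(r, s)\<in>?T. F r s)"
    by (simp add: sum_negf case_prod_unfold)
  finally have "(\<Sum>(r, s)\<in>?T. F r s) = - (\<Sum>(r, s)\<in>?T. F r s)" .
  then have "(\<Sum>(r, s)\<in>?T. F r s) + (\<Sum>(r, s)\<in>?T. F r s) = 0"
    by (simp only: eq_neg_iff_add_eq_0)
  then have "frag_cmul 2 (\<Sum>(r, s)\<in>?T. F r s) = 0"
    by (simp only: frag_cmul_2)
  then show ?thesis using 1 by simp
qed

text \<open>The sign of the cube edge that adds \<open>r\<close>, as in the Khovanov
  differential.\<close>

definition esign :: "nat set \<Rightarrow> nat \<Rightarrow> int" where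
  "esign P r = (-1) ^ card {l \<in> P. l < r}"

lemma esign_square [simp]: "esign P r * esign P r = 1"
  by (simp add: esign_def flip: power_add mult_2)

lemma esign_insert:
  assumes "finite P" "s \<notin> P"
  shows "esign (insert s P) r = (if s < r then - esign P r else esign P r)"
proof -
  have "{l \<in> insert s P. l < r} = (if s < r then insert s {l \<in> P. l < r} else {l \<in> P. l < r})"
    by auto
  then show ?thesis using assms by (auto simp: esign_def)
qed

text \<open>Exactly one of two distinct edges precedes the other, so exactly one of the two
  insertions flips a sign.\<close>

lemma esign_anticommute:
  assumes "finite P" "r \<notin> P" "s \<notin> P" "r \<noteq> s"
  shows "esign P r * esign (insert r P) s = - (esign P s * esign (insert s P) r)"
  using assms by (auto simp: esign_insert)

text \<open>
  The edge \<open>r\<close> joins \<open>a r\<close> to \<open>b r\<close>; vertices related by \<open>R0\<close> are identified from the start.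
  The components of the spanning subgraph with edge set \<open>P\<close> are the classes of \<open>eq P\<close>.  A pair \<open>(P, W)\<close>
  stands for the pure tensor at \<open>P\<close> with \<open>x\<close> on the components contained in \<open>W\<close> and \<open>1\<close> on all others.
\<close>

locale graph =
  fixes R0 :: "('v \<times> 'v) set" and a b :: "nat \<Rightarrow> 'v"
begin

section \<open>Connectivity in spanning subgraphs\<close>

definition gen :: "nat set \<Rightarrow> ('v \<times> 'v) set" where
  "gen P = R0 \<union> (\<lambda>r. (a r, b r)) ` P"

definition eq :: "nat set \<Rightarrow> ('v \<times> 'v) set" where
  "eq P = (gen P \<union> (gen P)\<inverse>)\<^sup>*"

text \<open>Unions of components. A set of labelled components is encoded by its union, so that
  labels are carried along under added edges by taking the closure, without bookkeeping of
  classes.\<close>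

definition closed :: "nat set \<Rightarrow> 'v set \<Rightarrow> bool" where
  "closed P W \<longleftrightarrow> (\<forall>x y. (x, y) \<in> eq P \<longrightarrow> x \<in> W \<longrightarrow> y \<in> W)"

lemma eq_refl [simp]: "(x, x) \<in> eq P"
  by (simp add: eq_def)

lemma eq_trans: "(x, y) \<in> eq P \<Longrightarrow> (y, z) \<in> eq P \<Longrightarrow> (x, z) \<in> eq P"
  by (simp add: eq_def)

lemma eq_sym: "(x, y) \<in> eq P \<Longrightarrow> (y, x) \<in> eq P"
  unfolding eq_def by (rule symD[OF sym_rtrancl[OF sym_Un_converse]])

lemma eq_mono: "P \<subseteq> Q \<Longrightarrow> (x, y) \<in> eq P \<Longrightarrow> (x, y) \<in> eq Q"
proof -
  assume "P \<subseteq> Q"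
  then have "gen P \<union> (gen P)\<inverse> \<subseteq> gen Q \<union> (gen Q)\<inverse>" by (auto simp: gen_def)
  then show "(x, y) \<in> eq P \<Longrightarrow> (x, y) \<in> eq Q" unfolding eq_def using rtrancl_mono by blast
qed

lemma eq_edge: "r \<in> P \<Longrightarrow> (a r, b r) \<in> eq P"
  by (auto simp: eq_def gen_def)

lemma eq_classI: "(x, y) \<in> eq P \<Longrightarrow> eq P `` {x} = eq P `` {y}"
  by (auto intro: eq_sym eq_trans)

lemma eq_class_iff: "eq P `` {x} = eq P `` {y} \<longleftrightarrow> (x, y) \<in> eq P"
  using eq_refl[of y P] eq_classI by (metis Image_singleton_iff)

lemma eq_least:
  assumes "gen P \<subseteq> S" "\<And>x. (x, x) \<in> S" "\<And>x y. (x, y) \<in> S \<Longrightarrow> (y, x) \<in> S"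
    "\<And>x y z. (x, y) \<in> S \<Longrightarrow> (y, z) \<in> S \<Longrightarrow> (x, z) \<in> S" "(x, y) \<in> eq P"
  shows "(x, y) \<in> S"
  using assms(5) unfolding eq_def
proof (induction rule: rtrancl_induct)
  case (step y z)
  then show ?case using assms by blast
qed (rule assms(2))

lemma closedI: "(\<And>x y. (x, y) \<in> gen P \<Longrightarrow> x \<in> W \<longleftrightarrow> y \<in> W) \<Longrightarrow> closed P W"
  unfolding closed_def
  using eq_least[of P "{(x, y). x \<in> W \<longleftrightarrow> y \<in> W}"] by blast

lemma closedD: "closed P W \<Longrightarrow> (x, y) \<in> eq P \<Longrightarrow> x \<in> W \<longleftrightarrow> y \<in> W"
  unfolding closed_def using eq_sym by blast

lemma closed_mono: "closed Q W \<Longrightarrow> P \<subseteq> Q \<Longrightarrow> closed P W"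
  unfolding closed_def using eq_mono by blast

lemma closed_Un: "closed P W \<Longrightarrow> closed P W' \<Longrightarrow> closed P (W \<union> W')"
  by (auto simp: closed_def)

lemma closed_Int: "closed P W \<Longrightarrow> closed P W' \<Longrightarrow> closed P (W \<inter> W')"
  by (auto simp: closed_def)

lemma closed_Diff: "closed P W \<Longrightarrow> closed P W' \<Longrightarrow> closed P (W - W')"
  unfolding closed_def using eq_sym by blast

lemma closed_Image: "closed P (eq P `` W)"
  unfolding closed_def using eq_trans by blast

lemma Image_closed: "closed P W \<Longrightarrow> eq P `` W = W"
  by (auto simp: closed_def intro: ImageI[OF eq_refl])

lemma Image_subset: "closed P W' \<Longrightarrow> W \<subseteq> W' \<Longrightarrow> eq P `` W \<subseteq> W'"
  by (auto simp: closed_def)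

lemma Image_superset: "W \<subseteq> eq P `` W"
  by (auto intro: ImageI[OF eq_refl])

lemma Image_Image: "P \<subseteq> Q \<Longrightarrow> eq Q `` (eq P `` W) = eq Q `` W"
proof (intro equalityI subsetI)
  assume "P \<subseteq> Q"
  then show "x \<in> eq Q `` W" if "x \<in> eq Q `` (eq P `` W)" for x
    using that by (auto intro: ImageI[OF eq_trans[OF eq_mono]])
  show "x \<in> eq Q `` (eq P `` W)" if "x \<in> eq Q `` W" for x
    using that Image_superset[of W P] by blast
qed

lemma closed_insert: "closed (insert r P) W \<longleftrightarrow> closed P W \<and> (a r \<in> W \<longleftrightarrow> b r \<in> W)"
proof
  assume "closed (insert r P) W"
  then show "closed P W \<and> (a r \<in> W \<longleftrightarrow> b r \<in> W)"
    using closed_mono[of "insert r P" W P] closedD[of "insert r P" W "a r" "b r"] eq_edge by blast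
next
  assume *: "closed P W \<and> (a r \<in> W \<longleftrightarrow> b r \<in> W)"
  show "closed (insert r P) W"
  proof (rule closedI)
    fix x y assume "(x, y) \<in> gen (insert r P)"
    then consider "x = a r \<and> y = b r" | "(x, y) \<in> gen P" by (auto simp: gen_def)
    then show "x \<in> W \<longleftrightarrow> y \<in> W"
    proof cases
      case 2
      then have "(x, y) \<in> eq P" by (auto simp: eq_def)
      then show ?thesis using * closedD by blast
    qed (use * in auto)
  qed
qed

text \<open>A connection uses the new edge at most once. Instead of shortening paths, the set of all
  \<open>y\<close> described on the right is shown to be closed under the enlarged relation; it
  contains \<open>x\<close>, hence its whole class.\<close>

lemma eq_insert_iff:
  "(x, y) \<in> eq (insert r P) \<longleftrightarrow> (x, y) \<in> eq P \<or> (x, a r) \<in> eq P \<and> (b r, y) \<in> eq P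
     \<or> (x, b r) \<in> eq P \<and> (a r, y) \<in> eq P"
proof
  let ?W = "{y. (x, y) \<in> eq P \<or> (x, a r) \<in> eq P \<and> (b r, y) \<in> eq P \<or> (x, b r) \<in> eq P \<and> (a r, y) \<in> eq P}"
  have "closed P ?W" unfolding closed_def using eq_trans by blast
  moreover have "a r \<in> ?W \<longleftrightarrow> b r \<in> ?W" using eq_refl eq_sym eq_trans by blast
  ultimately have "closed (insert r P) ?W" by (simp add: closed_insert)
  moreover have "x \<in> ?W" by simp
  moreover assume "(x, y) \<in> eq (insert r P)"
  ultimately have "y \<in> ?W" unfolding closed_def by blast
  then show "(x, y) \<in> eq P \<or> (x, a r) \<in> eq P \<and> (b r, y) \<in> eq P \<or> (x, b r) \<in> eq P \<and> (a r, y) \<in> eq P"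
    by simp
next
  have "(a r, b r) \<in> eq (insert r P)" by (simp add: eq_edge)
  moreover have "\<And>x y. (x, y) \<in> eq P \<Longrightarrow> (x, y) \<in> eq (insert r P)" by (rule eq_mono) auto
  moreover assume "(x, y) \<in> eq P \<or> (x, a r) \<in> eq P \<and> (b r, y) \<in> eq P \<or> (x, b r) \<in> eq P \<and> (a r, y) \<in> eq P"
  ultimately show "(x, y) \<in> eq (insert r P)"
    using eq_trans eq_sym by meson
qed

lemma eq_insert_loop: "(a r, b r) \<in> eq P \<Longrightarrow> eq (insert r P) = eq P"
  by (auto simp: eq_insert_iff) (meson eq_trans eq_sym)+

section \<open>Numbers of components\<close>

definition ncomp :: "nat set \<Rightarrow> 'v set \<Rightarrow> nat" where
  "ncomp P W = card (W // eq P)"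

text \<open>Adding edges maps components onto components. The counts before and after are compared
  through this map: they agree iff it is injective.\<close>

lemma quotient_Image:
  assumes "P \<subseteq> Q"
  shows "(eq Q `` W) // eq Q = (\<lambda>K. eq Q `` K) ` (W // eq P)"
proof -
  have "eq Q `` (eq P `` {x}) = eq Q `` {x}" for x using Image_Image[OF assms] .
  then have "(\<lambda>K. eq Q `` K) ` (W // eq P) = {eq Q `` {x} | x. x \<in> W}"
    by (auto simp: quotient_def image_iff)
  also have "\<dots> = (eq Q `` W) // eq Q"
    by (auto simp: quotient_def) (metis eq_classI ImageI eq_refl)+
  finally show ?thesis ..
qed

lemma finite_quotient_eq: "finite W \<Longrightarrow> finite (W // eq P)"
  by (simp add: quotient_def)

lemma ncomp_Image_le: "finite W \<Longrightarrow> P \<subseteq> Q \<Longrightarrow> ncomp Q (eq Q `` W) \<le> ncomp P W"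
  unfolding ncomp_def quotient_Image by (rule card_image_le) (rule finite_quotient_eq)

lemma ncomp_Un:
  assumes "finite W" "finite W'" "closed P W" "closed P W'" "W \<inter> W' = {}"
  shows "ncomp P (W \<union> W') = ncomp P W + ncomp P W'"
proof -
  have "(W \<union> W') // eq P = W // eq P \<union> W' // eq P" by (auto simp: quotient_def)
  moreover have "W // eq P \<inter> W' // eq P = {}"
  proof -
    have "K \<subseteq> W" if "K \<in> W // eq P" for K using that assms(3) by (auto simp: quotient_def closed_def)
    moreover have "K \<subseteq> W'" if "K \<in> W' // eq P" for K using that assms(4) by (auto simp: quotient_def closed_def)
    moreover have "K \<noteq> {}" if "K \<in> W // eq P" for K using that by (auto simp: quotient_def intro: eq_refl)
    ultimately show ?thesis using assms(5) by fast
  qed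
  ultimately show ?thesis
    unfolding ncomp_def using assms(1,2) by (simp add: card_Un_disjoint finite_quotient_eq)
qed

lemma ncomp_class [simp]: "ncomp P (eq P `` {x}) = 1"
proof -
  have "(eq P `` {x}) // eq P = {eq P `` {x}}"
  proof -
    have "eq P `` {y} = eq P `` {x}" if "y \<in> eq P `` {x}" for y
      using that eq_classI[of x y P] by simp
    then have "(\<lambda>y. eq P `` {y}) ` (eq P `` {x}) = {eq P `` {x}}"
      by (intro equalityI subsetI) (auto simp: image_iff simp del: Image_singleton_iff
          intro!: bexI[of _ x] ImageI[OF eq_refl])
    then show ?thesis unfolding quotient_def UNION_singleton_eq_range .
  qed
  then show ?thesis by (simp add: ncomp_def)
qed

lemma ncomp_eq: "eq P = eq Q \<Longrightarrow> ncomp P W = ncomp Q W"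
  by (simp add: ncomp_def)

text \<open>
  The multiplication of the components that \<open>Q\<close> joins, for the relations \<open>x\<^sup>2 = t x\<close>, and \<open>x = 0\<close> on
  components which meet the base set \<open>B\<close>.  Note that \<open>0 ^ 0 = 1\<close>.
\<close>

definition push :: "int \<Rightarrow> 'v set \<Rightarrow> nat set \<Rightarrow> nat set \<times> 'v set \<Rightarrow> (nat set \<times> 'v set) \<Rightarrow>\<^sub>0 int" where
  "push t B Q = (\<lambda>(P, W). let W' = eq Q `` W in
     if W' \<inter> B = {} then frag_cmul (t ^ (ncomp P W - ncomp Q W')) (frag_of (Q, W')) else 0)"

definition diff :: "int \<Rightarrow> nat set \<Rightarrow> 'v set \<Rightarrow> nat set \<times> 'v set \<Rightarrow> (nat set \<times> 'v set) \<Rightarrow>\<^sub>0 int" where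
  "diff t U B = (\<lambda>(P, W). \<Sum>r\<in>U - P. frag_cmul (esign P r) (push t B (insert r P) (P, W)))"

definition gens :: "'v set \<Rightarrow> nat set \<Rightarrow> nat set \<Rightarrow> 'v set \<Rightarrow> (nat set \<times> 'v set) set" where
  "gens V J U B = {(P, W). J \<subseteq> P \<and> P \<subseteq> U \<and> W \<subseteq> V \<and> closed P W \<and> W \<inter> B = {}}"

definition lev :: "nat set \<times> 'v set \<Rightarrow> nat" where
  "lev = (\<lambda>(P, W). card P + ncomp P W)"

text \<open>The exponent of \<open>t\<close> counts lost labels, and losses add up along successive
  merges. A label that has reached \<open>B\<close> stays there.\<close>

lemma push_push:
  assumes "finite W" "P \<subseteq> Q" "Q \<subseteq> Q'" "finite (eq Q `` W)"
  shows "frag_extend (push t B Q') (push t B Q (P, W)) = push t B Q' (P, W)"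
proof (cases "eq Q `` W \<inter> B = {}")
  case True
  have 1: "eq Q' `` (eq Q `` W) = eq Q' `` W" using Image_Image[OF assms(3)] .
  have 2: "ncomp Q' (eq Q' `` W) \<le> ncomp Q (eq Q `` W)"
    using ncomp_Image_le[OF assms(4,3)] 1 by simp
  have 3: "ncomp Q (eq Q `` W) \<le> ncomp P W"
    using ncomp_Image_le[OF assms(1,2)] .
  show ?thesis
    using True 1 2 3 by (auto simp: push_def Let_def frag_extend_simps simp flip: power_add)
next
  case False
  have "eq Q `` W \<subseteq> eq Q' `` W" using eq_mono[OF assms(3)] by blast
  then have "eq Q' `` W \<inter> B \<noteq> {}" using False by blast
  then show ?thesis using False by (auto simp: push_def Let_def)
qed

lemma push_cases:
  obtains c where "push t B Q (P, W) = frag_cmul c (frag_of (Q, eq Q `` W))" "eq Q `` W \<inter> B = {}"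
  | "push t B Q (P, W) = 0"
  by (cases "eq Q `` W \<inter> B = {}") (auto simp: push_def Let_def)

section \<open>The graded complex\<close>

context
  fixes V :: "'v set" and J U :: "nat set" and B :: "'v set"
  assumes fin: "finite V" "finite U" and V: "closed U V"
begin

lemma gens_Image: "(P, W) \<in> gens V J U B \<Longrightarrow> Q \<subseteq> U \<Longrightarrow> eq Q `` W \<subseteq> V"
  by (rule Image_subset[OF closed_mono[OF V]]) (auto simp: gens_def)

lemma finite_gens_W: "(P, W) \<in> gens V J U B \<Longrightarrow> finite W"
  using fin(1) finite_subset by (auto simp: gens_def)

lemma push_in_gens:
  "(P, W) \<in> gens V J U B \<Longrightarrow> P \<subseteq> Q \<Longrightarrow> Q \<subseteq> U \<Longrightarrow> push t B Q (P, W) \<in> frags (gens V J U B)"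
  by (rule push_cases[of t B Q P W])
     (use gens_Image[of P W Q] in \<open>auto intro!: frags_cmul simp: gens_def closed_Image\<close>)

lemma diff_in_gens: "g \<in> gens V J U B \<Longrightarrow> diff t U B g \<in> frags (gens V J U B)"
  by (cases g) (auto simp: diff_def intro!: frags_sum frags_cmul push_in_gens, auto simp: gens_def)

text \<open>Adding two edges in either order gives the same multiplication by
  \<open>push_push\<close>, while the signs are opposite.\<close>

lemma diff_square:
  assumes g: "g \<in> gens V J U B"
  shows "frag_extend (diff t U B) (diff t U B g) = 0"
proof -
  obtain P W where [simp]: "g = (P, W)" by (cases g)
  have P: "P \<subseteq> U" and W: "finite W" using g finite_gens_W by (auto simp: gens_def)
  have finP: "finite P" using P fin finite_subset by blast
  have 1: "frag_extend (diff t U B) (push t B (insert r P) g) =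
      (\<Sum>s\<in>U - P - {r}. frag_cmul (esign (insert r P) s) (push t B (insert s (insert r P)) g))"
    if r: "r \<in> U - P" for r
  proof -
    have fin2: "finite (eq (insert r P) `` W)"
      using gens_Image[of P W "insert r P"] g r P fin finite_subset by fastforce
    \<comment> \<open>The index set of the sum in \<open>diff\<close> depends on the generator. It
      is constant here because all generators in the chain share the edge set
      \<open>insert r P\<close>.\<close>
    have "frag_extend (diff t U B) (push t B (insert r P) g) =
      frag_extend (\<lambda>h. \<Sum>s\<in>U - P - {r}. frag_cmul (esign (insert r P) s) (push t B (insert s (insert r P)) h))
        (push t B (insert r P) g)"
    proof (rule extend_cong)
      show "push t B (insert r P) g \<in> frags {(insert r P, W') |W'. True}"
        by (auto simp: push_def Let_def intro!: frags_cmul)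
      have "U - insert r P = U - P - {r}" by auto
      then show "diff t U B h = (\<Sum>s\<in>U - P - {r}. frag_cmul (esign (insert r P) s) (push t B (insert s (insert r P)) h))"
        if "h \<in> {(insert r P, W') |W'. True}" for h
        using that by (elim CollectE exE conjE) (simp only: diff_def prod.case)
    qed
    also have "\<dots> = (\<Sum>s\<in>U - P - {r}. frag_cmul (esign (insert r P) s)
        (frag_extend (push t B (insert s (insert r P))) (push t B (insert r P) g)))"
      by (simp add: frag_extend_def frag_cmul_sum sum.swap[of _ "U - P - {r}"] mult.commute)
    also have "\<dots> = (\<Sum>s\<in>U - P - {r}. frag_cmul (esign (insert r P) s) (push t B (insert s (insert r P)) g))"
    proof -
      have "frag_extend (push t B (insert s (insert r P))) (push t B (insert r P) g) = push t B (insert s (insert r P)) g" for s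
        unfolding \<open>g = (P, W)\<close> by (rule push_push[OF W _ _ fin2]) auto
      then show ?thesis by simp
    qed
    finally show ?thesis .
  qed
  have "frag_extend (diff t U B) (diff t U B g) =
      (\<Sum>r\<in>U - P. frag_cmul (esign P r) (frag_extend (diff t U B) (push t B (insert r P) g)))"
    using fin by (simp add: diff_def frag_extend_sum frag_extend_simps comp_def)
  also have "\<dots> = (\<Sum>r\<in>U - P. \<Sum>s\<in>U - P - {r}.
      frag_cmul (esign P r * esign (insert r P) s) (push t B (insert s (insert r P)) g))"
    by (rule sum.cong) (simp_all only: 1 frag_cmul_sum frag_cmul_cmul)
  also have "\<dots> = 0"
  proof (rule sum_antisym_eq_0)
    show "finite (U - P)" using fin by simp
    fix r s assume rs: "r \<in> U - P" "s \<in> U - P" "r \<noteq> s"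
    then show "frag_cmul (esign P r * esign (insert r P) s) (push t B (insert s (insert r P)) g) =
       - frag_cmul (esign P s * esign (insert s P) r) (push t B (insert r (insert s P)) g)"
      using esign_anticommute[OF finP, of r s] by (simp add: insert_commute)
  qed
  finally show ?thesis .
qed

text \<open>For t = 0 a surviving term has lost no label and has gained one edge.\<close>

lemma push_0_level:
  assumes "(P, W) \<in> gens V J U B" "r \<in> U - P"
  shows "push 0 B (insert r P) (P, W) \<in> frags (level (gens V J U B) lev (Suc (lev (P, W))))"
proof -
  let ?Q = "insert r P"
  have "ncomp ?Q (eq ?Q `` W) \<le> ncomp P W"
    using ncomp_Image_le finite_gens_W[OF assms(1)] by blast
  moreover have "(?Q, eq ?Q `` W) \<in> gens V J U B" if "eq ?Q `` W \<inter> B = {}"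
    using that assms gens_Image[OF assms(1), of ?Q] by (auto simp: gens_def closed_Image)
  moreover have "card ?Q = Suc (card P)"
    using assms fin finite_subset by (auto simp: gens_def intro!: card_insert_disjoint)
  ultimately show ?thesis
    by (auto simp: push_def Let_def power_0_left lev_def intro!: frags_cmul)
qed

lemma graded_diff: "graded_differential (gens V J U B) lev (diff 0 U B)"
  unfolding graded_differential_def
proof (intro ballI conjI)
  fix g assume g: "g \<in> gens V J U B"
  show "frag_extend (diff 0 U B) (diff 0 U B g) = 0" by (rule diff_square[OF g])
  show "diff 0 U B g \<in> frags (level (gens V J U B) lev (Suc (lev g)))"
    using g push_0_level by (cases g) (auto simp: diff_def intro!: frags_sum frags_cmul)
qed

end

end

context graph
begin

section \<open>Deletion and contraction\<close>

text \<open>In \<open>gens V J U B\<close> the edges in \<open>J\<close> are contracted and those outside \<open>U\<close> deleted.\<close>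

definition corank :: "'v set \<Rightarrow> nat set \<Rightarrow> 'v set \<Rightarrow> nat" where
  "corank V J B = card J + ncomp J (V - eq J `` B)"

lemma gens_delete_contract:
  assumes "e \<in> U" "e \<notin> J"
  shows "gens V J U B = gens V J (U - {e}) B \<union> gens V (insert e J) U B"
    "gens V J (U - {e}) B \<inter> gens V (insert e J) U B = {}"
  using assms by (auto simp: gens_def)

lemma diff_delete:
  assumes "finite U" "e \<in> U" "(P, W) \<in> gens V J (U - {e}) B"
  shows "diff t U B (P, W) = diff t (U - {e}) B (P, W) + frag_cmul (esign P e) (push t B (insert e P) (P, W))"
proof -
  have "U - P = insert e (U - {e} - P)" using assms by (auto simp: gens_def)
  then show ?thesis using assms by (simp add: diff_def add.commute)
qed

text \<open>The differential only adds edges, so the generators that contain \<open>e\<close> span a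
  subcomplex: contraction is the subcomplex and deletion the quotient.\<close>

lemma cone_edge:
  assumes fin: "finite V" "finite U" and V: "closed U V" and e: "e \<in> U" "e \<notin> J"
  shows "cone (gens V J (U - {e}) B) (gens V (insert e J) U B) lev (diff 0 U B) (diff 0 (U - {e}) B)
     (\<lambda>(P, W). frag_cmul (esign P e) (push 0 B (insert e P) (P, W)))"
proof unfold_locales
  note gd = gens_delete_contract[OF e, of V B]
  have V': "closed (U - {e}) V" using V by (rule closed_mono) auto
  have fin': "finite (U - {e})" using fin by simp
  show "gens V J (U - {e}) B \<inter> gens V (insert e J) U B = {}" by (rule gd)
  show "graded_differential (gens V J (U - {e}) B \<union> gens V (insert e J) U B) lev (diff 0 U B)"
    unfolding gd(1)[symmetric] by (rule graded_diff[OF fin V])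
  fix g assume g: "g \<in> gens V J (U - {e}) B"
  obtain P W where gPW: "g = (P, W)" by (cases g)
  show "diff 0 U B g = diff 0 (U - {e}) B g + (case g of (P, W) \<Rightarrow> frag_cmul (esign P e) (push 0 B (insert e P) (P, W)))"
    using diff_delete[OF fin(2) e(1)] g by (simp add: gPW)
  show "diff 0 (U - {e}) B g \<in> frags (level (gens V J (U - {e}) B) lev (Suc (lev g)))"
    using graded_diff[OF fin(1) fin' V'] g by (auto simp: graded_differential_def)
  have "(P, W) \<in> gens V J U B" "e \<in> U - P" using g e gd(1) by (auto simp: gPW gens_def)
  then have "push 0 B (insert e P) (P, W) \<in> frags (level (gens V J U B) lev (Suc (lev (P, W))))"
    by (rule push_0_level[OF fin V])
  moreover have "push 0 B (insert e P) (P, W) \<in> frags {(insert e P, W') |W'. True}"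
    by (auto simp: push_def Let_def intro!: frags_cmul)
  ultimately have "push 0 B (insert e P) (P, W) \<in> frags (level (gens V J U B) lev (Suc (lev (P, W))) \<inter> {(insert e P, W') |W'. True})"
    by (rule frags_Int)
  then have "push 0 B (insert e P) (P, W) \<in> frags (level (gens V (insert e J) U B) lev (Suc (lev (P, W))))"
    by (rule frags_mono) (auto simp: gens_def)
  then show "(case g of (P, W) \<Rightarrow> frag_cmul (esign P e) (push 0 B (insert e P) (P, W)))
      \<in> frags (level (gens V (insert e J) U B) lev (Suc (lev g)))"
    by (auto simp: gPW intro: frags_cmul)
next
  fix g assume g: "g \<in> gens V (insert e J) U B"
  show "diff 0 U B g \<in> frags (level (gens V (insert e J) U B) lev (Suc (lev g)))"
    using graded_diff[OF fin V] g by (auto simp: graded_differential_def)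
qed

text \<open>The base class absorbs exactly the component of \<open>q\<close>. Under contraction the
  new element of \<open>J\<close> makes up for that component; with \<open>q\<close> as a further
  base point nothing does.\<close>

lemma corank_contract:
  assumes fin: "finite V" "finite J" and V: "closed J V" and e: "e \<notin> J"
    and pq: "(a e = p \<and> b e = q) \<or> (a e = q \<and> b e = p)"
    and p: "p \<in> eq J `` B" and q: "q \<in> V" "q \<notin> eq J `` B"
  shows "corank V (insert e J) B = corank V J B" "corank V J B = Suc (corank V J (insert q B))"
proof -
  let ?K = "eq J `` {q}"
  have img: "eq (insert e J) `` B = eq J `` B \<union> ?K"
  proof (intro equalityI subsetI)
    fix y assume "y \<in> eq (insert e J) `` B"
    then show "y \<in> eq J `` B \<union> ?K"
      using pq q p by (auto simp: eq_insert_iff)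
  next
    fix y assume y: "y \<in> eq J `` B \<union> ?K"
    have m: "(x, z) \<in> eq (insert e J)" if "(x, z) \<in> eq J" for x z
      by (rule eq_mono[OF _ that]) auto
    have pq1: "(p, q) \<in> eq (insert e J)"
      using pq by (auto simp: eq_insert_iff)
    obtain \<beta> where "\<beta> \<in> B" "(\<beta>, p) \<in> eq J" using p by blast
    then show "y \<in> eq (insert e J) `` B"
      using y m eq_trans[OF eq_trans[OF m pq1] m, of \<beta> y] by auto
  qed
  have img2: "eq J `` (insert q B) = eq J `` B \<union> ?K" by auto
  have KV: "?K \<subseteq> V" by (rule Image_subset[OF V]) (use q in auto)
  have KB: "?K \<inter> eq J `` B = {}" using q closedD[OF closed_Image[of J B]] by blast
  let ?R = "V - (eq J `` B \<union> ?K)"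
  have cl: "closed J ?R" by (intro closed_Diff closed_Un closed_Image V)
  have "V - eq J `` B = ?R \<union> ?K" using KV KB by auto
  then have 1: "ncomp J (V - eq J `` B) = Suc (ncomp J ?R)"
    using ncomp_Un[of ?R ?K J] cl closed_Image[of J "{q}"] fin KV finite_subset[OF KV] by auto
  have "ncomp (insert e J) ?R = ncomp J ?R"
  proof -
    have "eq (insert e J) `` {x} = eq J `` {x}" if "x \<in> ?R" for x
    proof -
      have "(x, p) \<notin> eq J" "(x, q) \<notin> eq J"
        using that p closedD[OF closed_Image[of J B]] eq_sym by blast+
      then show ?thesis using pq by (auto simp: eq_insert_iff)
    qed
    then have "?R // eq (insert e J) = ?R // eq J" unfolding quotient_def by (intro SUP_cong) auto
    then show ?thesis by (simp add: ncomp_def)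
  qed
  then show "corank V (insert e J) B = corank V J B"
    using 1 fin e by (simp add: corank_def img)
  show "corank V J B = Suc (corank V J (insert q B))"
    using 1 by (simp add: corank_def img2)
qed

lemma thin_empty: "thin {} lv \<kappa> F"
  unfolding thin_def by simp

text \<open>Such an edge changes neither which label sets are closed nor how many components they
  have. The attaching map is therefore an isomorphism and the cone is acyclic, whence the conclusion
  for every \<kappa>.\<close>

lemma thin_loop:
  assumes fin: "finite V" "finite U" and V: "closed U V" and e: "e \<in> U" "e \<notin> J"
    and loop: "(a e, b e) \<in> eq J \<or> (a e \<in> eq J `` B \<and> b e \<in> eq J `` B)"
  shows "thin (gens V J U B) lev \<kappa> (diff 0 U B)"
proof -
  let ?\<phi> = "\<lambda>(P, W). (insert e P, W)"
  have same: "closed (insert e P) W" if "(P, W) \<in> gens V J U B" for P W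
  proof -
    have P: "J \<subseteq> P" "closed P W" "W \<inter> B = {}" using that by (auto simp: gens_def)
    have "x \<notin> W" if "x \<in> eq J `` B" for x
      using that P eq_mono[OF P(1)] closedD[OF P(2)] by blast
    then have "a e \<in> W \<longleftrightarrow> b e \<in> W"
      using loop eq_mono[OF P(1)] closedD[OF P(2)] by blast
    then show ?thesis using P by (simp add: closed_insert)
  qed
  have ncomp_same: "ncomp (insert e P) W = ncomp P W" if "(P, W) \<in> gens V J U B" for P W
  proof (cases "(a e, b e) \<in> eq J")
    case True
    have "J \<subseteq> P" using that by (auto simp: gens_def)
    then have "(a e, b e) \<in> eq P" using True eq_mono by blast
    then show ?thesis using eq_insert_loop ncomp_eq by metis
  next
    case False
    have P: "J \<subseteq> P" "closed P W" "W \<inter> B = {}" using that by (auto simp: gens_def)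
    have nW: "a e \<notin> W" "b e \<notin> W"
      using False loop P eq_mono[OF P(1)] closedD[OF P(2)] by blast+
    have "eq (insert e P) `` {x} = eq P `` {x}" if "x \<in> W" for x
      using that nW closedD[OF P(2)] by (auto simp: eq_insert_iff)
    then have "W // eq (insert e P) = W // eq P" unfolding quotient_def by (intro SUP_cong) auto
    then show ?thesis by (simp add: ncomp_def)
  qed
  interpret cone "gens V J (U - {e}) B" "gens V (insert e J) U B" lev \<kappa> "diff 0 U B" "diff 0 (U - {e}) B"
     "\<lambda>(P, W). frag_cmul (esign P e) (push 0 B (insert e P) (P, W))"
    by (rule cone_edge[OF fin V e])
  note gd = gens_delete_contract[OF e, of V B]
  show ?thesis
    unfolding gd(1)
  proof (rule thin_cancel[where Ga = "gens V J (U - {e}) B" and Gb = "{}" and \<phi> = ?\<phi> and s = "\<lambda>(P, W). esign P e"])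
    show "bij_betw ?\<phi> (gens V J (U - {e}) B) (gens V (insert e J) U B)"
    proof (rule bij_betw_byWitness[where f' = "\<lambda>(P, W). (P - {e}, W)"])
      show "?\<phi> ` gens V J (U - {e}) B \<subseteq> gens V (insert e J) U B"
      proof clarify
        fix P W assume g: "(P, W) \<in> gens V J (U - {e}) B"
        then have "(P, W) \<in> gens V J U B" by (auto simp: gens_def)
        then show "(insert e P, W) \<in> gens V (insert e J) U B"
          using same[of P W] e by (auto simp: gens_def)
      qed
      show "(\<lambda>(P, W). (P - {e}, W)) ` gens V (insert e J) U B \<subseteq> gens V J (U - {e}) B"
        using e by (auto simp: gens_def intro: closed_mono)
    qed (auto simp: gens_def)
    fix g assume g: "g \<in> gens V J (U - {e}) B"
    show "(case g of (P, W) \<Rightarrow> frag_cmul (esign P e) (push 0 B (insert e P) (P, W))) =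
         frag_cmul (case g of (P, W) \<Rightarrow> esign P e) (frag_of (?\<phi> g))"
    proof (cases g)
      case (Pair P W)
      have "(P, W) \<in> gens V J U B" "W \<inter> B = {}" using g gd(1) by (auto simp: Pair gens_def)
      then show ?thesis using same[of P W] ncomp_same[of P W]
        by (simp add: Pair push_def Image_closed)
    qed
  qed (auto simp: thin_empty)
qed

text \<open>Induction on the edges that are neither contracted nor deleted. Loops make the complex
  acyclic. Otherwise some edge leaves the base class. If its far end stays connected to the base
  without it, deletion and contraction both satisfy the hypotheses, with the same corank. If not,
  deletion cuts vertices off from the base, and cancellation takes the place of the exact
  sequence.\<close>

lemma thin_gens:
  assumes "finite V" "finite U" "J \<subseteq> U" "closed U V" "\<And>r. r \<in> U \<Longrightarrow> a r \<in> V \<and> b r \<in> V"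
    and "\<And>x. x \<in> V \<Longrightarrow> \<exists>\<beta>\<in>B. (x, \<beta>) \<in> eq U"
  shows "thin (gens V J U B) lev (corank V J B) (diff 0 U B)"
  using assms
proof (induction "card (U - J)" arbitrary: U J B rule: less_induct)
  case less
  note fin = less.prems(1,2) and JU = less.prems(3) and V = less.prems(4)
    and ends = less.prems(5) and base = less.prems(6)
  have finJ: "finite J" using JU fin(2) finite_subset by blast
  show ?case
  proof (cases "U = J")
    case True
    have base': "V - eq J `` B = {}" using base True eq_sym by blast
    \<comment> \<open>Every component meets the base, where labels are zero; at most one generator
      remains, with zero differential.\<close>
    have "gens V J U B \<subseteq> {(J, {})}"
      using base True closedD by (fastforce simp: gens_def)
    moreover have "diff 0 U B (J, {}) = 0" by (simp add: diff_def True)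
    moreover have "lev (J, {}) = corank V J B" by (simp add: lev_def corank_def base')
    ultimately have *: "\<And>g. g \<in> gens V J U B \<Longrightarrow> diff 0 U B g = 0 \<and> lev g = corank V J B" by auto
    have empty: "level (gens V J U B) lev N = {}" if "N \<noteq> corank V J B" for N
      using * that by auto
    show ?thesis
      unfolding thin_def
    proof (intro conjI allI impI)
      fix N z assume "N \<noteq> corank V J B" and z: "z \<in> frags (level (gens V J U B) lev N)"
      then have "level (gens V J U B) lev N = {}" by (intro empty)
      with z have "z = 0" by (simp only: frags_empty singleton_iff)
      then show "\<exists>y\<in>frags (below (gens V J U B) lev N). z = frag_extend (diff 0 U B) y"
        by (auto intro!: bexI[of _ 0])
    next
      fix z y and n :: int
      assume n: "0 < n" and "y \<in> frags (below (gens V J U B) lev (corank V J B))"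
        and eq: "frag_cmul n z = frag_extend (diff 0 U B) y"
      then have "frag_extend (diff 0 U B) y = 0" by (intro extend_eq_0) (auto simp: *)
      then have "z = 0" using eq n by simp
      then show "\<exists>y\<in>frags (below (gens V J U B) lev (corank V J B)). z = frag_extend (diff 0 U B) y"
        by (auto intro!: bexI[of _ 0])
    qed
  next
    case False
    show ?thesis
    proof (cases "\<exists>e\<in>U - J. (a e, b e) \<in> eq J \<or> (a e \<in> eq J `` B \<and> b e \<in> eq J `` B)")
      case True
      then show ?thesis using thin_loop[OF fin V] by blast
    next
      case noloop: False
      \<comment> \<open>Otherwise the base class is closed under all of \<open>U\<close> and thus
        contains \<open>V\<close>; a remaining edge would have both ends in it, against
        \<open>noloop\<close>.\<close>
      have "\<exists>e p q. e \<in> U - J \<and> ((a e = p \<and> b e = q) \<or> (a e = q \<and> b e = p)) \<and> p \<in> eq J `` B \<and> q \<notin> eq J `` B"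
      proof (rule ccontr)
        assume no: "\<not> ?thesis"
        have "closed U (eq J `` B)"
        proof (rule closedI)
          fix x y assume "(x, y) \<in> gen U"
          then consider "(x, y) \<in> gen J" | e where "e \<in> U - J" "x = a e" "y = b e" by (auto simp: gen_def)
          then show "x \<in> eq J `` B \<longleftrightarrow> y \<in> eq J `` B"
          proof cases
            case 1
            then have "(x, y) \<in> eq J" by (auto simp: eq_def)
            then show ?thesis using closedD[OF closed_Image] by metis
          next
            case 2
            then show ?thesis using no by blast
          qed
        qed
        then have "V \<subseteq> eq J `` B"
          using base Image_superset[of B J] closedD by blast
        moreover obtain e where "e \<in> U - J" using False JU by blast
        ultimately show False using noloop ends by blast
      qed
      then obtain e p q where e: "e \<in> U" "e \<notin> J" and pq: "(a e = p \<and> b e = q) \<or> (a e = q \<and> b e = p)"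
        and p: "p \<in> eq J `` B" and q: "q \<notin> eq J `` B" by blast
      have qV: "q \<in> V" using ends e pq by blast
      have VJ: "closed J V" using V JU closed_mono by blast
      have VU: "closed (U - {e}) V" using V by (rule closed_mono) auto
      note cor = corank_contract[OF fin(1) finJ VJ e(2) pq p qV q]
      note gd = gens_delete_contract[OF e, of V B]
      interpret cone "gens V J (U - {e}) B" "gens V (insert e J) U B" lev "corank V J B" "diff 0 U B" "diff 0 (U - {e}) B"
         "\<lambda>(P, W). frag_cmul (esign P e) (push 0 B (insert e P) (P, W))"
        by (rule cone_edge[OF fin V e])
      have card_less: "card (U - {e} - J) < card (U - J)" "card (U - insert e J) < card (U - J)"
        by (rule psubset_card_mono, use fin in simp, use e in blast)+
      have U': "finite (U - {e})" "J \<subseteq> U - {e}" "\<And>r. r \<in> U - {e} \<Longrightarrow> a r \<in> V \<and> b r \<in> V"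
        using fin JU e ends by auto
      have pq': "(x, y) \<in> eq U \<longleftrightarrow> (x, y) \<in> eq (U - {e}) \<or> (x, p) \<in> eq (U - {e}) \<and> (q, y) \<in> eq (U - {e})
         \<or> (x, q) \<in> eq (U - {e}) \<and> (p, y) \<in> eq (U - {e})" for x y
        using eq_insert_iff[of x y e "U - {e}"] pq e by (auto simp: insert_absorb)
      obtain \<beta>0 where \<beta>0: "\<beta>0 \<in> B" "(p, \<beta>0) \<in> eq (U - {e})"
        using p eq_mono[OF U'(2)] eq_sym by blast
      have base': "\<exists>\<beta>\<in>B. (x, \<beta>) \<in> eq (U - {e}) \<or> (x, q) \<in> eq (U - {e})" if "x \<in> V" for x
        using base[OF that] pq' \<beta>0 eq_trans by meson
      show ?thesis
      proof (cases "\<exists>\<beta>\<in>B. (q, \<beta>) \<in> eq (U - {e})")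
        case True
        have "\<exists>\<beta>\<in>B. (x, \<beta>) \<in> eq (U - {e})" if "x \<in> V" for x
          using base'[OF that] True eq_trans by meson
        then have t0: "thin (gens V J (U - {e}) B) lev (corank V J B) (diff 0 (U - {e}) B)"
          using less.hyps[OF card_less(1) fin(1) U'(1,2) VU U'(3)] by blast
        have "thin (gens V (insert e J) U B) lev (corank V (insert e J) B) (diff 0 U B)"
          using less.hyps[OF card_less(2) fin _ V ends base] JU e by blast
        then show ?thesis
          unfolding gd(1) using thin_cone t0 cor by simp
      next
        case bridge: False
        txt \<open>The generators without \<open>x\<close> at \<open>q\<close> cancel; on the others \<open>q\<close> acts as a further base point.\<close>
        define Ga where "Ga = {(P, W) \<in> gens V J (U - {e}) B. q \<notin> W}"
        define Gb where "Gb = {(P, W) \<in> gens V J (U - {e}) B. q \<in> W}"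
        have pW: "p \<notin> W" if "(P, W) \<in> gens V J U' B" for P W U'
        proof -
          have P: "J \<subseteq> P" "closed P W" "W \<inter> B = {}" using that by (auto simp: gens_def)
          then show ?thesis using p eq_mono[OF P(1)] closedD[OF P(2)] by blast
        qed
        have qW: "q \<notin> W" if "(P, W) \<in> gens V (insert e J) U B" for P W
        proof -
          have "insert e P = P" using that by (auto simp: gens_def)
          moreover have "closed P W" using that by (auto simp: gens_def)
          ultimately have "closed (insert e P) W" by simp
          moreover have "p \<notin> W" using that pW[of P W U] by (auto simp: gens_def)
          ultimately show ?thesis using pq by (auto simp: closed_insert)
        qed
        have nocross: "\<beta> \<notin> eq P `` {q}" if "P \<subseteq> U - {e}" "\<beta> \<in> B" for P \<beta>
          using that bridge eq_mono by blast
        have base2: "\<exists>\<beta>\<in>insert q B. (x, \<beta>) \<in> eq (U - {e})" if "x \<in> V" for x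
          using base'[OF that] by blast
        have t2: "thin (gens V J (U - {e}) (insert q B)) lev (corank V J (insert q B)) (diff 0 (U - {e}) (insert q B))"
          using less.hyps[OF card_less(1) fin(1) U'(1,2) VU U'(3) base2] by blast
        let ?\<phi> = "\<lambda>(P, W). (P, W - eq P `` {q})"
        have Gb: "J \<subseteq> P" "P \<subseteq> U - {e}" "W \<subseteq> V" "closed P W" "W \<inter> B = {}" "q \<in> W" "finite W"
           "finite P" "eq P `` {q} \<subseteq> W" if "(P, W) \<in> Gb" for P W
        proof -
          show 1: "J \<subseteq> P" "P \<subseteq> U - {e}" "W \<subseteq> V" "closed P W" "W \<inter> B = {}" "q \<in> W"
            using that by (auto simp: Gb_def gens_def)
          show "finite W" "finite P" using 1 fin finite_subset by (blast, metis U'(1) finite_subset)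
          show "eq P `` {q} \<subseteq> W" using 1 by (intro Image_subset) auto
        qed
        have split_W: "ncomp P W = Suc (ncomp P (W - eq P `` {q}))"
          if "finite W" "closed P W" "q \<in> W" for P W
        proof -
          have sub: "eq P `` {q} \<subseteq> W" using that by (intro Image_subset) auto
          then have "W = (W - eq P `` {q}) \<union> eq P `` {q}" by blast
          moreover have "finite (eq P `` {q})" using sub that finite_subset by blast
          ultimately show ?thesis
            using ncomp_Un[of "W - eq P `` {q}" "eq P `` {q}" P] closed_Image[of P "{q}"]
              closed_Diff[of P W "eq P `` {q}"] that by auto
        qed
        \<comment> \<open>Two reasons for a term to vanish correspond: the label at \<open>q\<close>
          meets another label, where x^2 = 0, and a label reaches the base point
          \<open>q\<close>.\<close>
        have push_\<phi>: "push 0 B Q (P, W) \<in> frags Gb \<and>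
          frag_extend (frag_of \<circ> ?\<phi>) (push 0 B Q (P, W)) = push 0 (insert q B) Q (?\<phi> (P, W))"
          if PW: "(P, W) \<in> Gb" and Q: "P \<subseteq> Q" "Q \<subseteq> U - {e}" for P W Q
        proof -
          note g = Gb[OF PW]
          let ?K = "eq P `` {q}" and ?KQ = "eq Q `` {q}" and ?W1 = "W - eq P `` {q}"
          let ?W' = "eq Q `` W" and ?W1' = "eq Q `` (W - eq P `` {q})"
          have W'V: "?W' \<subseteq> V" by (rule Image_subset[OF closed_mono[OF VU Q(2)] g(3)])
          then have finW': "finite ?W'" using fin finite_subset by blast
          have KQ: "eq Q `` ?K = ?KQ" by (rule Image_Image[OF Q(1)])
          have W'_eq: "?W' = ?W1' \<union> ?KQ"
          proof -
            have "W = ?W1 \<union> ?K" using g(9) by blast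
            then show ?thesis using KQ by (metis Image_Un)
          qed
          have KQB: "?KQ \<inter> B = {}" using nocross[OF Q(2)] by blast
          have clW': "closed Q ?W'" "q \<in> ?W'" using closed_Image g(6) Image_superset by blast+
          have step1: "ncomp P W = Suc (ncomp P ?W1)" by (rule split_W[OF g(7,4,6)])
          have leW1: "ncomp Q ?W1' \<le> ncomp P ?W1" using ncomp_Image_le[OF _ Q(1)] g(7) by blast
          have inGb: "push 0 B Q (P, W) \<in> frags Gb"
          proof -
            have "(Q, ?W') \<in> Gb" if "?W' \<inter> B = {}"
              using that g Q W'V clW' by (auto simp: Gb_def gens_def)
            then show ?thesis by (auto simp: push_def Let_def intro: frags_cmul)
          qed
          show ?thesis
          proof (cases "q \<in> ?W1'")
            case True
            then have "?KQ \<subseteq> ?W1'" using Image_subset[OF closed_Image] by blast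
            then have "?W' = ?W1'" using W'_eq by blast
            then have "ncomp Q ?W' < ncomp P W" using step1 leW1 by simp
            then have "push 0 B Q (P, W) = 0" by (simp add: push_def Let_def)
            moreover have "push 0 (insert q B) Q (P, ?W1) = 0" using True by (auto simp: push_def Let_def)
            ultimately show ?thesis using inGb by simp
          next
            case False
            have disj: "?W1' \<inter> ?KQ = {}"
              using False closedD[OF closed_Image[of Q ?W1]] by blast
            then have W1': "?W1' = ?W' - ?KQ" using W'_eq by blast
            then have "ncomp Q ?W' = Suc (ncomp Q ?W1')"
              using split_W[OF finW' clW'] by simp
            then have "ncomp P W - ncomp Q ?W' = ncomp P ?W1 - ncomp Q ?W1'" using step1 by simp
            moreover have "?W' \<inter> B = {} \<longleftrightarrow> ?W1' \<inter> insert q B = {}"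
              using W'_eq KQB False by auto
            ultimately have "frag_extend (frag_of \<circ> ?\<phi>) (push 0 B Q (P, W)) = push 0 (insert q B) Q (P, ?W1)"
              using W1' by (auto simp: push_def Let_def frag_extend_simps)
            then show ?thesis using inGb by simp
          qed
        qed
        have tb: "thin Gb lev (corank V J B) (diff 0 (U - {e}) B)"
          unfolding cor(2)
        proof (rule thin_transport[OF _ _ _ t2])
          show "bij_betw ?\<phi> Gb (gens V J (U - {e}) (insert q B))"
          proof (rule bij_betw_byWitness[where f' = "\<lambda>(P, W). (P, W \<union> eq P `` {q})"])
            show "\<forall>g\<in>Gb. (\<lambda>(P, W). (P, W \<union> eq P `` {q})) (?\<phi> g) = g"
              using Gb(9) by fastforce
            show "\<forall>g\<in>gens V J (U - {e}) (insert q B). ?\<phi> ((\<lambda>(P, W). (P, W \<union> eq P `` {q})) g) = g"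
              using closedD by (fastforce simp: gens_def)
            show "?\<phi> ` Gb \<subseteq> gens V J (U - {e}) (insert q B)"
              using Gb closed_Diff closed_Image by (fastforce simp: gens_def)
            show "(\<lambda>(P, W). (P, W \<union> eq P `` {q})) ` gens V J (U - {e}) (insert q B) \<subseteq> Gb"
            proof clarify
              fix P W assume g: "(P, W) \<in> gens V J (U - {e}) (insert q B)"
              have "eq P `` {q} \<subseteq> V"
                using g closed_mono[OF VU] qV by (intro Image_subset) (auto simp: gens_def)
              moreover have "eq P `` {q} \<inter> B = {}" using g nocross[of P] by (auto simp: gens_def)
              ultimately show "(P, W \<union> eq P `` {q}) \<in> Gb"
                using g closed_Un closed_Image[of P "{q}"] by (auto simp: Gb_def gens_def)
            qed
          qed
          show "lev g = Suc (lev (?\<phi> g))" if "g \<in> Gb" for g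
            using that split_W Gb by (cases g) (simp add: lev_def)
          show "diff 0 (U - {e}) B g \<in> frags Gb \<and>
            frag_extend (frag_of \<circ> ?\<phi>) (diff 0 (U - {e}) B g) = diff 0 (U - {e}) (insert q B) (?\<phi> g)"
            if "g \<in> Gb" for g
          proof -
            obtain P W where [simp]: "g = (P, W)" by (cases g)
            have P: "P \<subseteq> U - {e}" using Gb(2) that by simp
            have *: "push 0 B (insert r P) (P, W) \<in> frags Gb \<and>
              frag_extend (frag_of \<circ> ?\<phi>) (push 0 B (insert r P) (P, W)) = push 0 (insert q B) (insert r P) (?\<phi> (P, W))"
              if "r \<in> U - {e} - P" for r
              by (rule push_\<phi>) (use that \<open>g \<in> Gb\<close> P in auto)
            have "finite (U - {e} - P)" using fin by simp
            then show ?thesis using *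
              by (auto simp: diff_def frag_extend_sum frag_extend_cmul intro!: frags_sum frags_cmul)
          qed
        qed
        show ?thesis
          unfolding gd(1)
        proof (rule thin_cancel[where Ga = Ga and Gb = Gb and \<phi> = "\<lambda>(P, W). (insert e P, W)" and s = "\<lambda>(P, W). esign P e"])
          show "gens V J (U - {e}) B = Ga \<union> Gb" "Ga \<inter> Gb = {}" by (auto simp: Ga_def Gb_def)
          show "thin Gb lev (corank V J B) (diff 0 (U - {e}) B)" by (rule tb)
          show "bij_betw (\<lambda>(P, W). (insert e P, W)) Ga (gens V (insert e J) U B)"
          proof (rule bij_betw_byWitness[where f' = "\<lambda>(P, W). (P - {e}, W)"])
            show "(\<lambda>(P, W). (insert e P, W)) ` Ga \<subseteq> gens V (insert e J) U B"
            proof clarify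
              fix P W assume g: "(P, W) \<in> Ga"
              then have "closed (insert e P) W"
                using pW[of P W "U - {e}"] pq by (auto simp: Ga_def gens_def closed_insert)
              then show "(insert e P, W) \<in> gens V (insert e J) U B" using g e by (auto simp: Ga_def gens_def)
            qed
            show "(\<lambda>(P, W). (P - {e}, W)) ` gens V (insert e J) U B \<subseteq> Ga"
              using qW e by (auto simp: Ga_def gens_def intro: closed_mono)
          qed (auto simp: Ga_def gens_def)
          fix g
          show "diff 0 (U - {e}) B g \<in> frags Gb" if "g \<in> Gb"
          proof -
            obtain P W where [simp]: "g = (P, W)" by (cases g)
            have P: "P \<subseteq> U - {e}" using Gb(2) that by simp
            have "push 0 B (insert r P) (P, W) \<in> frags Gb" if "r \<in> U - {e} - P" for r
              using push_\<phi>[of P W "insert r P"] that \<open>g \<in> Gb\<close> P by auto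
            then show ?thesis by (auto simp: diff_def intro!: frags_sum frags_cmul)
          qed
          \<comment> \<open>Adding \<open>e\<close> connects the label at \<open>q\<close> to a base
            point, so the attaching map vanishes on \<open>Gb\<close>.\<close>
          show "(case g of (P, W) \<Rightarrow> frag_cmul (esign P e) (push 0 B (insert e P) (P, W))) = 0" if "g \<in> Gb"
          proof -
            obtain P W where [simp]: "g = (P, W)" by (cases g)
            have qp: "(q, p) \<in> eq (insert e P)" using pq by (auto simp: eq_insert_iff)
            have JP: "J \<subseteq> insert e P" using Gb(1)[of P W] that by auto
            obtain \<beta> where "\<beta> \<in> B" "(\<beta>, p) \<in> eq J" using p by blast
            then have "(q, \<beta>) \<in> eq (insert e P)" using eq_trans[OF qp eq_sym[OF eq_mono[OF JP]]] by blast
            then have "\<beta> \<in> eq (insert e P) `` W" using Gb(6)[of P W] that by auto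
            then have "eq (insert e P) `` W \<inter> B \<noteq> {}" using \<open>\<beta> \<in> B\<close> by blast
            then show ?thesis by (simp add: push_def Let_def)
          qed
          show "(case g of (P, W) \<Rightarrow> frag_cmul (esign P e) (push 0 B (insert e P) (P, W))) =
             frag_cmul (case g of (P, W) \<Rightarrow> esign P e) (frag_of (case g of (P, W) \<Rightarrow> (insert e P, W)))" if "g \<in> Ga"
          proof -
            obtain P W where g [simp]: "g = (P, W)" by (cases g)
            have W: "p \<notin> W" "q \<notin> W" "closed P W" "W \<inter> B = {}"
              using that pW[of P W "U - {e}"] by (auto simp: Ga_def gens_def)
            then have cl: "closed (insert e P) W" using pq by (auto simp: closed_insert)
            have "eq (insert e P) `` {x} = eq P `` {x}" if "x \<in> W" for x
              using that W(1,2) pq closedD[OF W(3)] by (auto simp: eq_insert_iff)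
            then have "W // eq (insert e P) = W // eq P" unfolding quotient_def by (intro SUP_cong) auto
            then have "ncomp (insert e P) W = ncomp P W" by (simp add: ncomp_def)
            then show ?thesis using W(4) by (simp add: push_def Image_closed[OF cl])
          qed
          show "(case g of (P, W) \<Rightarrow> esign P e) * (case g of (P, W) \<Rightarrow> esign P e) = 1" if "g \<in> Ga"
            by (cases g) simp
        qed
      qed
    qed
  qed
qed

end

section \<open>Deformed differentials\<close>

lemma frags_level_decomp:
  assumes "z \<in> frags G"
  shows "z = (\<Sum>N\<in>lv ` Poly_Mapping.keys z. proj (level G lv N) z)"
proof (rule poly_mapping_eqI)
  fix g
  show "Poly_Mapping.lookup z g = Poly_Mapping.lookup (\<Sum>N\<in>lv ` Poly_Mapping.keys z. proj (level G lv N) z) g"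
  proof (cases "g \<in> Poly_Mapping.keys z")
    case True
    then have "g \<in> G" using assms by (auto simp: frags_def)
    have "Poly_Mapping.lookup (\<Sum>N\<in>lv ` Poly_Mapping.keys z. proj (level G lv N) z) g
      = (\<Sum>N\<in>lv ` Poly_Mapping.keys z. if N = lv g then Poly_Mapping.lookup z g else 0)"
      unfolding lookup_sum by (rule sum.cong) (auto simp: lookup_proj \<open>g \<in> G\<close>)
    then show ?thesis using True by simp
  next
    case False
    then have "Poly_Mapping.lookup z g = 0" by (simp add: in_keys_iff)
    then show ?thesis unfolding lookup_sum lookup_proj by (simp cong: if_cong)
  qed
qed

text \<open>\<open>d\<close> raises \<open>lev\<close> and \<Delta> preserves it, while both raise
  the homological degree \<open>deg\<close>. Thinness is a property of \<open>d\<close> alone;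
  \<open>exact\<close> is one of the sum, in positive degrees.\<close>

locale deformation =
  fixes G :: "'g set" and lev deg :: "'g \<Rightarrow> nat" and \<kappa> :: nat and d \<Delta> :: "'g \<Rightarrow> 'g \<Rightarrow>\<^sub>0 int"
  assumes thin: "thin G lev \<kappa> d"
    and d_level: "g \<in> G \<Longrightarrow> d g \<in> frags (level G lev (Suc (lev g)))"
    and \<Delta>_level: "g \<in> G \<Longrightarrow> \<Delta> g \<in> frags (level G lev (lev g))"
    and d_deg: "g \<in> G \<Longrightarrow> d g \<in> frags (level G deg (Suc (deg g)))"
    and \<Delta>_deg: "g \<in> G \<Longrightarrow> \<Delta> g \<in> frags (level G deg (Suc (deg g)))"
    and dd: "z \<in> frags G \<Longrightarrow> frag_extend d (frag_extend d z) = 0"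
    and d\<Delta>: "z \<in> frags G \<Longrightarrow> frag_extend d (frag_extend \<Delta> z) = - frag_extend \<Delta> (frag_extend d z)"
    and \<Delta>\<Delta>: "z \<in> frags G \<Longrightarrow> frag_extend \<Delta> (frag_extend \<Delta> z) = 0"
    and exact: "z \<in> frags {g \<in> G. 0 < deg g} \<Longrightarrow> frag_extend d z + frag_extend \<Delta> z = 0 \<Longrightarrow>
       \<exists>y\<in>frags G. z = frag_extend d y + frag_extend \<Delta> y"
begin

section \<open>Homology of \<open>d\<close> for chains spread over several levels\<close>

abbreviation "\<d> \<equiv> frag_extend d"
abbreviation "\<D> \<equiv> frag_extend \<Delta>"

lemma inG: "z \<in> frags {g \<in> G. Q g} \<Longrightarrow> z \<in> frags G"
  by (erule frags_mono) auto

lemma d_in: "z \<in> frags G \<Longrightarrow> \<d> z \<in> frags G"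
  by (erule frags_extend) (rule inG[OF d_level])

lemma \<Delta>_in: "z \<in> frags G \<Longrightarrow> \<D> z \<in> frags G"
  by (erule frags_extend) (rule inG[OF \<Delta>_level])

lemma d_shift:
  assumes "z \<in> frags {g \<in> G. Q (lev g)}" "\<And>N. Q N \<Longrightarrow> R (Suc N)"
  shows "\<d> z \<in> frags {g \<in> G. R (lev g)}"
  using assms(1) by (rule frags_extend) (rule frags_mono[OF d_level], use assms(2) in auto)

lemma \<Delta>_shift:
  assumes "z \<in> frags {g \<in> G. Q (lev g)}"
  shows "\<D> z \<in> frags {g \<in> G. Q (lev g)}"
  using assms(1) by (rule frags_extend) (rule frags_mono[OF \<Delta>_level], auto)

lemma proj_level_d:
  assumes "z \<in> frags G" shows "proj (level G lev (Suc N)) (\<d> z) = \<d> (proj (level G lev N) z)"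
proof -
  have z: "z = proj (level G lev N) z + proj (- level G lev N) z" by (simp add: proj_decomp)
  have 1: "proj (level G lev N) z \<in> frags (level G lev N)" by (rule proj_in)
  have "proj (- level G lev N) z \<in> frags (G \<inter> - level G lev N)" by (rule proj_frags[OF assms])
  then have 2: "proj (- level G lev N) z \<in> frags {g \<in> G. lev g \<noteq> N}" by (rule frags_mono) auto
  have "\<d> (proj (level G lev N) z) \<in> frags (level G lev (Suc N))"
    by (rule d_shift[OF 1]) simp
  then have 3: "proj (level G lev (Suc N)) (\<d> (proj (level G lev N) z)) = \<d> (proj (level G lev N) z)"
    by (rule proj_eq) simp
  have "\<d> (proj (- level G lev N) z) \<in> frags {g \<in> G. lev g \<noteq> Suc N}"
    by (rule d_shift[OF 2]) simp
  then have "proj (level G lev (Suc N)) (\<d> (proj (- level G lev N) z)) = 0"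
    by (rule proj_eq_0) auto
  then have "proj (level G lev (Suc N)) (\<d> (proj (level G lev N) z + proj (- level G lev N) z)) = \<d> (proj (level G lev N) z)"
    using 3 by (simp add: proj_simps frag_extend_add)
  then show ?thesis by (simp only: proj_decomp)
qed

text \<open>\<open>thin\<close> treats one level at a time; \<open>d\<close> being homogeneous, the
  components of a closed chain are closed and have separate primitives.\<close>

lemma exact_off_diagonal:
  assumes u: "u \<in> frags {g \<in> G. lev g \<noteq> \<kappa>}" and du: "\<d> u = 0"
  shows "\<exists>y\<in>frags G. u = \<d> y"
proof -
  let ?S = "lev ` Poly_Mapping.keys u"
  have "\<exists>y\<in>frags G. proj (level G lev N) u = \<d> y" if "N \<in> ?S" for N
  proof -
    have N: "N \<noteq> \<kappa>" using that u by (auto simp: frags_def)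
    have "\<d> (proj (level G lev N) u) = 0"
      using proj_level_d[OF inG[OF u]] du by (metis proj_simps(5))
    from thin_exact[OF thin N proj_in this] show ?thesis using inG by metis
  qed
  then have "\<forall>N\<in>?S. \<exists>y. y \<in> frags G \<and> proj (level G lev N) u = \<d> y" by blast
  from bchoice[OF this]
  obtain y where y: "\<And>N. N \<in> ?S \<Longrightarrow> y N \<in> frags G \<and> proj (level G lev N) u = \<d> (y N)"
    by blast
  have "u = (\<Sum>N\<in>?S. proj (level G lev N) u)" by (rule frags_level_decomp[OF inG[OF u]])
  also have "\<dots> = (\<Sum>N\<in>?S. \<d> (y N))" by (rule sum.cong) (simp_all add: y)
  also have "\<dots> = \<d> (\<Sum>N\<in>?S. y N)" by (subst frag_extend_sum) (simp_all add: comp_def)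
  finally show ?thesis using y by (intro bexI[of _ "\<Sum>N\<in>?S. y N"] frags_sum) auto
qed

lemma split_diagonal:
  assumes "z \<in> frags G"
  obtains z0 z1 where "z0 \<in> frags (level G lev N)" "z1 \<in> frags {g \<in> G. lev g \<noteq> N}" "z = z0 + z1"
proof -
  have "G = level G lev N \<union> {g \<in> G. lev g \<noteq> N}" by auto
  then have "z \<in> frags (level G lev N \<union> {g \<in> G. lev g \<noteq> N})" using assms by simp
  then show ?thesis by (rule frags_split) (rule that)
qed

text \<open>Components off \<kappa> are exact, and the component at \<kappa> falls under the second
  clause of \<open>thin\<close>.\<close>

lemma torsion_free:
  assumes n: "0 < n" and z: "z \<in> frags G" and w: "w \<in> frags G" and eq: "frag_cmul n z = \<d> w"
  shows "\<exists>y\<in>frags G. z = \<d> y"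
proof -
  obtain z0 z1 where z01: "z0 \<in> frags (level G lev \<kappa>)" "z1 \<in> frags {g \<in> G. lev g \<noteq> \<kappa>}" "z = z0 + z1"
    by (rule split_diagonal[OF z])
  have "frag_cmul n (\<d> z) = 0" using eq dd[OF w] by (metis frag_extend_cmul)
  then have dz: "\<d> z = 0" using n by simp
  have "\<d> z0 \<in> frags (level G lev (Suc \<kappa>))" "\<d> z1 \<in> frags {g \<in> G. lev g \<noteq> Suc \<kappa>}"
    by (rule d_shift[OF z01(1)], simp, rule d_shift[OF z01(2)], simp)
  moreover have "\<d> z0 + \<d> z1 = 0 + 0" using dz z01(3) by (simp add: frag_extend_simps)
  ultimately have "\<d> z1 = 0"
    by (intro frags_disjoint_cancel(2)[OF _ frags_0 _ frags_0, of "\<d> z0" _ "\<d> z1"]) auto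
  then obtain y1 where y1: "y1 \<in> frags G" "z1 = \<d> y1" using exact_off_diagonal[OF z01(2)] by blast
  have "\<exists>y0 \<in> frags G. z0 = \<d> y0"
  proof (cases \<kappa>)
    case 0
    have "proj (level G lev 0) (\<d> w) = 0"
    proof (rule proj_eq_0)
      show "\<d> w \<in> frags {g \<in> G. lev g \<noteq> 0}"
        by (rule d_shift[of w "\<lambda>_. True"]) (use w in auto)
    qed auto
    moreover have "proj (level G lev 0) (frag_cmul n z) = frag_cmul n z0"
    proof -
      have "proj (level G lev 0) z0 = z0" "proj (level G lev 0) z1 = 0"
        by (rule proj_eq[OF z01(1)], use 0 in simp, rule proj_eq_0[OF z01(2)], use 0 in blast)
      then show ?thesis using z01(3) by (simp add: proj_simps frag_cmul_distrib2)
    qed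
    ultimately have "z0 = 0" using eq n by simp
    then show ?thesis by (intro bexI[of _ 0]) auto
  next
    case (Suc M)
    have "frag_cmul n z0 = proj (level G lev \<kappa>) (frag_cmul n z)"
    proof -
      have "proj (level G lev \<kappa>) z0 = z0" "proj (level G lev \<kappa>) z1 = 0"
        by (rule proj_eq[OF z01(1)], simp, rule proj_eq_0[OF z01(2)], blast)
      then show ?thesis using z01(3) by (simp add: proj_simps frag_cmul_distrib2)
    qed
    also have "\<dots> = \<d> (proj (level G lev M) w)"
      using eq proj_level_d[OF w, of M] Suc by simp
    finally have 1: "frag_cmul n z0 = \<d> (proj (level G lev M) w)" .
    have 2: "proj (level G lev M) w \<in> frags (below G lev \<kappa>)"
      by (rule frags_mono[OF proj_in]) (auto simp: Suc)
    obtain y0 where "y0 \<in> frags (below G lev \<kappa>)" "z0 = \<d> y0"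
      by (rule thin_torsion_free[OF thin n z01(1) 2 1])
    then show ?thesis using inG[of y0 "\<lambda>g. Suc (lev g) = \<kappa>"] by blast
  qed
  then obtain y0 where "y0 \<in> frags G" "z0 = \<d> y0" by blast
  then show ?thesis
    using y1 z01(3) by (intro bexI[of _ "y0 + y1"]) (auto simp: frag_extend_add intro: frags_add)
qed

section \<open>The deformed differential, filtered by level\<close>

definition total :: "('g \<Rightarrow>\<^sub>0 int) \<Rightarrow> ('g \<Rightarrow>\<^sub>0 int)" where
  "total z = \<d> z + \<D> z"

lemma total_simps: "total (x + y) = total x + total y" "total (x - y) = total x - total y"
  "total (- x) = - total x" "total 0 = 0"
  by (simp_all add: total_def frag_extend_simps)

lemma total_total: "z \<in> frags G \<Longrightarrow> total (total z) = 0"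
  using dd d\<Delta> \<Delta>\<Delta> by (simp add: total_def frag_extend_simps)

lemma split_top:
  assumes "z \<in> frags {g \<in> G. lev g < Suc M}"
  obtains z0 z1 where "z0 \<in> frags (level G lev M)" "z1 \<in> frags {g \<in> G. lev g < M}" "z = z0 + z1"
proof -
  have "{g \<in> G. lev g < Suc M} = level G lev M \<union> {g \<in> G. lev g < M}" by auto
  then have "z \<in> frags (level G lev M \<union> {g \<in> G. lev g < M})" using assms by simp
  then show ?thesis by (rule frags_split) (rule that)
qed

text \<open>At level \<open>Suc M\<close> the only contribution to the total differential is
  \<open>d\<close> of the leading term.\<close>

lemma top_closed:
  assumes "z0 \<in> frags (level G lev M)" "z1 \<in> frags {g \<in> G. lev g < M}"
    "total (z0 + z1) \<in> frags {g \<in> G. lev g \<le> M}"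
  shows "\<d> z0 = 0"
proof -
  have "\<d> z0 \<in> frags (level G lev (Suc M))" by (rule d_shift[OF assms(1)]) simp
  moreover have "\<d> z0 \<in> frags {g \<in> G. lev g \<le> M}"
  proof -
    have "\<D> z0 \<in> frags {g \<in> G. lev g \<le> M}"
      by (rule frags_mono[OF \<Delta>_shift[OF assms(1)]]) auto
    moreover have "\<d> z1 \<in> frags {g \<in> G. lev g \<le> M}"
      by (rule d_shift[OF assms(2)]) auto
    moreover have "\<D> z1 \<in> frags {g \<in> G. lev g \<le> M}"
      by (rule frags_mono[OF \<Delta>_shift[OF assms(2)]]) auto
    moreover have "\<d> z0 = total (z0 + z1) - \<D> z0 - \<d> z1 - \<D> z1"
      by (simp add: total_def frag_extend_simps)
    ultimately show ?thesis using assms(3) by (auto intro!: frags_diff)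
  qed
  ultimately show ?thesis by (rule frags_disjoint_eq_0) auto
qed

text \<open>The leading term is \<open>d\<close>-closed and lies off \<kappa>, hence is
  \<open>d\<close>-exact. Subtracting the total differential of a primitive cancels it, at the cost
  of a \<Delta>-term of lower level.\<close>

lemma total_exact_below:
  assumes "u \<in> frags {g \<in> G. lev g < M}" "M \<le> \<kappa>" "total u = 0"
  shows "\<exists>t\<in>frags {g \<in> G. lev g < \<kappa>}. u = total t"
  using assms
proof (induction M arbitrary: u)
  case 0
  then show ?case by (auto simp: total_simps intro!: bexI[of _ 0])
next
  case (Suc M)
  obtain u0 u1 where u01: "u0 \<in> frags (level G lev M)" "u1 \<in> frags {g \<in> G. lev g < M}" "u = u0 + u1"
    by (rule split_top[OF Suc.prems(1)])
  have du: "\<d> u0 = 0" by (rule top_closed[OF u01(1,2)]) (use Suc.prems u01 in simp)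
  have "M \<noteq> \<kappa>" using Suc.prems by simp
  from thin_exact[OF thin this u01(1) du]
  obtain t0 where t0: "t0 \<in> frags (below G lev M)" "u0 = \<d> t0" .
  have t0': "t0 \<in> frags {g \<in> G. lev g < M}" by (rule frags_mono[OF t0(1)]) auto
  have eq: "u - total t0 = u1 - \<D> t0" using u01 t0 by (simp add: total_def)
  have "u - total t0 \<in> frags {g \<in> G. lev g < M}"
    unfolding eq by (intro frags_diff u01 \<Delta>_shift t0')
  moreover have "total (u - total t0) = 0"
    using Suc.prems total_total[OF inG[OF t0']] by (simp add: total_simps)
  ultimately obtain t where t: "t\<in>frags {g \<in> G. lev g < \<kappa>}" "u - total t0 = total t"
    using Suc.IH Suc.prems by (meson Suc_leD)
  then have "u = total (t0 + t)" by (simp add: total_simps algebra_simps)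
  moreover have "t0 + t \<in> frags {g \<in> G. lev g < \<kappa>}"
    by (rule frags_add[OF frags_mono[OF t0'] t(1)]) (use Suc.prems in auto)
  ultimately show ?case by blast
qed

text \<open>Leading terms above \<kappa> are \<open>d\<close>-exact and are removed one level at a
  time by subtracting elements \<open>total t0\<close>, which are killed by
  \<open>total\<close>.\<close>

lemma total_lower:
  assumes "q \<in> frags {g \<in> G. lev g < M}" "total q \<in> frags {g \<in> G. lev g \<le> \<kappa>}"
  shows "\<exists>q'\<in>frags {g \<in> G. lev g \<le> \<kappa>}. total q' = total q"
  using assms
proof (induction M arbitrary: q)
  case 0
  then show ?case by auto
next
  case (Suc M)
  show ?case
  proof (cases "M \<le> \<kappa>")
    case True
    then have "q \<in> frags {g \<in> G. lev g \<le> \<kappa>}" using Suc.prems(1) by (auto elim!: frags_mono)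
    then show ?thesis by blast
  next
    case False
    obtain q0 q1 where q01: "q0 \<in> frags (level G lev M)" "q1 \<in> frags {g \<in> G. lev g < M}" "q = q0 + q1"
      by (rule split_top[OF Suc.prems(1)])
    have "total q \<in> frags {g \<in> G. lev g \<le> M}" by (rule frags_mono[OF Suc.prems(2)]) (use False in auto)
    then have dq: "\<d> q0 = 0" using top_closed[OF q01(1,2)] q01(3) by simp
    have "M \<noteq> \<kappa>" using False by simp
    from thin_exact[OF thin this q01(1) dq]
    obtain t0 where t0: "t0 \<in> frags (below G lev M)" "q0 = \<d> t0" .
    have t0': "t0 \<in> frags {g \<in> G. lev g < M}" by (rule frags_mono[OF t0(1)]) auto
    have eq: "q - total t0 = q1 - \<D> t0" using q01 t0 by (simp add: total_def)
    have 1: "q - total t0 \<in> frags {g \<in> G. lev g < M}"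
      unfolding eq by (intro frags_diff q01 \<Delta>_shift t0')
    have 2: "total (q - total t0) = total q"
      using total_total[OF inG[OF t0']] by (simp add: total_simps)
    show ?thesis using Suc.IH[OF 1] Suc.prems(2) unfolding 2 by simp
  qed
qed

text \<open>Both summands raise \<open>deg\<close> by exactly one. Hence the part in positive degree
  of a chain closed under \<open>total\<close> is closed too, and \<open>exact\<close> applies to
  it.\<close>

lemma total_deg_proj:
  assumes "z \<in> frags G"
  shows "total (proj {g \<in> G. 0 < deg g} z) = proj {g \<in> G. 1 < deg g} (total z)"
proof -
  let ?z1 = "proj {g \<in> G. 0 < deg g} z" and ?z0 = "proj (- {g \<in> G. 0 < deg g}) z"
  have z: "z = ?z1 + ?z0" by (simp add: proj_decomp)
  have "?z1 \<in> frags {g \<in> G. 0 < deg g}" by (rule proj_in)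
  then have "\<d> ?z1 \<in> frags {g \<in> G. 1 < deg g}" "\<D> ?z1 \<in> frags {g \<in> G. 1 < deg g}"
    by (erule_tac[!] frags_extend) (rule frags_mono[OF d_deg], auto, rule frags_mono[OF \<Delta>_deg], auto)
  then have "total ?z1 \<in> frags {g \<in> G. 1 < deg g}" by (simp add: total_def frags_add)
  then have 1: "proj {g \<in> G. 1 < deg g} (total ?z1) = total ?z1" by (rule proj_eq) simp
  have "?z0 \<in> frags (G \<inter> - {g \<in> G. 0 < deg g})" by (rule proj_frags[OF assms])
  then have "\<d> ?z0 \<in> frags {g \<in> G. deg g = 1}" "\<D> ?z0 \<in> frags {g \<in> G. deg g = 1}"
    by (erule_tac[!] frags_extend) (rule frags_mono[OF d_deg], auto, rule frags_mono[OF \<Delta>_deg], auto)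
  then have "total ?z0 \<in> frags {g \<in> G. deg g = 1}" by (simp add: total_def frags_add)
  then have "proj {g \<in> G. 1 < deg g} (total ?z0) = 0" by (rule proj_eq_0) auto
  then have "proj {g \<in> G. 1 < deg g} (total (?z1 + ?z0)) = total ?z1"
    using 1 by (simp add: proj_simps total_simps)
  then show ?thesis by (simp only: proj_decomp)
qed

text \<open>Purity of the image of \<Delta> on the homology of \<open>d\<close>. This homology is
  torsion-free, so \<Delta> kills the class of \<open>z\<close> and not only that of a multiple.
  Terms of lower level then complete \<open>z\<close> to a chain closed under \<open>total\<close>;
  a primitive exists by \<open>exact\<close>, and its part at level \<kappa> is the desired
  preimage.\<close>

lemma deformation_torsion_free_diagonal:
  assumes n: "0 < n" and z: "z \<in> frags (level G lev \<kappa>)" and w: "w \<in> frags (level G lev \<kappa>)" "\<d> w = 0"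
    and y: "y \<in> frags (below G lev \<kappa>)" and eq: "frag_cmul n z = \<D> w + \<d> y"
  shows "\<exists>w'\<in>frags G. \<exists>y'\<in>frags G. \<d> w' = 0 \<and> z = \<D> w' + \<d> y'"
proof -
  note zG = inG[OF z] and wG = inG[OF w(1)] and yG = inG[OF y]
  \<comment> \<open>A multiple of \<open>z\<close> is a sum of images under maps that raise the
    degree; this is the positivity that \<open>exact\<close> asks for.\<close>
  have zdeg: "z \<in> frags {g \<in> G. 0 < deg g}"
  proof -
    have "frag_cmul n z \<in> frags {g \<in> G. 0 < deg g}"
      unfolding eq
    proof (rule frags_add)
      show "\<D> w \<in> frags {g \<in> G. 0 < deg g}"
        using wG by (rule frags_extend) (rule frags_mono[OF \<Delta>_deg], auto)
      show "\<d> y \<in> frags {g \<in> G. 0 < deg g}"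
        using yG by (rule frags_extend) (rule frags_mono[OF d_deg], auto)
    qed
    then show ?thesis using n by (auto simp: frags_def)
  qed
  have "frag_cmul n (\<d> z) = \<d> (\<D> w) + \<d> (\<d> y)" using eq by (metis frag_extend_cmul frag_extend_add)
  then have "frag_cmul n (\<d> z) = 0" using d\<Delta>[OF wG] w(2) dd[OF yG] by (simp add: frag_extend_simps)
  then have dz: "\<d> z = 0" using n by simp
  have "frag_cmul n (\<D> z) = \<D> (\<D> w) + \<D> (\<d> y)" using eq by (metis frag_extend_cmul frag_extend_add)
  then have 1: "frag_cmul n (\<D> z) = \<d> (- \<D> y)" using \<Delta>\<Delta>[OF wG] d\<Delta>[OF yG] by (simp add: frag_extend_simps)
  have 2: "\<D> z \<in> frags (level G lev \<kappa>)" by (rule \<Delta>_shift[OF z])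
  have 3: "- \<D> y \<in> frags (below G lev \<kappa>)" by (rule frags_minus[OF \<Delta>_shift[OF y]])
  obtain y' where y': "y' \<in> frags (below G lev \<kappa>)" "\<D> z = \<d> y'"
    by (rule thin_torsion_free[OF thin n 2 3 1])
  have y'l: "y' \<in> frags {g \<in> G. lev g < \<kappa>}" by (rule frags_mono[OF y'(1)]) auto
  \<comment> \<open>The defect of \<open>z - y'\<close> from being closed. It has level below
    \<kappa> and is closed under \<open>total\<close>, so a correction \<open>t\<close> below
    \<kappa> exists.\<close>
  let ?u = "total (z - y')"
  have u: "?u = - \<D> y'" using dz y'(2) by (simp add: total_def frag_extend_simps)
  have "?u \<in> frags {g \<in> G. lev g < \<kappa>}" unfolding u by (rule frags_minus[OF \<Delta>_shift[OF y'l]])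
  moreover have "total ?u = 0" by (rule total_total[OF frags_diff[OF zG inG[OF y'(1)]]])
  ultimately obtain t where t: "t\<in>frags {g \<in> G. lev g < \<kappa>}" "?u = total t"
    using total_exact_below by blast
  let ?s = "y' + t"
  have s: "?s \<in> frags {g \<in> G. lev g < \<kappa>}" by (rule frags_add[OF y'l t(1)])
  let ?z = "z - ?s"
  have zG': "?z \<in> frags G" by (rule frags_diff[OF zG inG[OF s]])
  have "total ?z = 0" using t(2) by (simp add: total_simps algebra_simps)
  let ?zp = "proj {g \<in> G. 0 < deg g} ?z"
  have "total ?zp = 0" using total_deg_proj[OF zG'] \<open>total ?z = 0\<close> by (simp add: proj_simps)
  then obtain q where q: "q \<in> frags G" "?zp = total q"
    using exact[OF proj_in] by (auto simp: total_def)
  let ?p = "proj {g \<in> G. 0 < deg g} ?s"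
  have zp: "?zp = z - ?p" using proj_eq[OF zdeg] by (simp add: proj_simps)
  have p: "?p \<in> frags {g \<in> G. lev g < \<kappa>}" by (rule frags_mono[OF proj_frags[OF s]]) auto
  obtain M where "q \<in> frags {g \<in> G. lev g < M}"
  proof -
    have "lev g < Suc (Max (lev ` Poly_Mapping.keys q))" if "g \<in> Poly_Mapping.keys q" for g
      using that by (simp add: less_Suc_eq_le)
    then show ?thesis using that q(1) unfolding frags_def by blast
  qed
  moreover have "total q \<in> frags {g \<in> G. lev g \<le> \<kappa>}"
    unfolding q(2)[symmetric] zp by (rule frags_diff[OF frags_mono[OF z] frags_mono[OF p]]) auto
  ultimately obtain q' where q': "q' \<in> frags {g \<in> G. lev g \<le> \<kappa>}" "total q' = total q"
    using total_lower by blast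
  have "q' \<in> frags {g \<in> G. lev g < Suc \<kappa>}" using q'(1) by (rule frags_mono) auto
  then obtain q0 q1 where q01: "q0 \<in> frags (level G lev \<kappa>)" "q1 \<in> frags {g \<in> G. lev g < \<kappa>}" "q' = q0 + q1"
    by (rule split_top)
  have tq: "total q' = z - ?p" using q' q zp by simp
  have "z - ?p \<in> frags {g \<in> G. lev g \<le> \<kappa>}"
    by (rule frags_diff[OF frags_mono[OF z] frags_mono[OF p]]) auto
  then have dq0: "\<d> q0 = 0" using top_closed[OF q01(1,2)] q01(3) tq by simp
  let ?L = "level G lev \<kappa>"
  \<comment> \<open>Comparison at level \<kappa>: every correction made to \<open>z\<close> lies
    strictly lower.\<close>
  have "proj ?L (z - ?p) = z"
  proof -
    have "proj ?L z = z" "proj ?L ?p = 0"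
      by (rule proj_eq[OF z], simp, rule proj_eq_0[OF p], blast)
    then show ?thesis by (simp only: proj_simps diff_zero)
  qed
  moreover have "proj ?L (total q') = \<D> q0 + proj ?L (\<d> q1)"
  proof -
    have "total q' = \<D> q0 + (\<d> q1 + \<D> q1)" using q01(3) dq0 by (simp add: total_def frag_extend_simps)
    moreover have "proj ?L (\<D> q0) = \<D> q0" by (rule proj_eq[OF \<Delta>_shift[OF q01(1)]]) simp
    moreover have "proj ?L (\<D> q1) = 0" by (rule proj_eq_0[OF \<Delta>_shift[OF q01(2)]]) auto
    ultimately show ?thesis by (simp add: proj_simps)
  qed
  moreover have "\<exists>y\<in>frags G. proj ?L (\<d> q1) = \<d> y"
  proof (cases \<kappa>)
    case 0
    then have "q1 = 0" using q01(2) by simp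
    then show ?thesis by (intro bexI[of _ 0]) (auto simp: proj_simps)
  next
    case (Suc M)
    then show ?thesis using proj_level_d[OF inG[OF q01(2)], of M] inG[OF proj_in] by metis
  qed
  ultimately have "\<exists>y\<in>frags G. z = \<D> q0 + \<d> y" using tq by metis
  then show ?thesis using inG[OF q01(1)] dq0 by blast
qed

text \<open>Off the diagonal closed chains are \<open>d\<close>-exact, and an exact part of
  \<open>w\<close> contributes only a boundary, because \<Delta> anticommutes with
  \<open>d\<close>.\<close>

lemma deformation_torsion_free:
  assumes n: "0 < n" and z: "z \<in> frags G" and w: "w \<in> frags G" "\<d> w = 0"
    and y: "y \<in> frags G" and eq: "frag_cmul n z = \<D> w + \<d> y"
  shows "\<exists>w'\<in>frags G. \<exists>y'\<in>frags G. \<d> w' = 0 \<and> z = \<D> w' + \<d> y'"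
proof -
  obtain z0 z1 where z01: "z0 \<in> frags (level G lev \<kappa>)" "z1 \<in> frags {g \<in> G. lev g \<noteq> \<kappa>}" "z = z0 + z1"
    by (rule split_diagonal[OF z])
  obtain w0 w1 where w01: "w0 \<in> frags (level G lev \<kappa>)" "w1 \<in> frags {g \<in> G. lev g \<noteq> \<kappa>}" "w = w0 + w1"
    by (rule split_diagonal[OF w(1)])
  have d01: "\<d> w0 \<in> frags (level G lev (Suc \<kappa>))" "\<d> w1 \<in> frags {g \<in> G. lev g \<noteq> Suc \<kappa>}"
    by (rule d_shift[OF w01(1)], simp, rule d_shift[OF w01(2)], simp)
  have "\<d> w0 + \<d> w1 = 0 + 0" using w(2) w01(3) by (simp add: frag_extend_simps)
  from frags_disjoint_cancel[OF d01(1) frags_0 d01(2) frags_0 _ this]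
  have dw: "\<d> w0 = 0" "\<d> w1 = 0" by auto
  obtain u where u: "u \<in> frags G" "w1 = \<d> u" using exact_off_diagonal[OF w01(2) dw(2)] by blast
  let ?y = "y - \<D> u"
  have y': "?y \<in> frags G" by (intro frags_diff y \<Delta>_in u)
  have eq': "frag_cmul n z = \<D> w0 + \<d> ?y"
    using eq w01(3) u d\<Delta>[OF u(1)] by (simp add: frag_extend_simps)
  have "frag_cmul n (\<d> z) = \<d> (\<D> w0) + \<d> (\<d> ?y)" using eq' by (metis frag_extend_cmul frag_extend_add)
  then have "frag_cmul n (\<d> z) = 0" using d\<Delta>[OF inG[OF w01(1)]] dw dd[OF y'] by (simp add: frag_extend_simps)
  then have dz: "\<d> z0 + \<d> z1 = 0 + 0" using n z01(3) by (simp add: frag_extend_simps)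
  have d01: "\<d> z0 \<in> frags (level G lev (Suc \<kappa>))" "\<d> z1 \<in> frags {g \<in> G. lev g \<noteq> Suc \<kappa>}"
    by (rule d_shift[OF z01(1)], simp, rule d_shift[OF z01(2)], simp)
  from frags_disjoint_cancel(2)[OF d01(1) frags_0 d01(2) frags_0 _ dz]
  have "\<d> z1 = 0" by auto
  then obtain t where t: "t \<in> frags G" "z1 = \<d> t" using exact_off_diagonal[OF z01(2)] by blast
  let ?L = "level G lev \<kappa>"
  have "proj ?L z0 = z0" "proj ?L z1 = 0" "proj ?L (\<D> w0) = \<D> w0"
    by (rule proj_eq[OF z01(1)], simp, rule proj_eq_0[OF z01(2)], blast, rule proj_eq[OF \<Delta>_shift[OF w01(1)]], simp)
  then have eq0: "frag_cmul n z0 = \<D> w0 + proj ?L (\<d> ?y)"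
    using arg_cong[OF eq', of "proj ?L"] z01(3) by (simp add: proj_simps)
  have "\<exists>y0\<in>frags (below G lev \<kappa>). proj ?L (\<d> ?y) = \<d> y0"
  proof (cases \<kappa>)
    case 0
    have "proj ?L (\<d> ?y) = 0"
    proof (rule proj_eq_0)
      show "\<d> ?y \<in> frags {g \<in> G. lev g \<noteq> 0}"
        by (rule d_shift[of _ "\<lambda>_. True"]) (use y' in auto)
    qed (use 0 in auto)
    then show ?thesis by (intro bexI[of _ 0]) (auto simp: proj_simps)
  next
    case (Suc M)
    have "proj (level G lev M) ?y \<in> frags (below G lev \<kappa>)"
      by (rule frags_mono[OF proj_in]) (auto simp: Suc)
    then show ?thesis using proj_level_d[OF y', of M] Suc by metis
  qed
  then obtain y0 where y0: "y0\<in>frags (below G lev \<kappa>)" "proj ?L (\<d> ?y) = \<d> y0" by blast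
  obtain w' y' where "w' \<in> frags G" "y' \<in> frags G" "\<d> w' = 0" "z0 = \<D> w' + \<d> y'"
    using deformation_torsion_free_diagonal[OF n z01(1) w01(1) dw(1) y0(1)] eq0 y0(2) by metis
  then show ?thesis
    using t z01(3) by (intro bexI[of _ w'] bexI[of _ "y' + t"]) (auto simp: frag_extend_simps intro: frags_add)
qed

end

section \<open>Colourings\<close>

context graph
begin

definition colourings :: "'v set \<Rightarrow> 'v set \<Rightarrow> nat set \<times> 'v set \<Rightarrow> 'v set set" where
  "colourings V B = (\<lambda>(P, W). {W'. W \<subseteq> W' \<and> W' \<subseteq> V \<and> closed P W' \<and> W' \<inter> B = {}})"

text \<open>If \<open>x\<^sup>2 = x\<close>, then \<open>x\<close> is the sum of the idempotents belonging to the colourings that contain it;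
  the chain \<open>(P, W')\<close> on the right now stands for the idempotent of the colouring \<open>W'\<close>.\<close>

definition idem :: "'v set \<Rightarrow> 'v set \<Rightarrow> nat set \<times> 'v set \<Rightarrow> (nat set \<times> 'v set) \<Rightarrow>\<^sub>0 int" where
  "idem V B = (\<lambda>(P, W). \<Sum>W'\<in>colourings V B (P, W). frag_of (P, W'))"

definition mono_edges :: "nat set \<Rightarrow> 'v set \<Rightarrow> nat set" where
  "mono_edges U W = {r \<in> U. a r \<in> W \<longleftrightarrow> b r \<in> W}"

text \<open>Merging two idempotents gives an idempotent if their colours agree and zero otherwise.
  So the colouring never changes, and only its monochromatic edges can be added.\<close>

definition cdiff :: "nat set \<Rightarrow> nat set \<times> 'v set \<Rightarrow> (nat set \<times> 'v set) \<Rightarrow>\<^sub>0 int" where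
  "cdiff U = (\<lambda>(P, W). \<Sum>r\<in>mono_edges U W - P. frag_cmul (esign P r) (frag_of (insert r P, W)))"

text \<open>Removes one monochromatic edge, chosen from the colouring alone; its independence of
  \<open>P\<close> makes this a contracting homotopy.\<close>

definition chomotopy :: "nat set \<Rightarrow> nat set \<times> 'v set \<Rightarrow> (nat set \<times> 'v set) \<Rightarrow>\<^sub>0 int" where
  "chomotopy U = (\<lambda>(P, W). let e = (SOME r. r \<in> mono_edges U W) in
     if e \<in> P then frag_cmul (esign (P - {e}) e) (frag_of (P - {e}, W)) else 0)"

text \<open>Adding and removing the chosen edge gives the identity; the terms from the other edges
  occur in both orders with opposite signs.\<close>

lemma cdiff_chomotopy:
  assumes U: "finite U" and P: "P \<subseteq> U" and ex: "mono_edges U W \<noteq> {}"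
  shows "frag_extend (cdiff U) (chomotopy U (P, W)) + frag_extend (chomotopy U) (cdiff U (P, W)) = frag_of (P, W)"
proof -
  define e where "e = (SOME r. r \<in> mono_edges U W)"
  have e: "e \<in> mono_edges U W" unfolding e_def using ex some_in_eq by blast
  have finM: "finite (mono_edges U W)" using U by (simp add: mono_edges_def)
  have finP: "finite P" using P U finite_subset by blast
  have h: "chomotopy U (Q, W) = (if e \<in> Q then frag_cmul (esign (Q - {e}) e) (frag_of (Q - {e}, W)) else 0)" for Q
    by (simp add: chomotopy_def e_def Let_def)
  have hd: "frag_extend (chomotopy U) (cdiff U (P, W)) =
    (\<Sum>r\<in>mono_edges U W - P. frag_cmul (esign P r) (chomotopy U (insert r P, W)))"
    using finM by (simp add: cdiff_def frag_extend_sum frag_extend_cmul)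
  show ?thesis
  proof (cases "e \<in> P")
    case False
    have "(\<Sum>r\<in>mono_edges U W - P. frag_cmul (esign P r) (chomotopy U (insert r P, W))) =
      (\<Sum>r\<in>mono_edges U W - P. if r = e then frag_of (P, W) else 0)"
      by (rule sum.cong) (use False in \<open>auto simp: h frag_cmul_sign_sign\<close>)
    also have "\<dots> = frag_of (P, W)" using finM e False by simp
    finally show ?thesis using hd False by (simp add: h)
  next
    case True
    define Q where "Q = P - {e}"
    have Q: "e \<notin> Q" "P = insert e Q" "finite Q" using True finP by (auto simp: Q_def)
    have "frag_extend (cdiff U) (chomotopy U (P, W)) =
      frag_cmul (esign Q e) (\<Sum>r\<in>mono_edges U W - Q. frag_cmul (esign Q r) (frag_of (insert r Q, W)))"
      using True by (simp add: h frag_extend_cmul cdiff_def Q_def)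
    also have "mono_edges U W - Q = insert e (mono_edges U W - P)" using e Q by auto
    also have "frag_cmul (esign Q e) (\<Sum>r\<in>insert e (mono_edges U W - P). frag_cmul (esign Q r) (frag_of (insert r Q, W))) =
       frag_of (P, W) + (\<Sum>r\<in>mono_edges U W - P. frag_cmul (esign Q e * esign Q r) (frag_of (insert r Q, W)))"
      using finM True Q(2) by (simp add: frag_cmul_distrib2 frag_cmul_sum)
    finally have 1: "frag_extend (cdiff U) (chomotopy U (P, W)) = frag_of (P, W) +
       (\<Sum>r\<in>mono_edges U W - P. frag_cmul (esign Q e * esign Q r) (frag_of (insert r Q, W)))" .
    have 2: "frag_extend (chomotopy U) (cdiff U (P, W)) =
      (\<Sum>r\<in>mono_edges U W - P. - frag_cmul (esign Q e * esign Q r) (frag_of (insert r Q, W)))"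
      unfolding hd
    proof (rule sum.cong)
      fix r assume r: "r \<in> mono_edges U W - P"
      then have r': "r \<notin> Q" "r \<noteq> e" "insert r P - {e} = insert r Q" using Q True by auto
      have "esign Q e * esign (insert e Q) r = - (esign Q r * esign (insert r Q) e)"
        by (rule esign_anticommute) (use Q r' in auto)
      moreover have "esign Q e = 1 \<or> esign Q e = -1" "esign Q r = 1 \<or> esign Q r = -1"
        "esign (insert e Q) r = 1 \<or> esign (insert e Q) r = -1" "esign (insert r Q) e = 1 \<or> esign (insert r Q) e = -1"
        by (simp_all add: esign_def minus_one_power_iff)
      ultimately have "esign P r * esign (insert r Q) e = - (esign Q e * esign Q r)"
        unfolding Q(2) by auto
      then show "frag_cmul (esign P r) (chomotopy U (insert r P, W)) =
          - frag_cmul (esign Q e * esign Q r) (frag_of (insert r Q, W))"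
        using True r' by (simp add: h)
    qed simp
    show ?thesis unfolding 1 2 sum_negf by simp
  qed
qed

text \<open>Two components that become equal include that of \<open>a r\<close>, so the map of
  components is injective on the others. A single edge hence loses at most one label.\<close>

lemma ncomp_insert_ge:
  assumes W: "finite W" "closed P W"
  shows "ncomp P W \<le> Suc (ncomp (insert r P) (eq (insert r P) `` W))"
proof -
  let ?Q = "insert r P" and ?S = "W // eq P - {eq P `` {a r}}"
  have finS: "finite (W // eq P)" by (rule finite_quotient_eq[OF W(1)])
  have "inj_on (\<lambda>K. eq ?Q `` K) ?S"
  proof (rule inj_onI)
    fix K K' assume K: "K \<in> ?S" and K': "K' \<in> ?S" and eq: "eq ?Q `` K = eq ?Q `` K'"
    obtain x y where x: "K = eq P `` {x}" and y: "K' = eq P `` {y}" using K K' by (auto simp: quotient_def)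
    have "eq ?Q `` {x} = eq ?Q `` {y}" using eq Image_Image[of P ?Q "{x}"] Image_Image[of P ?Q "{y}"] unfolding x y
      by (simp add: subset_insertI)
    then have "(x, y) \<in> eq ?Q" using eq_class_iff by blast
    moreover have "(x, a r) \<notin> eq P" "(a r, y) \<notin> eq P"
      using K K' eq_classI[of x "a r" P] eq_classI[of "a r" y P] x y by auto
    ultimately have "(x, y) \<in> eq P" by (auto simp: eq_insert_iff)
    then show "K = K'" using x y eq_classI by blast
  qed
  then have "card ?S = card ((\<lambda>K. eq ?Q `` K) ` ?S)" by (simp add: card_image)
  also have "\<dots> \<le> card ((\<lambda>K. eq ?Q `` K) ` (W // eq P))"
    using finS by (intro card_mono) auto
  also have "\<dots> = ncomp ?Q (eq ?Q `` W)" unfolding ncomp_def by (subst quotient_Image[of P ?Q]) auto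
  finally have "card ?S \<le> ncomp ?Q (eq ?Q `` W)" .
  moreover have "card (W // eq P) \<le> Suc (card ?S)"
    using finS by (auto simp: card_Diff_singleton_if)
  ultimately show ?thesis unfolding ncomp_def by linarith
qed

text \<open>The coefficient of \<open>t\<close> in \<open>diff t\<close>: the terms where two labels
  merge into one.\<close>

definition dmerge :: "nat set \<Rightarrow> 'v set \<Rightarrow> nat set \<times> 'v set \<Rightarrow> (nat set \<times> 'v set) \<Rightarrow>\<^sub>0 int" where
  "dmerge U B g = diff 1 U B g - diff 0 U B g"

section \<open>The idempotent basis and the deformed complex\<close>

context
  fixes V :: "'v set" and U :: "nat set" and B :: "'v set"
  assumes fin: "finite V" "finite U" and V: "closed U V"
begin

lemma finite_colourings: "finite (colourings V B g)"
  using fin by (auto simp: colourings_def split: prod.splits intro: finite_subset[of _ "Pow V"])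

lemma idem_in: "g \<in> gens V {} U B \<Longrightarrow> idem V B g \<in> frags (gens V {} U B)"
  by (cases g) (auto simp: idem_def colourings_def gens_def intro!: frags_sum)

text \<open>A colouring that contains the merged labels is one that contains the old labels and
  gives both ends of \<open>r\<close> the same colour.\<close>

lemma idem_diff:
  assumes g: "g \<in> gens V {} U B"
  shows "frag_extend (idem V B) (diff 1 U B g) = frag_extend (cdiff U) (idem V B g)"
proof -
  obtain P W where [simp]: "g = (P, W)" by (cases g)
  let ?S = "colourings V B (P, W)"
  have push: "frag_extend (idem V B) (push 1 B (insert r P) (P, W)) =
     (\<Sum>W'\<in>?S. if a r \<in> W' \<longleftrightarrow> b r \<in> W' then frag_of (insert r P, W') else 0)" for r
  proof -
    let ?Q = "insert r P"
    have S: "{W' \<in> ?S. a r \<in> W' \<longleftrightarrow> b r \<in> W'} = colourings V B (?Q, eq ?Q `` W)"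
    proof (intro equalityI subsetI)
      fix W' assume "W' \<in> {W' \<in> ?S. a r \<in> W' \<longleftrightarrow> b r \<in> W'}"
      then show "W' \<in> colourings V B (?Q, eq ?Q `` W)"
        using Image_subset[of ?Q W' W] by (auto simp: colourings_def closed_insert)
    next
      fix W' assume "W' \<in> colourings V B (?Q, eq ?Q `` W)"
      then show "W' \<in> {W' \<in> ?S. a r \<in> W' \<longleftrightarrow> b r \<in> W'}"
        using Image_superset[of W ?Q] by (auto simp: colourings_def closed_insert)
    qed
    have "(\<Sum>W'\<in>?S. if a r \<in> W' \<longleftrightarrow> b r \<in> W' then frag_of (?Q, W') else 0) =
      (\<Sum>W'\<in>{W' \<in> ?S. a r \<in> W' \<longleftrightarrow> b r \<in> W'}. frag_of (?Q, W'))"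
      using finite_colourings[of "(P, W)"] by (simp add: sum.inter_filter)
    also have "\<dots> = idem V B (?Q, eq ?Q `` W)" unfolding S by (simp add: idem_def)
    also have "\<dots> = frag_extend (idem V B) (push 1 B ?Q (P, W))"
    proof (cases "eq ?Q `` W \<inter> B = {}")
      case False
      then have "colourings V B (?Q, eq ?Q `` W) = {}" by (auto simp: colourings_def)
      then show ?thesis using False by (simp add: push_def idem_def)
    qed (simp add: push_def)
    finally show ?thesis ..
  qed
  have "frag_extend (idem V B) (diff 1 U B g) = (\<Sum>r\<in>U - P. frag_cmul (esign P r)
      (\<Sum>W'\<in>?S. if a r \<in> W' \<longleftrightarrow> b r \<in> W' then frag_of (insert r P, W') else 0))"
    using fin by (simp add: diff_def frag_extend_sum frag_extend_cmul push)
  also have "\<dots> = (\<Sum>W'\<in>?S. \<Sum>r\<in>U - P. if a r \<in> W' \<longleftrightarrow> b r \<in> W' then frag_cmul (esign P r) (frag_of (insert r P, W')) else 0)"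
    unfolding frag_cmul_sum by (subst sum.swap) (auto intro!: sum.cong)
  also have "\<dots> = (\<Sum>W'\<in>?S. cdiff U (P, W'))"
  proof (rule sum.cong)
    fix W'
    have "mono_edges U W' - P = {r \<in> U - P. a r \<in> W' \<longleftrightarrow> b r \<in> W'}" by (auto simp: mono_edges_def)
    then show "(\<Sum>r\<in>U - P. if a r \<in> W' \<longleftrightarrow> b r \<in> W' then frag_cmul (esign P r) (frag_of (insert r P, W')) else 0)
      = cdiff U (P, W')"
      using sum.inter_filter[of "U - P" "\<lambda>r. frag_cmul (esign P r) (frag_of (insert r P, W'))" "\<lambda>r. a r \<in> W' \<longleftrightarrow> b r \<in> W'"] fin
      by (simp add: cdiff_def)
  qed simp
  also have "\<dots> = frag_extend (cdiff U) (idem V B g)"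
    using finite_colourings[of "(P, W)"] by (simp add: idem_def frag_extend_sum)
  finally show ?thesis .
qed

lemma idem_split:
  assumes "(P, W) \<in> gens V {} U B"
  shows "idem V B (P, W) = frag_of (P, W) + (\<Sum>W'\<in>colourings V B (P, W) - {W}. frag_of (P, W'))"
proof -
  have "W \<in> colourings V B (P, W)" using assms by (auto simp: colourings_def gens_def)
  then show ?thesis using finite_colourings[of "(P, W)"] by (simp add: idem_def sum.remove)
qed

text \<open>The change of basis is unitriangular for inclusion of label sets, and larger label sets
  are covered by induction.\<close>

lemma idem_surj_gen: "(P, W) \<in> gens V {} U B \<Longrightarrow> \<exists>q\<in>frags (gens V {} U B). frag_extend (idem V B) q = frag_of (P, W)"
proof (induction "card (V - W)" arbitrary: W rule: less_induct)
  case less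
  let ?S = "colourings V B (P, W) - {W}"
  have "\<exists>q\<in>frags (gens V {} U B). frag_extend (idem V B) q = frag_of (P, W')" if "W' \<in> ?S" for W'
  proof (rule less.hyps)
    show "card (V - W') < card (V - W)"
    proof (rule psubset_card_mono)
      show "V - W' \<subset> V - W" using that by (auto simp: colourings_def)
    qed (use fin in simp)
    show "(P, W') \<in> gens V {} U B" using that less.prems by (auto simp: colourings_def gens_def)
  qed
  then obtain q where q: "\<And>W'. W' \<in> ?S \<Longrightarrow> q W' \<in> frags (gens V {} U B) \<and> frag_extend (idem V B) (q W') = frag_of (P, W')"
    by metis
  have "frag_extend (idem V B) (frag_of (P, W) - (\<Sum>W'\<in>?S. q W')) = frag_of (P, W)"
    using finite_colourings[of "(P, W)"] idem_split[OF less.prems] q by (simp add: frag_extend_simps frag_extend_sum)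
  moreover have "frag_of (P, W) - (\<Sum>W'\<in>?S. q W') \<in> frags (gens V {} U B)"
    using q less.prems by (intro frags_diff frags_sum) auto
  ultimately show ?case by blast
qed

lemma idem_surj:
  assumes "y \<in> frags (gens V {} U B)"
  shows "\<exists>q\<in>frags (gens V {} U B). frag_extend (idem V B) q = y"
proof -
  obtain q where q: "\<And>g. g \<in> gens V {} U B \<Longrightarrow> q g \<in> frags (gens V {} U B) \<and> frag_extend (idem V B) (q g) = frag_of g"
  proof -
    have "\<exists>q\<in>frags (gens V {} U B). frag_extend (idem V B) q = frag_of g" if "g \<in> gens V {} U B" for g
      using idem_surj_gen[of "fst g" "snd g"] that by simp
    then show ?thesis using that[of "\<lambda>g. SOME q. q\<in>frags (gens V {} U B) \<and> frag_extend (idem V B) q = frag_of g"]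
      by (metis (mono_tags, lifting) someI_ex)
  qed
  have "frag_extend (idem V B) (frag_extend q y) = y"
    unfolding extend_compose using assms by (rule extend_id) (simp add: q)
  moreover have "frag_extend q y \<in> frags (gens V {} U B)"
    using assms by (rule frags_extend) (simp add: q)
  ultimately show ?thesis by blast
qed

text \<open>Unitriangularity again: no other generator in the support contributes to the coefficient
  at a smallest label set.\<close>

lemma idem_inj:
  assumes z: "z \<in> frags (gens V {} U B)" and 0: "frag_extend (idem V B) z = 0"
  shows "z = 0"
proof (rule ccontr)
  assume "z \<noteq> 0"
  then have "Poly_Mapping.keys z \<noteq> {}" by simp
  then obtain g where g: "g \<in> Poly_Mapping.keys z"
    and min: "\<And>h. h \<in> Poly_Mapping.keys z \<Longrightarrow> card (snd g) \<le> card (snd h)"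
    using ex_has_least_nat[of "\<lambda>g. g \<in> Poly_Mapping.keys z" _ "\<lambda>g. card (snd g)"] by blast
  obtain P W where gPW: "g = (P, W)" by (cases g)
  have "Poly_Mapping.lookup (idem V B h) g = (if h = g then 1 else 0)" if h: "h \<in> Poly_Mapping.keys z" for h
  proof -
    obtain P' W' where hPW: "h = (P', W')" by (cases h)
    have hg: "(P', W') \<in> gens V {} U B" using h z hPW by (auto simp: frags_def)
    have "Poly_Mapping.lookup (idem V B h) g = (\<Sum>X\<in>colourings V B (P', W'). if (P', X) = g then 1 else 0)"
      by (simp add: idem_def hPW lookup_sum eq_commute)
    also have "\<dots> = (if P' = P \<and> W \<in> colourings V B (P', W') then 1 else 0)"
      using finite_colourings[of "(P', W')"] by (cases "P' = P") (simp_all add: gPW)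
    also have "\<dots> = (if h = g then 1 else 0)"
    proof -
      have "W' = W" if "W \<in> colourings V B (P', W')"
      proof -
        have "W' \<subseteq> W" "W \<subseteq> V" using that by (auto simp: colourings_def)
        then show ?thesis using min[OF h] fin finite_subset[of W V] by (metis card_seteq gPW hPW snd_conv)
      qed
      moreover have "W' \<in> colourings V B (P', W')" using hg by (auto simp: colourings_def gens_def)
      ultimately show ?thesis by (auto simp: gPW hPW)
    qed
    finally show ?thesis .
  qed
  then have "Poly_Mapping.lookup (frag_extend (idem V B) z) g =
     (\<Sum>h\<in>Poly_Mapping.keys z. if h = g then Poly_Mapping.lookup z h else 0)"
    unfolding lookup_frag_extend by (intro sum.cong) auto
  also have "\<dots> = Poly_Mapping.lookup z g" using g by simp
  finally show False using 0 g by (simp add: in_keys_iff)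
qed

text \<open>Colourings are constant along the edges of \<open>P\<close>, so a nonempty
  \<open>P\<close> supplies a monochromatic edge and with it the homotopy. The primitive is carried
  back through the change of basis.\<close>

lemma diff_1_exact:
  assumes z: "z \<in> frags {g \<in> gens V {} U B. fst g \<noteq> {}}" and 0: "frag_extend (diff 1 U B) z = 0"
  shows "\<exists>y\<in>frags (gens V {} U B). z = frag_extend (diff 1 U B) y"
proof -
  let ?G = "gens V {} U B" and ?G' = "{g \<in> gens V {} U B. fst g \<noteq> {}}"
  let ?i = "frag_extend (idem V B)" and ?c = "frag_extend (cdiff U)" and ?h = "frag_extend (chomotopy U)"
  have zG: "z \<in> frags ?G" using z by (rule frags_mono) auto
  have comm: "?i (frag_extend (diff 1 U B) y) = ?c (?i y)" if "y \<in> frags ?G" for y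
    unfolding extend_compose using that by (rule extend_cong) (rule idem_diff)
  have iz: "?i z \<in> frags ?G'"
    using z by (rule frags_extend) (auto simp: idem_def colourings_def gens_def intro!: frags_sum)
  have ciz: "?c (?i z) = 0" using comm[OF zG] 0 by simp
  have hom: "?c (?h y) + ?h (?c y) = y" if "y \<in> frags ?G'" for y
    unfolding extend_compose extend_add_fun[symmetric] using that
  proof (rule extend_id)
    fix g assume g: "g \<in> ?G'"
    obtain P W where [simp]: "g = (P, W)" by (cases g)
    have "P \<subseteq> U" "closed P W" "P \<noteq> {}" using g by (auto simp: gens_def)
    then have "mono_edges U W \<noteq> {}"
      using closedD[OF \<open>closed P W\<close> eq_edge] by (fastforce simp: mono_edges_def)
    then show "?c (chomotopy U g) + ?h (cdiff U g) = frag_of g"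
      using cdiff_chomotopy[OF fin(2) \<open>P \<subseteq> U\<close>] by simp
  qed
  have 1: "?c (?h (?i z)) = ?i z" using iz ciz hom[of "?i z"] by simp
  have "?h (?i z) \<in> frags ?G"
  proof (rule frags_extend)
    show "?i z \<in> frags ?G" using zG by (rule frags_extend) (rule idem_in)
    fix g assume "g \<in> ?G"
    then show "chomotopy U g \<in> frags ?G"
      by (cases g) (auto simp: chomotopy_def Let_def gens_def intro!: frags_cmul elim: closed_mono)
  qed
  then obtain q where q: "q \<in> frags ?G" "?i q = ?h (?i z)" using idem_surj by blast
  have "?i (z - frag_extend (diff 1 U B) q) = 0"
    using 1 comm[OF q(1)] q(2) by (simp add: frag_extend_simps)
  moreover have "z - frag_extend (diff 1 U B) q \<in> frags ?G"
    using zG q(1) diff_in_gens[OF fin V] by (intro frags_diff frags_extend[OF q(1)]) auto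
  ultimately have "z - frag_extend (diff 1 U B) q = 0" using idem_inj by blast
  then show ?thesis using q(1) by auto
qed

text \<open>A surviving term gains one edge and loses exactly one label.\<close>

lemma push_1_diff_level:
  assumes g: "(P, W) \<in> gens V {} U B" and r: "r \<in> U - P"
  shows "push 1 B (insert r P) (P, W) - push 0 B (insert r P) (P, W) \<in> frags (level (gens V {} U B) lev (lev (P, W)))"
proof (cases "ncomp (insert r P) (eq (insert r P) `` W) < ncomp P W \<and> eq (insert r P) `` W \<inter> B = {}")
  case False
  then have "push 1 B (insert r P) (P, W) - push 0 B (insert r P) (P, W) = 0"
    by (auto simp: push_def Let_def)
  then show ?thesis by simp
next
  case True
  let ?Q = "insert r P"
  have W: "finite W" "closed P W" using g fin finite_subset by (auto simp: gens_def)
  have P: "finite P" using g fin finite_subset by (auto simp: gens_def)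
  have "ncomp P W = Suc (ncomp ?Q (eq ?Q `` W))" using True ncomp_insert_ge[OF W, of r] by linarith
  then have "lev (?Q, eq ?Q `` W) = lev (P, W)" using P r by (simp add: lev_def)
  moreover have "(?Q, eq ?Q `` W) \<in> gens V {} U B"
    using True gens_Image[OF fin V g, of ?Q] g r by (auto simp: gens_def closed_Image)
  moreover have "push 1 B ?Q (P, W) - push 0 B ?Q (P, W) = frag_of (?Q, eq ?Q `` W)"
    using True by (simp add: push_def Let_def)
  ultimately show ?thesis by simp
qed

lemma dmerge_level: "g \<in> gens V {} U B \<Longrightarrow> dmerge U B g \<in> frags (level (gens V {} U B) lev (lev g))"
proof -
  assume g: "g \<in> gens V {} U B"
  obtain P W where [simp]: "g = (P, W)" by (cases g)
  have "dmerge U B g = (\<Sum>r\<in>U - P. frag_cmul (esign P r) (push 1 B (insert r P) (P, W) - push 0 B (insert r P) (P, W)))"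
    by (simp add: dmerge_def diff_def sum_subtractf frag_cmul_diff2)
  then show ?thesis using push_1_diff_level g by (auto intro!: frags_sum frags_cmul)
qed

lemma diff_deg:
  assumes g: "g \<in> gens V {} U B"
  shows "diff t U B g \<in> frags (level (gens V {} U B) (card \<circ> fst) (Suc ((card \<circ> fst) g)))"
proof -
  obtain P W where [simp]: "g = (P, W)" by (cases g)
  have P: "finite P" "P \<subseteq> U" using g fin finite_subset by (auto simp: gens_def)
  have "push t B (insert r P) (P, W) \<in> frags (level (gens V {} U B) (card \<circ> fst) (Suc (card P)))" if "r \<in> U - P" for r
  proof -
    have "push t B (insert r P) (P, W) \<in> frags (gens V {} U B)"
      by (rule push_in_gens[OF fin V]) (use g that P in auto)
    moreover have "push t B (insert r P) (P, W) \<in> frags {g. (card \<circ> fst) g = Suc (card P)}"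
      using that P by (auto simp: push_def Let_def intro!: frags_cmul)
    ultimately have "push t B (insert r P) (P, W) \<in> frags (gens V {} U B \<inter> {g. (card \<circ> fst) g = Suc (card P)})"
      by (rule frags_Int)
    then show ?thesis by (rule frags_mono) auto
  qed
  then show ?thesis by (auto simp: diff_def intro!: frags_sum frags_cmul)
qed

text \<open>At most one label is lost per edge, so \<open>diff t\<close> has degree one in
  \<open>t\<close>.\<close>

lemma diff_minus_1: 
  assumes g: "g \<in> gens V {} U B"
  shows "diff (-1) U B g = diff 0 U B g - dmerge U B g"
proof -
  obtain P W where [simp]: "g = (P, W)" by (cases g)
  have W: "finite W" "closed P W" using g fin finite_subset by (auto simp: gens_def)
  have "push (-1) B (insert r P) (P, W) = push 0 B (insert r P) (P, W) -
      (push 1 B (insert r P) (P, W) - push 0 B (insert r P) (P, W))" for r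
  proof -
    let ?Q = "insert r P"
    consider "ncomp P W - ncomp ?Q (eq ?Q `` W) = 0" | "ncomp P W - ncomp ?Q (eq ?Q `` W) = 1"
      using ncomp_insert_ge[OF W, of r] by linarith
    then show ?thesis by cases (simp_all add: push_def Let_def)
  qed
  then show ?thesis
    by (simp add: dmerge_def diff_def sum_subtractf frag_cmul_diff2)
qed

text \<open>The square of \<open>diff t\<close> vanishes for t = 0, 1 and -1. Adding the relations
  at 1 and -1 leaves twice the square of \<open>dmerge\<close>, and 2 can be cancelled among chains;
  the relation at 1 then leaves the anticommutator.\<close>

lemma dmerge_relations:
  assumes z: "z \<in> frags (gens V {} U B)"
  shows "frag_extend (diff 0 U B) (frag_extend (dmerge U B) z) = - frag_extend (dmerge U B) (frag_extend (diff 0 U B) z)"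
    "frag_extend (dmerge U B) (frag_extend (dmerge U B) z) = 0"
proof -
  let ?d = "frag_extend (diff 0 U B)" and ?m = "frag_extend (dmerge U B)"
  let ?G = "gens V {} U B"
  have m: "?m x = frag_extend (diff 1 U B) x - ?d x" for x
    unfolding dmerge_def by (rule extend_diff_fun)
  have m': "frag_extend (diff (-1) U B) x = ?d x - ?m x" if "x \<in> frags ?G" for x
    unfolding extend_diff_fun[symmetric] using that by (rule extend_cong) (rule diff_minus_1)
  have sq: "frag_extend (diff t U B) (frag_extend (diff t U B) z) = 0" for t
    unfolding extend_compose using z by (rule extend_eq_0) (rule diff_square[OF fin V])
  have inG: "frag_extend (diff t U B) x \<in> frags ?G" if "x \<in> frags ?G" for t x
    using that by (rule frags_extend) (rule diff_in_gens[OF fin V])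
  have 1: "?d (?d z) + ?d (?m z) + ?m (?d z) + ?m (?m z) = 0"
    using sq[of 1] by (simp add: m frag_extend_simps algebra_simps)
  have 2: "?d (?d z) - ?d (?m z) - ?m (?d z) + ?m (?m z) = 0"
  proof -
    have "?d (?d z - ?m z) - ?m (?d z - ?m z) = 0"
      using sq[of "-1"] m'[OF inG[OF z, of "-1"]] by (simp only: m'[OF z])
    then show ?thesis by (simp add: frag_extend_simps algebra_simps)
  qed
  have 3: "?d (?d z) = 0" by (rule sq)
  have "frag_cmul 2 (?m (?m z)) = 0" unfolding frag_cmul_2 using 1 2 3 by (simp add: algebra_simps)
  then show 4: "?m (?m z) = 0" by simp
  show "?d (?m z) = - ?m (?d z)" using 1 3 4 by (simp add: eq_neg_iff_add_eq_0)
qed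

lemma deformation_gens:
  assumes ends: "\<And>r. r \<in> U \<Longrightarrow> a r \<in> V \<and> b r \<in> V"
    and base: "\<And>x. x \<in> V \<Longrightarrow> \<exists>\<beta>\<in>B. (x, \<beta>) \<in> eq U"
  shows "deformation (gens V {} U B) lev (card \<circ> fst) (corank V {} B) (diff 0 U B) (dmerge U B)"
proof unfold_locales
  show "thin (gens V {} U B) lev (corank V {} B) (diff 0 U B)"
    by (rule thin_gens[OF fin _ V ends base]) auto
  show "frag_extend (diff 0 U B) (frag_extend (diff 0 U B) z) = 0" if "z \<in> frags (gens V {} U B)" for z
    unfolding extend_compose using that by (rule extend_eq_0) (rule diff_square[OF fin V])
  fix g assume g: "g \<in> gens V {} U B"
  show "diff 0 U B g \<in> frags (level (gens V {} U B) lev (Suc (lev g)))"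
    using graded_diff[OF fin V] g by (auto simp: graded_differential_def)
  show "dmerge U B g \<in> frags (level (gens V {} U B) (card \<circ> fst) (Suc ((card \<circ> fst) g)))"
    unfolding dmerge_def by (intro frags_diff diff_deg g)
next
  fix z assume z: "z \<in> frags {g \<in> gens V {} U B. 0 < (card \<circ> fst) g}"
    and 0: "frag_extend (diff 0 U B) z + frag_extend (dmerge U B) z = 0"
  have m: "frag_extend (diff 0 U B) x + frag_extend (dmerge U B) x = frag_extend (diff 1 U B) x" for x
    unfolding dmerge_def extend_diff_fun by simp
  have "z \<in> frags {g \<in> gens V {} U B. fst g \<noteq> {}}" using z by (rule frags_mono) auto
  then show "\<exists>y\<in>frags (gens V {} U B). z = frag_extend (diff 0 U B) y + frag_extend (dmerge U B) y"
    using diff_1_exact 0 unfolding m by blast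
qed (use dmerge_level diff_deg dmerge_relations in auto)

end

end

section \<open>Connected graphs\<close>

context graph
begin

lemma class_facts:
  assumes W: "finite W" "closed P W" and K: "K \<in> W // eq P"
  shows "K \<subseteq> W" "closed P (W - K)" "ncomp P W = Suc (ncomp P (W - K))" "finite K"
proof -
  obtain x where x: "x \<in> W" "K = eq P `` {x}" using K by (auto simp: quotient_def)
  show KW: "K \<subseteq> W" unfolding x(2) using x(1) by (intro Image_subset[OF W(2)]) simp
  then show "finite K" using W(1) finite_subset by blast
  have cK: "closed P K" unfolding x(2) by (rule closed_Image)
  then show cl: "closed P (W - K)" by (rule closed_Diff[OF W(2)])
  have "ncomp P ((W - K) \<union> K) = ncomp P (W - K) + ncomp P K"
    by (rule ncomp_Un) (use W \<open>finite K\<close> cl cK in auto)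
  moreover have "(W - K) \<union> K = W" using KW by blast
  ultimately show "ncomp P W = Suc (ncomp P (W - K))" by (simp add: x(2))
qed

lemma Image_class: "P \<subseteq> Q \<Longrightarrow> K \<in> W // eq P \<Longrightarrow> x \<in> K \<Longrightarrow> eq Q `` K = eq Q `` {x}"
proof -
  assume PQ: "P \<subseteq> Q" and K: "K \<in> W // eq P" and x: "x \<in> K"
  obtain y where "K = eq P `` {y}" using K by (auto simp: quotient_def)
  then have "K = eq P `` {x}" using x eq_classI[of y x P] by simp
  then show ?thesis using Image_Image[OF PQ] by simp
qed

text \<open>If no label is lost, distinct labelled components stay distinct, so removing one of them
  commutes with merging.\<close>

lemma Image_remove_class:
  assumes W: "finite W" "closed P W" and PQ: "P \<subseteq> Q" and same: "ncomp Q (eq Q `` W) = ncomp P W"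
  shows "inj_on (\<lambda>K. eq Q `` K) (W // eq P)"
    "K \<in> W // eq P \<Longrightarrow> eq Q `` (W - K) = eq Q `` W - eq Q `` K"
proof -
  show inj: "inj_on (\<lambda>K. eq Q `` K) (W // eq P)"
    using same unfolding ncomp_def quotient_Image[OF PQ] by (rule eq_card_imp_inj_on[OF finite_quotient_eq[OF W(1)]])
  assume K: "K \<in> W // eq P"
  show "eq Q `` (W - K) = eq Q `` W - eq Q `` K"
  proof (intro equalityI subsetI)
    fix y assume "y \<in> eq Q `` (W - K)"
    then obtain x where x: "x \<in> W" "x \<notin> K" "(x, y) \<in> eq Q" by blast
    have "y \<notin> eq Q `` K"
    proof
      assume "y \<in> eq Q `` K"
      then obtain k where k: "k \<in> K" "(k, y) \<in> eq Q" by blast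
      have Kx: "eq P `` {x} \<in> W // eq P" using x(1) by (rule quotientI)
      have "eq Q `` (eq P `` {x}) = eq Q `` {x}" by (rule Image_Image[OF PQ])
      also have "\<dots> = eq Q `` {k}" using eq_classI[OF eq_trans[OF x(3) eq_sym[OF k(2)]]] .
      also have "\<dots> = eq Q `` K" using Image_class[OF PQ K k(1)] ..
      finally have "eq P `` {x} = K" using inj_onD[OF inj] Kx K by blast
      then show False using x(2) by auto
    qed
    then show "y \<in> eq Q `` W - eq Q `` K" using x by blast
  next
    fix y assume "y \<in> eq Q `` W - eq Q `` K"
    then show "y \<in> eq Q `` (W - K)" by blast
  qed
qed

lemma ncomp_insert_less:
  assumes W: "finite W" "closed P W" and ab: "a r \<in> W" "b r \<in> W" "(a r, b r) \<notin> eq P"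
  shows "ncomp (insert r P) (eq (insert r P) `` W) < ncomp P W"
proof -
  let ?Q = "insert r P" and ?f = "\<lambda>K. eq (insert r P) `` K"
  have PQ: "P \<subseteq> ?Q" by auto
  have fin: "finite (W // eq P)" by (rule finite_quotient_eq[OF W(1)])
  have Ka: "eq P `` {a r} \<in> W // eq P" "eq P `` {b r} \<in> W // eq P" using ab by (auto intro: quotientI)
  have ne: "eq P `` {a r} \<noteq> eq P `` {b r}" using ab(3) eq_class_iff by blast
  have "?f (eq P `` {a r}) = ?f (eq P `` {b r})"
    unfolding Image_Image[OF PQ] by (rule eq_classI) (simp add: eq_edge)
  then have "\<not> inj_on ?f (W // eq P)" using Ka ne inj_onD by metis
  then have "card (?f ` (W // eq P)) \<noteq> card (W // eq P)" using fin eq_card_imp_inj_on by blast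
  moreover have "card (?f ` (W // eq P)) \<le> card (W // eq P)" using fin by (rule card_image_le)
  ultimately show ?thesis unfolding ncomp_def quotient_Image[OF PQ] by simp
qed

lemma ncomp_insert_same:
  assumes W: "finite W" "closed P W" and ab: "\<not> (a r \<in> W \<and> b r \<in> W \<and> (a r, b r) \<notin> eq P)"
  shows "ncomp (insert r P) (eq (insert r P) `` W) = ncomp P W"
proof -
  let ?Q = "insert r P" and ?f = "\<lambda>K. eq (insert r P) `` K"
  have PQ: "P \<subseteq> ?Q" by auto
  have "inj_on ?f (W // eq P)"
  proof (rule inj_onI)
    fix K K' assume K: "K \<in> W // eq P" "K' \<in> W // eq P" and eq: "?f K = ?f K'"
    obtain x y where xy: "x \<in> W" "K = eq P `` {x}" "y \<in> W" "K' = eq P `` {y}" using K by (auto simp: quotient_def)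
    have "(x, y) \<in> eq ?Q" using eq unfolding xy Image_Image[OF PQ] eq_class_iff .
    moreover have "(x, y) \<in> eq P" if "(x, a r) \<in> eq P" "(b r, y) \<in> eq P"
    proof -
      have "a r \<in> W" "b r \<in> W" using that xy closedD[OF W(2)] by blast+
      then have "(a r, b r) \<in> eq P" using ab by blast
      then show ?thesis using that eq_trans by blast
    qed
    moreover have "(x, y) \<in> eq P" if "(x, b r) \<in> eq P" "(a r, y) \<in> eq P"
    proof -
      have "a r \<in> W" "b r \<in> W" using that xy closedD[OF W(2)] by blast+
      then have "(b r, a r) \<in> eq P" using ab eq_sym by blast
      then show ?thesis using that eq_trans by blast
    qed
    ultimately have "(x, y) \<in> eq P" by (auto simp: eq_insert_iff)
    then show "K = K'" unfolding xy by (rule eq_classI)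
  qed
  then show ?thesis unfolding ncomp_def quotient_Image[OF PQ] by (rule card_image)
qed

text \<open>Multiplication by \<open>x\<close> at the component of \<open>v\<close>. The unbased
  complex consists of the based generators and their images under this map.\<close>

definition add_base :: "'v \<Rightarrow> nat set \<times> 'v set \<Rightarrow> (nat set \<times> 'v set) \<Rightarrow>\<^sub>0 int" where
  "add_base v = (\<lambda>(P, W). frag_of (P, W \<union> eq P `` {v}))"

text \<open>The derivation with \<open>x \<mapsto> 1\<close>.  It does not respect \<open>x\<^sup>2 = 0\<close>, and the defect \<open>x\<^sup>2 \<mapsto> 2 x\<close> is the
  source of the factor two.\<close>

definition forget :: "nat set \<times> 'v set \<Rightarrow> (nat set \<times> 'v set) \<Rightarrow>\<^sub>0 int" where
  "forget = (\<lambda>(P, W). \<Sum>K\<in>W // eq P. frag_of (P, W - K))"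

lemma extend_diff_fixed:
  assumes "finite U" "z \<in> frags (range (Pair P))"
  shows "frag_extend (diff t U B) z =
    (\<Sum>r\<in>U - P. frag_cmul (esign P r) (frag_extend (push t B (insert r P)) z))"
proof -
  have "frag_extend (diff t U B) z =
    frag_extend (\<lambda>h. \<Sum>r\<in>U - P. frag_cmul (esign P r) (push t B (insert r P) h)) z"
    using assms(2) by (rule extend_cong) (auto simp: diff_def)
  also have "\<dots> = (\<Sum>r\<in>U - P. frag_cmul (esign P r) (frag_extend (push t B (insert r P)) z))"
    by (simp add: frag_extend_def frag_cmul_sum sum.swap[of _ "U - P"] mult.commute)
  finally show ?thesis .
qed

section \<open>The unbased complex as a cone over the based one\<close>

context
  fixes V :: "'v set" and U :: "nat set" and v :: 'v
  assumes fin: "finite V" "finite U" and V: "closed U V" and v: "v \<in> V"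
begin

text \<open>Both sides vanish once a label reaches \<open>v\<close>: in the unbased complex because
  x^2 = 0, in the based one because \<open>x\<close> is zero at \<open>v\<close>.\<close>

lemma push_add_base:
  assumes g: "(P, W) \<in> gens V {} U {v}" and r: "r \<in> U - P"
  shows "frag_extend (push 0 {} (insert r P)) (add_base v (P, W)) =
    frag_extend (add_base v) (push 0 {v} (insert r P) (P, W))"
proof -
  let ?Q = "insert r P"
  have W: "finite W" "closed P W" "v \<notin> W" "W \<subseteq> V" "P \<subseteq> U"
    using g fin finite_subset by (auto simp: gens_def)
  have PQ: "P \<subseteq> ?Q" by auto
  let ?K = "eq P `` {v}" and ?KQ = "eq ?Q `` {v}" and ?W' = "eq ?Q `` W"
  have KV: "?K \<subseteq> V" by (rule Image_subset[OF closed_mono[OF V W(5)]]) (use v in simp)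
  then have finK: "finite ?K" using fin finite_subset by blast
  have disj: "W \<inter> ?K = {}" using W closedD[OF W(2)] by blast
  have img: "eq ?Q `` (W \<union> ?K) = ?W' \<union> ?KQ" using Image_Image[OF PQ, of "{v}"] by (simp add: Image_Un)
  have nP: "ncomp P (W \<union> ?K) = Suc (ncomp P W)"
    using ncomp_Un[OF W(1) finK W(2) closed_Image disj] by simp
  have le: "ncomp ?Q ?W' \<le> ncomp P W" by (rule ncomp_Image_le[OF W(1) PQ])
  have QU: "?Q \<subseteq> U" using W r by auto
  show ?thesis
  proof (cases "v \<in> ?W'")
    case True
    then have "?KQ \<subseteq> ?W'" by (intro Image_subset[OF closed_Image]) simp
    then have "ncomp ?Q (eq ?Q `` (W \<union> ?K)) < ncomp P (W \<union> ?K)"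
      using img nP le by (simp add: Un_absorb2)
    then have "push 0 {} ?Q (P, W \<union> ?K) = 0" by (simp add: push_def Let_def)
    moreover have "push 0 {v} ?Q (P, W) = 0" using True by (simp add: push_def Let_def)
    ultimately show ?thesis by (simp add: add_base_def)
  next
    case False
    have fin': "finite ?W'" "finite ?KQ"
      using gens_Image[OF fin V g QU] Image_subset[OF closed_mono[OF V QU], of "{v}"] v fin finite_subset by auto
    have "?W' \<inter> ?KQ = {}" using False closedD[OF closed_Image[of ?Q W]] by blast
    then have "ncomp ?Q (?W' \<union> ?KQ) = Suc (ncomp ?Q ?W')"
      using ncomp_Un[OF fin' closed_Image closed_Image] by simp
    then show ?thesis
      using False nP img by (simp add: add_base_def push_def Let_def frag_extend_simps)
  qed
qed

text \<open>Three cases. If no label is lost and none reaches \<open>v\<close>,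
  \<open>forget\<close> commutes with merging. If a label reaches \<open>v\<close>, the based terms
  survive only after forgetting that label, and this supplies the unbased term labelled at
  \<open>v\<close>. If two labels merge, forgetting either one gives the same result, which is the
  factor two.\<close>

lemma push_forget:
  assumes g: "(P, W) \<in> gens V {} U {v}" and r: "r \<in> U - P"
  defines "Q \<equiv> insert r P"
  shows "push 0 {} Q (P, W) = push 0 {v} Q (P, W) + frag_extend (add_base v)
    (frag_extend (push 0 {v} Q) (forget (P, W)) - frag_extend forget (push 0 {v} Q (P, W))
      - frag_cmul 2 (push 1 {v} Q (P, W) - push 0 {v} Q (P, W)))"
proof -
  have W: "finite W" "closed P W" "v \<notin> W" "W \<subseteq> V" "P \<subseteq> U"
    using g fin finite_subset by (auto simp: gens_def)
  have PQ: "P \<subseteq> Q" by (auto simp: Q_def)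
  have QU: "Q \<subseteq> U" using W r by (auto simp: Q_def)
  let ?W' = "eq Q `` W"
  have finW': "finite ?W'" using gens_Image[OF fin V g QU] fin finite_subset by blast
  have finq: "finite (W // eq P)" by (rule finite_quotient_eq[OF W(1)])
  have sum_forget: "frag_extend (push 0 {v} Q) (forget (P, W)) = (\<Sum>K\<in>W // eq P. push 0 {v} Q (P, W - K))"
    using finq by (simp add: forget_def frag_extend_sum)
  show ?thesis
  proof (cases "ncomp Q ?W' = ncomp P W")
    case same: True
    note inj = Image_remove_class[OF W(1,2) PQ same]
    have drop: "ncomp P (W - K) = ncomp Q (eq Q `` (W - K))" if K: "K \<in> W // eq P" for K
    proof -
      have "eq Q `` K \<in> ?W' // eq Q" unfolding quotient_Image[OF PQ] using K by blast
      from class_facts(3)[OF finW' closed_Image this] class_facts(3)[OF W(1,2) K]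
      show ?thesis using same inj(2)[OF K] by simp
    qed
    have push_K: "push 0 {v} Q (P, W - K) = (if v \<in> ?W' - eq Q `` K then 0 else frag_of (Q, ?W' - eq Q `` K))"
      if K: "K \<in> W // eq P" for K
      using drop[OF K] inj(2)[OF K] by (simp add: push_def Let_def)
    show ?thesis
    proof (cases "v \<in> ?W'")
      case False
      have "frag_extend forget (push 0 {v} Q (P, W)) = forget (Q, ?W')"
        using False same by (simp add: push_def Let_def)
      also have "\<dots> = (\<Sum>K\<in>W // eq P. frag_of (Q, ?W' - eq Q `` K))"
        unfolding forget_def prod.case quotient_Image[OF PQ] by (subst sum.reindex[OF inj(1)]) simp
      also have "\<dots> = frag_extend (push 0 {v} Q) (forget (P, W))"
        unfolding sum_forget by (rule sum.cong) (simp_all add: push_K False)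
      finally have 1: "frag_extend forget (push 0 {v} Q (P, W)) = frag_extend (push 0 {v} Q) (forget (P, W))" .
      show ?thesis unfolding 1 using False same by (simp add: push_def Let_def)
    next
      case True
      then obtain x where x: "x \<in> W" "(x, v) \<in> eq Q" by blast
      let ?K = "eq P `` {x}"
      have K: "?K \<in> W // eq P" using x(1) by (rule quotientI)
      have KQ: "eq Q `` ?K = eq Q `` {v}" unfolding Image_Image[OF PQ] by (rule eq_classI[OF x(2)])
      have uniq: "v \<in> eq Q `` K' \<longleftrightarrow> K' = ?K" if K': "K' \<in> W // eq P" for K'
      proof
        assume "v \<in> eq Q `` K'"
        then obtain k where k: "k \<in> K'" "(k, v) \<in> eq Q" by blast
        have "eq Q `` K' = eq Q `` {v}" unfolding Image_class[OF PQ K' k(1)] by (rule eq_classI[OF k(2)])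
        then show "K' = ?K" using inj_onD[OF inj(1)] K K' KQ by simp
      next
        assume "K' = ?K"
        then show "v \<in> eq Q `` K'" using KQ by simp
      qed
      have "frag_extend (push 0 {v} Q) (forget (P, W)) =
          (\<Sum>K\<in>W // eq P. if K = ?K then frag_of (Q, ?W' - eq Q `` {v}) else 0)"
        unfolding sum_forget
      proof (rule sum.cong)
        fix K' assume K': "K' \<in> W // eq P"
        show "push 0 {v} Q (P, W - K') = (if K' = ?K then frag_of (Q, ?W' - eq Q `` {v}) else 0)"
          using push_K[OF K'] uniq[OF K'] True KQ by auto
      qed simp
      also have "\<dots> = frag_of (Q, ?W' - eq Q `` {v})" using finq K by simp
      finally have 1: "frag_extend (push 0 {v} Q) (forget (P, W)) = frag_of (Q, ?W' - eq Q `` {v})" .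
      have "eq Q `` {v} \<subseteq> ?W'" using True by (intro Image_subset[OF closed_Image]) simp
      then have 2: "?W' - eq Q `` {v} \<union> eq Q `` {v} = ?W'" by blast
      have 3: "push 0 {v} Q (P, W) = 0" "push 1 {v} Q (P, W) = 0" using True by (simp_all add: push_def Let_def)
      show ?thesis unfolding 1 3 using same 2 by (simp add: push_def Let_def add_base_def)
    qed
  next
    case False
    then have ab: "a r \<in> W" "b r \<in> W" "(a r, b r) \<notin> eq P"
      using ncomp_insert_same[OF W(1,2), of r] unfolding Q_def by blast+
    have n: "ncomp P W = Suc (ncomp Q ?W')"
      using ncomp_insert_ge[OF W(1,2), of r] ncomp_insert_less[OF W(1,2) ab] unfolding Q_def by linarith
    have "closed Q W" using ab W(2) by (simp add: Q_def closed_insert)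
    then have W': "?W' = W" by (rule Image_closed)
    let ?Ka = "eq P `` {a r}" and ?Kb = "eq P `` {b r}"
    have K: "?Ka \<in> W // eq P" "?Kb \<in> W // eq P" "?Ka \<noteq> ?Kb"
      using ab eq_class_iff by (auto intro: quotientI)
    have img: "eq Q `` (W - K') = W" if K': "K' = ?Ka \<or> K' = ?Kb" for K'
    proof (rule equalityI)
      show "eq Q `` (W - K') \<subseteq> W" by (rule Image_subset[OF \<open>closed Q W\<close>]) auto
      have aQb: "(a r, b r) \<in> eq Q" by (simp add: eq_edge Q_def)
      obtain p where p: "p \<in> W - K'" "K' \<subseteq> eq Q `` {p}"
      proof (cases "K' = ?Ka")
        case True
        have "b r \<in> W - K'" using ab True by auto
        moreover have "K' \<subseteq> eq Q `` {b r}"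
          using True eq_trans[OF eq_sym[OF aQb] eq_mono[OF PQ]] by auto
        ultimately show ?thesis using that by blast
      next
        case False
        then have Kb: "K' = ?Kb" using K' by blast
        have "a r \<in> W - K'" using ab Kb eq_sym[of "b r" "a r"] by auto
        moreover have "K' \<subseteq> eq Q `` {a r}"
          using Kb eq_trans[OF aQb eq_mono[OF PQ]] by auto
        ultimately show ?thesis using that by blast
      qed
      show "W \<subseteq> eq Q `` (W - K')"
        using p Image_superset[of "W - K'" Q] by blast
    qed
    have push1: "push 0 {v} Q (P, W - K') = frag_of (Q, W)" if K': "K' = ?Ka \<or> K' = ?Kb" for K'
    proof -
      have "K' \<in> W // eq P" using K' K by blast
      then show ?thesis
        using class_facts(3)[OF W(1,2)] n img[OF K'] W' W(3) by (simp add: push_def Let_def)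
    qed
    have push0: "push 0 {v} Q (P, W - K') = 0" if K': "K' \<in> W // eq P" "K' \<noteq> ?Ka" "K' \<noteq> ?Kb" for K'
    proof -
      have "a r \<notin> K'" "b r \<notin> K'"
      proof -
        obtain x where "K' = eq P `` {x}" using K'(1) by (auto simp: quotient_def)
        then show "a r \<notin> K'" "b r \<notin> K'" using K'(2,3) eq_classI[of x _ P] by auto
      qed
      then have "ncomp Q (eq Q `` (W - K')) < ncomp P (W - K')"
        unfolding Q_def using ncomp_insert_less[of "W - K'" P r] class_facts(2)[OF W(1,2) K'(1)] W(1) ab by simp
      then show ?thesis by (simp add: push_def Let_def)
    qed
    have "frag_extend (push 0 {v} Q) (forget (P, W)) =
        (\<Sum>K\<in>W // eq P. if K \<in> {?Ka, ?Kb} then frag_of (Q, W) else 0)"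
      unfolding sum_forget by (rule sum.cong) (use push0 push1 in auto)
    also have "\<dots> = (\<Sum>K\<in>{?Ka, ?Kb}. frag_of (Q, W))"
      using finq K by (intro sum.mono_neutral_cong_right) auto
    also have "\<dots> = frag_cmul 2 (frag_of (Q, W))" using K(3) by (simp add: frag_cmul_2)
    finally have 1: "frag_extend (push 0 {v} Q) (forget (P, W)) = frag_cmul 2 (frag_of (Q, W))" .
    have "push 0 {} Q (P, W) = 0" "push 0 {v} Q (P, W) = 0" using n by (simp_all add: push_def Let_def)
    moreover have "push 1 {v} Q (P, W) = frag_of (Q, W)" using W' W(3) by (simp add: push_def Let_def)
    ultimately show ?thesis by (simp add: 1)
  qed
qed

lemma diff_add_base:
  assumes z: "z \<in> frags (gens V {} U {v})"
  shows "frag_extend (diff 0 U {}) (frag_extend (add_base v) z) = frag_extend (add_base v) (frag_extend (diff 0 U {v}) z)"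
  unfolding extend_compose using z
proof (rule extend_cong)
  fix g assume g: "g \<in> gens V {} U {v}"
  obtain P W where [simp]: "g = (P, W)" by (cases g)
  have "add_base v g \<in> frags (range (Pair P))" by (simp add: add_base_def)
  then have "frag_extend (diff 0 U {}) (add_base v g) =
    (\<Sum>r\<in>U - P. frag_cmul (esign P r) (frag_extend (push 0 {} (insert r P)) (add_base v g)))"
    by (rule extend_diff_fixed[OF fin(2)])
  also have "\<dots> = (\<Sum>r\<in>U - P. frag_cmul (esign P r) (frag_extend (add_base v) (push 0 {v} (insert r P) g)))"
    using push_add_base g by (intro sum.cong) auto
  also have "\<dots> = frag_extend (add_base v) (diff 0 U {v} g)"
    using fin by (simp add: diff_def frag_extend_sum frag_extend_cmul)
  finally show "frag_extend (diff 0 U {}) (add_base v g) = frag_extend (add_base v) (diff 0 U {v} g)" .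
qed

text \<open>Relative to the label at \<open>v\<close> the unbased differential is triangular. Its
  off-diagonal entry is -2 \<open>dmerge\<close> up to a commutator with \<open>forget\<close>,
  which serves as the homotopy.\<close>

lemma diff_forget:
  assumes z: "z \<in> frags (gens V {} U {v})"
  shows "frag_extend (diff 0 U {}) z = frag_extend (diff 0 U {v}) z + frag_extend (add_base v)
    (frag_extend (diff 0 U {v}) (frag_extend forget z) - frag_extend forget (frag_extend (diff 0 U {v}) z)
      - frag_cmul 2 (frag_extend (dmerge U {v}) z))"
  unfolding extend_compose extend_cmul_fun[symmetric] extend_diff_fun[symmetric] extend_add_fun[symmetric] using z
proof (rule extend_cong)
  fix g assume g: "g \<in> gens V {} U {v}"
  obtain P W where [simp]: "g = (P, W)" by (cases g)
  let ?p = "\<lambda>t r. push t {v} (insert r P) g"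
  have "forget g \<in> frags (range (Pair P))" by (auto simp: forget_def intro!: frags_sum)
  then have 1: "frag_extend (diff 0 U {v}) (forget g) =
    (\<Sum>r\<in>U - P. frag_cmul (esign P r) (frag_extend (push 0 {v} (insert r P)) (forget g)))"
    by (rule extend_diff_fixed[OF fin(2)])
  have 2: "frag_extend forget (diff 0 U {v} g) = (\<Sum>r\<in>U - P. frag_cmul (esign P r) (frag_extend forget (?p 0 r)))"
    using fin by (simp add: diff_def frag_extend_sum frag_extend_cmul)
  have 3: "frag_cmul 2 (dmerge U {v} g) = (\<Sum>r\<in>U - P. frag_cmul (esign P r) (frag_cmul 2 (?p 1 r - ?p 0 r)))"
    by (simp add: dmerge_def diff_def frag_cmul_sum frag_cmul_diff2 sum_subtractf mult.commute)
  have 4: "frag_extend (diff 0 U {v}) (forget g) - frag_extend forget (diff 0 U {v} g) - frag_cmul 2 (dmerge U {v} g)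
    = (\<Sum>r\<in>U - P. frag_cmul (esign P r) (frag_extend (push 0 {v} (insert r P)) (forget g) - frag_extend forget (?p 0 r)
        - frag_cmul 2 (?p 1 r - ?p 0 r)))"
    unfolding 1 2 3 by (simp only: frag_cmul_diff2 sum_subtractf)
  have "diff 0 U {} g = (\<Sum>r\<in>U - P. frag_cmul (esign P r) (push 0 {} (insert r P) g))"
    by (simp add: diff_def)
  also have "\<dots> = (\<Sum>r\<in>U - P. frag_cmul (esign P r) (?p 0 r) + frag_cmul (esign P r) (frag_extend (add_base v)
     (frag_extend (push 0 {v} (insert r P)) (forget g) - frag_extend forget (?p 0 r) - frag_cmul 2 (?p 1 r - ?p 0 r))))"
  proof (rule sum.cong)
    fix r assume "r \<in> U - P"
    from push_forget[OF g[unfolded \<open>g = (P, W)\<close>] this]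
    show "frag_cmul (esign P r) (push 0 {} (insert r P) g) = frag_cmul (esign P r) (?p 0 r) + frag_cmul (esign P r) (frag_extend (add_base v)
     (frag_extend (push 0 {v} (insert r P)) (forget g) - frag_extend forget (?p 0 r) - frag_cmul 2 (?p 1 r - ?p 0 r)))"
      by (simp add: frag_cmul_distrib2)
  qed simp
  also have "\<dots> = diff 0 U {v} g + frag_extend (add_base v) (frag_extend (diff 0 U {v}) (forget g)
     - frag_extend forget (diff 0 U {v} g) - frag_cmul 2 (dmerge U {v} g))"
    unfolding 4 sum.distrib using fin by (subst frag_extend_sum) (simp_all add: diff_def frag_extend_cmul comp_def)
  finally show "diff 0 U {} g = diff 0 U {v} g + frag_extend (add_base v) (frag_extend (diff 0 U {v}) (forget g)
     - frag_extend forget (diff 0 U {v} g) - frag_cmul 2 (dmerge U {v} g))" .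
qed

lemma gens_base_split:
  assumes "z \<in> frags (gens V {} U {})"
  obtains z0 z1 where "z0 \<in> frags (gens V {} U {v})" "z1 \<in> frags (gens V {} U {v})" "z = z0 + frag_extend (add_base v) z1"
proof -
  let ?G = "gens V {} U {v}" and ?H = "{(P, W) \<in> gens V {} U {}. v \<in> W}"
  have "gens V {} U {} = ?G \<union> ?H" by (auto simp: gens_def)
  then have "z \<in> frags (?G \<union> ?H)" using assms by simp
  then obtain z0 z' where z: "z0 \<in> frags ?G" "z' \<in> frags ?H" "z = z0 + z'" by (rule frags_split)
  define s where "s = (\<lambda>(P, W). frag_of (P, W - eq P `` {v}))"
  have sub: "eq P `` {v} \<subseteq> W" if "(P, W) \<in> ?H" for P W
    using that by (intro Image_subset) (auto simp: gens_def)
  have "frag_extend s z' \<in> frags ?G"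
    using z(2) by (rule frags_extend) (auto simp: s_def gens_def closed_Diff closed_Image)
  moreover have "frag_extend (add_base v) (frag_extend s z') = z'"
    unfolding extend_compose using z(2)
  proof (rule extend_id)
    fix g assume "g \<in> ?H"
    moreover obtain P W where "g = (P, W)" by (cases g)
    ultimately show "frag_extend (add_base v) (s g) = frag_of g"
      using sub[of P W] by (simp add: s_def add_base_def Un_absorb2)
  qed
  ultimately show ?thesis using that[OF z(1), of "frag_extend s z'"] z(3) by simp
qed

lemma add_base_in: "z \<in> frags (gens V {} U {v}) \<Longrightarrow> frag_extend (add_base v) z \<in> frags {(P, W) \<in> gens V {} U {}. v \<in> W}"
proof (erule frags_extend)
  fix g assume g: "g \<in> gens V {} U {v}"
  obtain P W where [simp]: "g = (P, W)" by (cases g)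
  have "eq P `` {v} \<subseteq> V"
    using closed_mono[OF V, of P] g v by (intro Image_subset) (auto simp: gens_def)
  then show "add_base v g \<in> frags {(P, W) \<in> gens V {} U {}. v \<in> W}"
    using g by (auto simp: add_base_def gens_def closed_Un closed_Image)
qed

lemma add_base_inj:
  assumes "z \<in> frags (gens V {} U {v})" "frag_extend (add_base v) z = 0"
  shows "z = 0"
proof -
  let ?s = "\<lambda>(P, W). frag_of (P, W - eq P `` {v})"
  have "frag_extend ?s (frag_extend (add_base v) z) = z"
    unfolding extend_compose using assms(1)
  proof (rule extend_id)
    fix g assume g: "g \<in> gens V {} U {v}"
    obtain P W where [simp]: "g = (P, W)" by (cases g)
    have "W \<inter> eq P `` {v} = {}" using g closedD[of P W] by (auto simp: gens_def)
    then have "W \<union> eq P `` {v} - eq P `` {v} = W" by blast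
    then show "frag_extend ?s (add_base v g) = frag_of g" by (simp add: add_base_def)
  qed
  then show ?thesis using assms(2) by simp
qed

text \<open>The part without label at \<open>v\<close> is torsion in the based homology and hence a
  boundary. What remains is a class with a multiple in the image of -2 \<open>dmerge\<close>. Purity
  puts the class itself into the image of \<open>dmerge\<close>, and doubling returns to the image
  of 2 \<open>dmerge\<close>.\<close>

lemma torsion_connected:
  assumes ends: "\<And>r. r \<in> U \<Longrightarrow> a r \<in> V \<and> b r \<in> V" and conn: "\<And>x. x \<in> V \<Longrightarrow> (x, v) \<in> eq U"
    and n: "0 < (n::int)" and z: "z \<in> frags (gens V {} U {})" and w: "w \<in> frags (gens V {} U {})"
    and eq: "frag_cmul n z = frag_extend (diff 0 U {}) w"
  shows "\<exists>y\<in>frags (gens V {} U {}). frag_cmul 2 z = frag_extend (diff 0 U {}) y"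
proof -
  let ?G = "gens V {} U {v}" and ?C = "gens V {} U {}"
  let ?X = "frag_extend (add_base v)" and ?d = "frag_extend (diff 0 U {v})" and ?D = "frag_extend (diff 0 U {})"
  let ?m = "frag_extend (dmerge U {v})" and ?\<nu> = "frag_extend forget"
  interpret deformation ?G lev "card \<circ> fst" "corank V {} {v}" "diff 0 U {v}" "dmerge U {v}"
    by (rule deformation_gens[OF fin V ends]) (use conn in auto)
  have GC: "x \<in> frags ?C" if "x \<in> frags ?G" for x using that by (rule frags_mono) (auto simp: gens_def)
  have XC: "?X x \<in> frags ?C" if "x \<in> frags ?G" for x using add_base_in[OF that] by (rule frags_mono) auto
  have \<nu>G: "?\<nu> x \<in> frags ?G" if "x \<in> frags ?G" for x
    using that
  proof (rule frags_extend)
    fix g assume g: "g \<in> ?G"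
    obtain P W where [simp]: "g = (P, W)" by (cases g)
    have W: "finite W" "closed P W" using g fin finite_subset by (auto simp: gens_def)
    show "forget g \<in> frags ?G"
      using g class_facts(2)[OF W] by (auto simp: forget_def gens_def intro!: frags_sum)
  qed
  have split0: "x = 0 \<and> y = 0" if "x \<in> frags ?G" "y \<in> frags ?G" "x + ?X y = 0" for x y
  proof -
    have "?G \<inter> {(P, W) \<in> gens V {} U {}. v \<in> W} = {}" by (auto simp: gens_def)
    from frags_disjoint_cancel[OF that(1) frags_0 add_base_in[OF that(2)] frags_0 this]
    have "x = 0" "?X y = 0" using that(3) by simp_all
    then show ?thesis using add_base_inj[OF that(2)] by simp
  qed
  obtain z0 z1 where z01: "z0 \<in> frags ?G" "z1 \<in> frags ?G" "z = z0 + ?X z1" by (rule gens_base_split[OF z])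
  obtain w0 w1 where w01: "w0 \<in> frags ?G" "w1 \<in> frags ?G" "w = w0 + ?X w1" by (rule gens_base_split[OF w])
  have D: "?D (x + ?X y) = ?d x + ?X (?d (?\<nu> x) - ?\<nu> (?d x) - frag_cmul 2 (?m x) + ?d y)"
    if "x \<in> frags ?G" "y \<in> frags ?G" for x y
    using diff_forget[OF that(1)] diff_add_base[OF that(2)] by (simp add: frag_extend_simps)
  have DG: "?d (?\<nu> x) - ?\<nu> (?d x) - frag_cmul 2 (?m x) + ?d y \<in> frags ?G"
    if "x \<in> frags ?G" "y \<in> frags ?G" for x y
    using that by (intro frags_add frags_diff frags_cmul \<nu>G d_in \<Delta>_in)
  let ?y1 = "?d (?\<nu> w0) - ?\<nu> (?d w0) - frag_cmul 2 (?m w0) + ?d w1"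
  have "frag_cmul n z0 + ?X (frag_cmul n z1) = ?d w0 + ?X ?y1"
    using eq unfolding z01(3) w01(3) D[OF w01(1,2)] by (simp only: frag_cmul_distrib2 frag_extend_cmul)
  then have "(frag_cmul n z0 - ?d w0) + ?X (frag_cmul n z1 - ?y1) = 0"
    unfolding frag_extend_diff[of _ "frag_cmul n z1" ?y1] by (simp add: algebra_simps)
  then have e0: "frag_cmul n z0 = ?d w0" and e1: "frag_cmul n z1 = ?y1"
    using split0[of "frag_cmul n z0 - ?d w0" "frag_cmul n z1 - ?y1"] z01 w01 DG[OF w01(1,2)]
    by (auto intro: frags_diff frags_cmul d_in)
  obtain y where y: "y \<in> frags ?G" "z0 = ?d y" using torsion_free[OF n z01(1) w01(1) e0] by blast
  \<comment> \<open>What is left of \<open>z\<close> at the label \<open>v\<close> after subtracting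
    the unbased boundary of \<open>y\<close>.\<close>
  let ?z = "z1 - (?d (?\<nu> y) - ?\<nu> (?d y) - frag_cmul 2 (?m y))"
  \<comment> \<open>\<open>?w\<close> is closed since both \<open>w0\<close> and
    \<open>frag_cmul n y\<close> bound the same multiple of \<open>z0\<close>. The -2 is the
    coefficient of \<open>dmerge\<close> in the unbased differential.\<close>
  let ?w = "w0 - frag_cmul n y" and ?u = "frag_cmul (-2) (w0 - frag_cmul n y)"
  have uG: "?u \<in> frags ?G" "?w \<in> frags ?G" using w01 y by (auto intro: frags_cmul frags_diff)
  have du: "?d ?w = 0" using e0 y(2) by (simp add: frag_extend_simps)
  have zG: "?z \<in> frags ?G" using z01(2) y(1) by (intro frags_diff frags_cmul \<nu>G d_in \<Delta>_in)
  have tG: "?\<nu> ?w + w1 \<in> frags ?G" using uG w01 by (intro frags_add \<nu>G)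
  have "frag_cmul n ?z = ?m ?u + ?d (?\<nu> ?w + w1)"
  proof -
    have "frag_cmul n ?z = ?y1 - (?d (?\<nu> (frag_cmul n y)) - ?\<nu> (?d (frag_cmul n y)) - frag_cmul 2 (?m (frag_cmul n y)))"
      using e1 by (simp add: frag_cmul_diff2 frag_cmul_distrib2 frag_extend_simps mult.commute)
    also have "\<dots> = ?d (?\<nu> ?w) - ?\<nu> (?d ?w) - frag_cmul 2 (?m ?w) + ?d w1"
      by (simp add: frag_extend_simps frag_cmul_diff2)
    also have "frag_cmul 2 (?m ?w) = - ?m ?u" by (simp add: frag_extend_simps)
    finally show ?thesis using du by (simp add: frag_extend_simps)
  qed
  from deformation_torsion_free[OF n zG uG(1) _ tG this]
  obtain q t where qt: "q \<in> frags ?G" "t \<in> frags ?G" "?d q = 0" "?z = ?m q + ?d t"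
    using du by (auto simp: frag_extend_simps)
  \<comment> \<open>The boundary of \<open>- q\<close> is twice \<open>dmerge\<close> of
    \<open>q\<close> together with the commutator term of \<open>forget\<close>; the first summand
    of \<open>?s\<close> cancels the latter, the second supplies twice the boundary of
    \<open>t\<close>.\<close>
  let ?s = "?\<nu> q + frag_cmul 2 t"
  have sG: "?s \<in> frags ?G" using qt by (intro frags_add frags_cmul \<nu>G)
  have "?D (- q + ?X ?s) = ?X (frag_cmul 2 ?z)"
    unfolding D[OF frags_minus[OF qt(1)] sG] qt(4) using qt(3) by (simp add: frag_extend_simps frag_cmul_distrib2 frag_cmul_minus2)
  moreover have "?D y = z0 + ?X (z1 - ?z)"
    using D[OF y(1) frags_0] y(2) by (simp add: frag_extend_simps)
  ultimately have "?D (frag_cmul 2 y + (- q + ?X ?s)) = frag_cmul 2 (z0 + ?X (z1 - ?z)) + ?X (frag_cmul 2 ?z)"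
    by (simp only: frag_extend_add frag_extend_cmul)
  also have "\<dots> = frag_cmul 2 (z0 + (?X (z1 - ?z) + ?X ?z))"
    by (simp only: frag_extend_cmul frag_cmul_distrib2 add.assoc)
  also have "?X (z1 - ?z) + ?X ?z = ?X z1"
    unfolding frag_extend_add[symmetric] by (simp only: diff_add_cancel)
  finally have "frag_cmul 2 z = ?D (frag_cmul 2 y + (- q + ?X ?s))" using z01(3) by simp
  moreover have "frag_cmul 2 y + (- q + ?X ?s) \<in> frags ?C"
    by (intro frags_add frags_cmul frags_minus GC[OF y(1)] GC[OF qt(1)] XC[OF sG])
  ultimately show ?thesis by blast
qed

end

end

section \<open>Splitting complexes of free Abelian groups\<close>

text \<open>Torsion of the cokernel, which for a differential is the torsion of the homology because
  chains are torsion-free.\<close>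

definition torsion_exponent_2 :: "'g set \<Rightarrow> ('g \<Rightarrow> 'g \<Rightarrow>\<^sub>0 int) \<Rightarrow> bool" where
  "torsion_exponent_2 S D \<longleftrightarrow> (\<forall>n z w. 0 < n \<longrightarrow> z \<in> frags S \<longrightarrow> w \<in> frags S \<longrightarrow>
     frag_cmul n z = frag_extend D w \<longrightarrow> (\<exists>y\<in>frags S. frag_cmul 2 z = frag_extend D y))"

definition diff_closed :: "('g \<Rightarrow>\<^sub>0 int) set \<Rightarrow> bool" where
  "diff_closed M \<longleftrightarrow> 0 \<in> M \<and> (\<forall>x\<in>M. \<forall>y\<in>M. x - y \<in> M)"

lemma diff_closed_simps:
  assumes "diff_closed M"
  shows "0 \<in> M" "x \<in> M \<Longrightarrow> y \<in> M \<Longrightarrow> x - y \<in> M" "x \<in> M \<Longrightarrow> - x \<in> M" "x \<in> M \<Longrightarrow> y \<in> M \<Longrightarrow> x + y \<in> M"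
    "x \<in> M \<Longrightarrow> frag_cmul k x \<in> M"
proof -
  show 0: "0 \<in> M" and d: "\<And>x y. x \<in> M \<Longrightarrow> y \<in> M \<Longrightarrow> x - y \<in> M"
    using assms by (auto simp: diff_closed_def)
  show m: "\<And>x. x \<in> M \<Longrightarrow> - x \<in> M" using d[OF 0] by simp
  show "\<And>x y. x \<in> M \<Longrightarrow> y \<in> M \<Longrightarrow> x + y \<in> M" using d[OF _ m] by simp
  show "x \<in> M \<Longrightarrow> frag_cmul k x \<in> M" using frag_closure_minus_cmul[of "\<lambda>x. x \<in> M"] 0 d by blast
qed

lemma diff_closed_frags: "diff_closed (frags S)"
  by (simp add: diff_closed_def frags_diff)

text \<open>Division with remainder by the least positive element.\<close>

lemma int_subgroup_generator:
  fixes H :: "int set"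
  assumes "0 \<in> H" "\<And>x y. x \<in> H \<Longrightarrow> y \<in> H \<Longrightarrow> x - y \<in> H"
  shows "\<exists>a\<in>H. \<forall>h\<in>H. a dvd h"
proof (cases "H = {0}")
  case False
  have neg: "- x \<in> H" if "x \<in> H" for x using assms(2)[OF assms(1) that] by simp
  have add: "x + y \<in> H" if "x \<in> H" "y \<in> H" for x y using assms(2)[OF that(1) neg[OF that(2)]] by simp
  have mult: "int n * x \<in> H" if "x \<in> H" for n x
    by (induction n) (use assms(1) add that in \<open>auto simp: algebra_simps\<close>)
  have multz: "k * x \<in> H" if "x \<in> H" for k x
  proof (cases "0 \<le> k")
    case True
    then show ?thesis using mult[OF that, of "nat k"] by simp
  next
    case F: False
    then show ?thesis using neg[OF mult[OF that, of "nat (- k)"]] by simp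
  qed
  obtain h0 where h0: "h0 \<in> H" "h0 \<noteq> 0" using False assms(1) by blast
  then have "0 < nat \<bar>h0\<bar> \<and> int (nat \<bar>h0\<bar>) \<in> H" using neg by (auto simp: abs_if)
  then have ex: "\<exists>n. 0 < n \<and> int n \<in> H" by blast
  define a where "a = (LEAST n. 0 < n \<and> int n \<in> H)"
  have a: "0 < a" "int a \<in> H" using LeastI_ex[OF ex] by (auto simp: a_def)
  have min: "a \<le> n" if "0 < n" "int n \<in> H" for n unfolding a_def using that by (intro Least_le) auto
  have "int a dvd h" if h: "h \<in> H" for h
  proof -
    have "h mod int a = h - (h div int a) * int a" by (simp add: minus_div_mult_eq_mod)
    then have m: "h mod int a \<in> H" using assms(2) h multz[OF a(2)] by metis
    have "h mod int a = 0"
    proof (rule ccontr)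
      assume "h mod int a \<noteq> 0"
      moreover have "0 \<le> h mod int a" using a by simp
      ultimately have pos: "0 < h mod int a" by linarith
      then have "a \<le> nat (h mod int a)" using m by (intro min) auto
      moreover have "h mod int a < int a" using a by simp
      ultimately show False using pos by linarith
    qed
    then show ?thesis by (simp add: dvd_eq_mod_eq_0)
  qed
  then show ?thesis using a(2) by blast
qed auto

text \<open>The image is a subgroup of a free group of finite rank, hence free, so the map splits
  over it. The section is built one coordinate at a time, from an element \<open>x0\<close> whose
  coordinate divides all that occur.\<close>

lemma section_exists:
  fixes f :: "('g \<Rightarrow>\<^sub>0 int) \<Rightarrow> ('h \<Rightarrow>\<^sub>0 int)"
  assumes "finite T" "diff_closed X" "\<And>x. x \<in> X \<Longrightarrow> f x \<in> frags T"
    and f: "\<And>x y. f (x - y) = f x - f y" "\<And>k x. f (frag_cmul k x) = frag_cmul k (f x)"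
  shows "\<exists>s. (\<forall>x\<in>X. s (f x) \<in> X \<and> f (s (f x)) = f x) \<and> (\<forall>x\<in>X. \<forall>y\<in>X. s (f x - f y) = s (f x) - s (f y))"
  using assms(1-3)
proof (induction T arbitrary: X rule: finite_induct)
  case empty
  then have "\<And>x. x \<in> X \<Longrightarrow> f x = 0" by simp
  moreover have "f 0 = 0" using f(1)[of 0 0] by simp
  ultimately show ?case using diff_closed_simps(1)[OF empty(1)] by (intro exI[of _ "\<lambda>_. 0"]) auto
next
  case (insert t T)
  let ?c = "\<lambda>y. Poly_Mapping.lookup y t"
  note X = diff_closed_simps[OF insert.prems(1)]
  have "\<exists>a\<in>(\<lambda>x. ?c (f x)) ` X. \<forall>h\<in>(\<lambda>x. ?c (f x)) ` X. a dvd h"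
  proof (rule int_subgroup_generator)
    have "f 0 = 0" using f(1)[of 0 0] by simp
    then show "0 \<in> (\<lambda>x. ?c (f x)) ` X" using X(1) by force
    show "u - v \<in> (\<lambda>x. ?c (f x)) ` X" if uv: "u \<in> (\<lambda>x. ?c (f x)) ` X" "v \<in> (\<lambda>x. ?c (f x)) ` X" for u v
    proof -
      obtain x y where "x \<in> X" "y \<in> X" "u = ?c (f x)" "v = ?c (f y)" using uv by blast
      then show ?thesis using X(2) by (intro image_eqI[of _ _ "x - y"]) (auto simp: f lookup_minus)
    qed
  qed
  then obtain x0 where x0: "x0 \<in> X" "\<And>x. x \<in> X \<Longrightarrow> ?c (f x0) dvd ?c (f x)" by blast
  define a where "a = ?c (f x0)"
  define X' where "X' = {x \<in> X. ?c (f x) = 0}"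
  have "f 0 = 0" using f(1)[of 0 0] by simp
  then have X': "diff_closed X'" using X by (auto simp: diff_closed_def X'_def f lookup_minus)
  have "f x \<in> frags T" if "x \<in> X'" for x
  proof -
    have "f x \<in> frags (insert t T)" "t \<notin> Poly_Mapping.keys (f x)"
      using that insert.prems(2) by (auto simp: X'_def in_keys_iff)
    then show ?thesis by (auto simp: frags_def)
  qed
  from insert.IH[OF X' this]
  obtain s where s: "\<And>x. x \<in> X' \<Longrightarrow> s (f x) \<in> X' \<and> f (s (f x)) = f x"
    "\<And>x y. x \<in> X' \<Longrightarrow> y \<in> X' \<Longrightarrow> s (f x - f y) = s (f x) - s (f y)" by blast
  \<comment> \<open>If all coordinates at \<open>t\<close> vanish, then \<open>a = 0\<close>, and
    division by zero gives the correct value \<open>k = 0\<close>.\<close>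
  define k where "k = (\<lambda>y. ?c y div a)"
  define s' where "s' = (\<lambda>y. frag_cmul (k y) x0 + s (y - frag_cmul (k y) (f x0)))"
  let ?r = "\<lambda>x. x - frag_cmul (k (f x)) x0"
  have r: "?r x \<in> X'" "f (?r x) = f x - frag_cmul (k (f x)) (f x0)" if x: "x \<in> X" for x
  proof -
    show eq: "f (?r x) = f x - frag_cmul (k (f x)) (f x0)" by (simp add: f)
    have "?c (f (?r x)) = 0" using x0(2)[OF x] unfolding eq by (simp add: lookup_minus k_def a_def)
    then show "?r x \<in> X'" using x x0(1) X by (simp add: X'_def)
  qed
  show ?case
  proof (intro exI[of _ s'] conjI ballI)
    fix x assume x: "x \<in> X"
    have s'x: "s' (f x) = frag_cmul (k (f x)) x0 + s (f (?r x))"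
      unfolding s'_def r(2)[OF x] ..
    have 1: "s (f (?r x)) \<in> X'" "f (s (f (?r x))) = f (?r x)" using s(1)[OF r(1)[OF x]] by auto
    show "s' (f x) \<in> X" unfolding s'x using 1(1) x0 X by (auto simp: X'_def)
    have fadd: "f (u + v) = f u + f v" for u v
      using f(1)[of "u + v" v] by (simp add: algebra_simps)
    show "f (s' (f x)) = f x" unfolding s'x fadd 1(2) unfolding r(2)[OF x] by (simp add: f)
    fix y assume y: "y \<in> X"
    have kk: "k (f x - f y) = k (f x) - k (f y)"
      using x0(2)[OF x] x0(2)[OF y] by (simp add: k_def a_def lookup_minus div_diff)
    have "f x - f y - frag_cmul (k (f x - f y)) (f x0) = f (?r x) - f (?r y)"
      unfolding kk r(2)[OF x] r(2)[OF y] by (simp add: frag_cmul_diff_distrib)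
    then have "s' (f x - f y) = frag_cmul (k (f x) - k (f y)) x0 + (s (f (?r x)) - s (f (?r y)))"
      using s(2)[OF r(1)[OF x] r(1)[OF y]] by (simp only: s'_def kk)
    moreover have "s' (f y) = frag_cmul (k (f y)) x0 + s (f (?r y))"
      unfolding s'_def r(2)[OF y] ..
    ultimately show "s' (f x - f y) = s' (f x) - s' (f y)"
      unfolding s'x by (simp add: frag_cmul_diff_distrib)
  qed
qed

text \<open>A pure subgroup has a torsion-free, hence free, quotient and is a direct summand. On
  chains: a projection to the part without \<open>t\<close> is extended by one further basis element
  \<open>z0\<close>, which requires an integral functional with value 1 at
  \<open>z0\<close>.\<close>

lemma pure_projection:
  fixes M :: "('g \<Rightarrow>\<^sub>0 int) set"
  assumes "finite S" "diff_closed M" "M \<subseteq> frags S"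
    and "\<And>n z. 0 < n \<Longrightarrow> z \<in> frags S \<Longrightarrow> frag_cmul n z \<in> M \<Longrightarrow> z \<in> M"
  shows "\<exists>R. (\<forall>z. frag_extend R z \<in> M) \<and> (\<forall>z\<in>M. frag_extend R z = z)"
  using assms
proof (induction S arbitrary: M rule: finite_induct)
  case empty
  then have "M = {0}" using diff_closed_simps(1) by fastforce
  then show ?case by (intro exI[of _ "\<lambda>_. 0"]) (auto intro: extend_eq_0[of _ UNIV] simp: frags_def)
next
  case (insert t S)
  let ?c = "\<lambda>y. Poly_Mapping.lookup y t"
  note M = diff_closed_simps[OF insert.prems(1)]
  define M' where "M' = M \<inter> frags S"
  have "diff_closed M'" using M by (auto simp: M'_def diff_closed_def frags_diff)
  moreover have "z \<in> M'" if "0 < n" "z \<in> frags S" "frag_cmul n z \<in> M'" for n z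
    using that insert.prems(3)[of n z] frags_mono[of z S "insert t S"] by (auto simp: M'_def)
  moreover have "M' \<subseteq> frags S" by (simp add: M'_def)
  ultimately obtain R where R: "\<And>z. frag_extend R z \<in> M'" "\<And>z. z \<in> M' \<Longrightarrow> frag_extend R z = z"
    using insert.IH[of M'] by blast
  have "\<exists>a\<in>?c ` M. \<forall>h\<in>?c ` M. a dvd h"
  proof (rule int_subgroup_generator)
    show "0 \<in> ?c ` M" using M(1) by force
    show "u - v \<in> ?c ` M" if uv: "u \<in> ?c ` M" "v \<in> ?c ` M" for u v
    proof -
      obtain x y where "x \<in> M" "y \<in> M" "u = ?c x" "v = ?c y" using uv by blast
      then show ?thesis using M(2) by (intro image_eqI[of _ _ "x - y"]) (auto simp: lookup_minus)
    qed
  qed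
  then obtain z1 where z1: "z1 \<in> M" "\<And>z. z \<in> M \<Longrightarrow> ?c z1 dvd ?c z" by blast
  have inM': "z \<in> M'" if "z \<in> M" "?c z = 0" for z
    using that insert.prems(2) by (auto simp: M'_def frags_def in_keys_iff)
  \<comment> \<open>Normalised so that the projection already found kills it.\<close>
  define z0 where "z0 = z1 - frag_extend R z1"
  have c0: "?c (frag_extend R z) = 0" for z
    using R(1)[of z] insert.hyps(2) by (auto simp: M'_def frags_def in_keys_iff)
  have z0: "z0 \<in> M" "?c z0 = ?c z1" "frag_extend R z0 = 0"
    using z1 R M c0 by (auto simp: z0_def M'_def lookup_minus frag_extend_simps)
  show ?case
  proof (cases "?c z0 = 0")
    case True
    then have "M \<subseteq> M'" using inM' z1(2) z0(2) by auto
    then show ?thesis using R by (auto simp: M'_def)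
  next
    case False
    define \<mu> where "\<mu> = (\<lambda>u z. \<Sum>g\<in>Poly_Mapping.keys z0. u g * Poly_Mapping.lookup z g :: int)"
    have \<mu>_diff: "\<mu> u (x - y) = \<mu> u x - \<mu> u y" for u x y
      by (simp add: \<mu>_def lookup_minus sum_subtractf algebra_simps)
    have \<mu>_cmul: "\<mu> u (frag_cmul k x) = k * \<mu> u x" for u k x
      by (simp add: \<mu>_def sum_distrib_left algebra_simps)
    have "\<exists>e\<in>range (\<lambda>u. \<mu> u z0). \<forall>h\<in>range (\<lambda>u. \<mu> u z0). e dvd h"
    proof (rule int_subgroup_generator)
      show "0 \<in> range (\<lambda>u. \<mu> u z0)" by (rule range_eqI[of _ _ "\<lambda>_. 0"]) (simp add: \<mu>_def)
      show "x - y \<in> range (\<lambda>u. \<mu> u z0)" if xy: "x \<in> range (\<lambda>u. \<mu> u z0)" "y \<in> range (\<lambda>u. \<mu> u z0)" for x y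
      proof -
        obtain p q where "x = \<mu> p z0" "y = \<mu> q z0" using xy by blast
        then show ?thesis
          by (intro range_eqI[of _ _ "\<lambda>g. p g - q g"]) (simp add: \<mu>_def sum_subtractf algebra_simps)
      qed
    qed
    then obtain u where u: "\<And>u'. \<mu> u z0 dvd \<mu> u' z0" by blast
    \<comment> \<open>Up to sign the gcd of the coordinates of \<open>z0\<close>, written as a value
      of a functional by Bezout.\<close>
    define e where "e = \<mu> u z0"
    have e_dvd: "e dvd Poly_Mapping.lookup z0 g" for g
    proof (cases "g \<in> Poly_Mapping.keys z0")
      case True
      have "\<mu> (\<lambda>g'. if g' = g then 1 else 0) z0 = (\<Sum>g'\<in>Poly_Mapping.keys z0. if g' = g then Poly_Mapping.lookup z0 g else 0)"
        unfolding \<mu>_def by (rule sum.cong) auto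
      also have "\<dots> = Poly_Mapping.lookup z0 g" using True by simp
      finally show ?thesis using u unfolding e_def by metis
    qed (simp add: in_keys_iff)
    have e0: "e \<noteq> 0" using e_dvd[of t] False by auto
    \<comment> \<open>\<open>z0\<close> divided by its content, which lies in \<open>M\<close> by
      purity. The coordinate of \<open>z0\<close> at \<open>t\<close> divides that of every element
      of \<open>M\<close>, so the content must be 1.\<close>
    define z' where "z' = frag_extend (\<lambda>g. frag_cmul (Poly_Mapping.lookup z0 g div \<bar>e\<bar>) (frag_of g)) (\<Sum>g\<in>Poly_Mapping.keys z0. frag_of g)"
    have z'_eq: "z' = (\<Sum>g\<in>Poly_Mapping.keys z0. frag_cmul (Poly_Mapping.lookup z0 g div \<bar>e\<bar>) (frag_of g))"
      by (simp add: z'_def frag_extend_sum)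
    have "frag_cmul \<bar>e\<bar> z' = (\<Sum>g\<in>Poly_Mapping.keys z0. frag_cmul (Poly_Mapping.lookup z0 g) (frag_of g))"
      unfolding z'_eq frag_cmul_sum by (rule sum.cong) (use e_dvd in auto)
    also have "\<dots> = z0" using frag_expansion[of z0] by (simp add: frag_extend_def)
    finally have ez': "frag_cmul \<bar>e\<bar> z' = z0" .
    have z0S: "z0 \<in> frags (insert t S)" using z0(1) insert.prems(2) by blast
    have "z' \<in> frags (insert t S)"
      unfolding z'_eq using z0S by (intro frags_sum frags_cmul) (auto simp: frags_def)
    then have "z' \<in> M" using insert.prems(3)[of "\<bar>e\<bar>" z'] e0 ez' z0(1) by simp
    then have "?c z0 dvd ?c z'" using z1(2) z0(2) by simp
    moreover have "?c z0 = \<bar>e\<bar> * ?c z'" unfolding ez'[symmetric] by simp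
    ultimately have "\<bar>e\<bar> dvd 1" using False by (metis dvd_mult_cancel_right mult_1 mult_eq_0_iff)
    then have e1: "e * e = 1" by (metis abs_dvd_iff abs_mult_self_eq zdvd1_eq mult_1)
    \<comment> \<open>The functional takes the value \<open>e * e\<close>, which is 1, at
      \<open>z0\<close>; composed with the complement of the old projection it vanishes on
      \<open>M'\<close>.\<close>
    define R' where "R' = (\<lambda>g. frag_extend R (frag_of g) + frag_cmul (e * \<mu> u (frag_of g - frag_extend R (frag_of g))) z0)"
    have \<mu>_add: "\<mu> u (x + y) = \<mu> u x + \<mu> u y" for u x y
      by (simp add: \<mu>_def lookup_add sum.distrib algebra_simps)
    have R': "frag_extend R' z = frag_extend R z + frag_cmul (e * \<mu> u (z - frag_extend R z)) z0" for z
    proof -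
      have "Poly_Mapping.keys z \<subseteq> UNIV" by simp
      then show ?thesis
      proof (induction z rule: frag_induction)
        case zero
        then show ?case by (simp add: \<mu>_def)
      next
        case (diff x y)
        have "\<mu> u (x - y - frag_extend R (x - y)) = \<mu> u (x - frag_extend R x) - \<mu> u (y - frag_extend R y)"
          by (simp add: \<mu>_diff[symmetric] frag_extend_simps algebra_simps)
        then show ?case
          using diff by (simp add: frag_extend_simps frag_cmul_diff_distrib right_diff_distrib)
      qed (simp add: R'_def)
    qed
    have R'z0: "frag_extend R' z0 = z0" unfolding R' z0(3) using e1 by (simp add: e_def)
    show ?thesis
    proof (intro exI[of _ R'] conjI allI ballI)
      fix z
      show "frag_extend R' z \<in> M"
        unfolding R' using R(1)[of z] z0(1) M by (auto simp: M'_def)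
      assume z: "z \<in> M"
      obtain k where k: "?c z = ?c z0 * k" using z1(2)[OF z] z0(2) by auto
      let ?w = "z - frag_cmul k z0"
      have "?w \<in> M'" by (rule inM') (use M z z0 k in \<open>auto simp: lookup_minus\<close>)
      then have "frag_extend R' ?w = ?w" unfolding R' R(2)[OF \<open>?w \<in> M'\<close>] by (simp add: \<mu>_def)
      then show "frag_extend R' z = z" using R'z0 by (simp add: frag_extend_simps)
    qed
  qed
qed

lemma extend_additive:
  assumes "z \<in> frags S" "f 0 = 0" "\<And>x y. x \<in> frags S \<Longrightarrow> y \<in> frags S \<Longrightarrow> f (x - y) = f x - f y"
  shows "frag_extend (\<lambda>g. f (frag_of g)) z = f z"
proof -
  have "Poly_Mapping.keys z \<subseteq> S" using assms(1) by (simp add: frags_def)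
  then have "z \<in> frags S \<and> frag_extend (\<lambda>g. f (frag_of g)) z = f z"
    by (induction z rule: frag_induction) (simp_all add: assms frags_diff frag_extend_diff)
  then show ?thesis ..
qed

text \<open>The complex is a direct sum of copies of \<open>\<int>\<close>, of \<open>\<int> \<rightarrow> \<int>\<close> by \<open>1\<close> and of \<open>\<int> \<rightarrow> \<int>\<close>
  by \<open>2\<close>; the projection \<open>K\<close> kills the summands \<open>\<int>\<close>.\<close>

lemma exponent_2_splitting:
  assumes S: "finite S" and D: "\<And>g. g \<in> S \<Longrightarrow> D g \<in> frags S" "\<And>z. z \<in> frags S \<Longrightarrow> frag_extend D (frag_extend D z) = 0"
    and exp: "torsion_exponent_2 S D"
  obtains H K where "\<And>g. g \<in> S \<Longrightarrow> H g \<in> frags S" "\<And>g. g \<in> S \<Longrightarrow> K g \<in> frags S"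
    "\<And>z. z \<in> frags S \<Longrightarrow> frag_extend D (frag_extend H z) + frag_extend H (frag_extend D z) = frag_cmul 2 (frag_extend K z)"
    "\<And>z. z \<in> frags S \<Longrightarrow> frag_extend D (frag_extend K z) = frag_extend D z"
    "\<And>z. z \<in> frags S \<Longrightarrow> frag_extend K (frag_extend D z) = frag_extend D z"
    "\<And>z. z \<in> frags S \<Longrightarrow> frag_extend K (frag_extend K z) = frag_extend K z"
proof -
  let ?d = "frag_extend D" and ?F = "frags S"
  have dF: "?d z \<in> ?F" if "z \<in> ?F" for z using that D(1) by (rule frags_extend)
  obtain s where s: "\<And>x. x \<in> ?F \<Longrightarrow> s (?d x) \<in> ?F" "\<And>x. x \<in> ?F \<Longrightarrow> ?d (s (?d x)) = ?d x"
    and s_diff: "\<And>x y. x \<in> ?F \<Longrightarrow> y \<in> ?F \<Longrightarrow> s (?d x - ?d y) = s (?d x) - s (?d y)"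
  proof -
    have "\<exists>s. (\<forall>x\<in>?F. s (?d x) \<in> ?F \<and> ?d (s (?d x)) = ?d x) \<and>
        (\<forall>x\<in>?F. \<forall>y\<in>?F. s (?d x - ?d y) = s (?d x) - s (?d y))"
      by (rule section_exists[OF S diff_closed_frags]) (auto simp: frag_extend_simps dF)
    then obtain s where "\<forall>x\<in>?F. s (?d x) \<in> ?F \<and> ?d (s (?d x)) = ?d x"
        "\<forall>x\<in>?F. \<forall>y\<in>?F. s (?d x - ?d y) = s (?d x) - s (?d y)" by blast
    then show ?thesis by (intro that[of s]) blast+
  qed
  have s0: "s 0 = 0" using s_diff[of 0 0] by simp
  \<comment> \<open>The saturation of the boundaries: pure by construction, and its quotient by the
    boundaries is the torsion.\<close>
  define M where "M = {z \<in> ?F. \<exists>n>0. frag_cmul n z \<in> ?d ` ?F}"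
  have "diff_closed M"
    unfolding diff_closed_def
  proof (intro conjI ballI)
    show "0 \<in> M" by (auto simp: M_def intro!: exI[of _ 1] image_eqI[of _ _ 0])
    fix x y assume "x \<in> M" "y \<in> M"
    then obtain n m u v where "x \<in> ?F" "y \<in> ?F" and nm: "0 < n" "0 < m" "u \<in> ?F" "v \<in> ?F"
      "frag_cmul n x = ?d u" "frag_cmul m y = ?d v" by (auto simp: M_def)
    have "frag_cmul (n * m) (x - y) = frag_cmul m (frag_cmul n x) - frag_cmul n (frag_cmul m y)"
      by (simp add: frag_cmul_diff2 mult.commute)
    then have "frag_cmul (n * m) (x - y) = ?d (frag_cmul m u - frag_cmul n v)"
      unfolding nm by (simp only: frag_extend_diff frag_extend_cmul)
    then show "x - y \<in> M"
      unfolding M_def using nm \<open>x \<in> ?F\<close> \<open>y \<in> ?F\<close>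
      by (auto intro!: exI[of _ "n * m"] frags_diff image_eqI[of _ _ "frag_cmul m u - frag_cmul n v"] frags_cmul)
  qed
  moreover have "M \<subseteq> ?F" by (auto simp: M_def)
  moreover have "z \<in> M" if nz: "0 < n" "z \<in> ?F" "frag_cmul n z \<in> M" for n z
  proof -
    obtain m where "0 < m" "frag_cmul m (frag_cmul n z) \<in> ?d ` ?F" using nz(3) by (auto simp: M_def)
    then show ?thesis using nz unfolding M_def by (auto intro!: exI[of _ "m * n"])
  qed
  ultimately obtain R where R: "\<And>z. frag_extend R z \<in> M" "\<And>z. z \<in> M \<Longrightarrow> frag_extend R z = z"
    using pure_projection[OF S] by blast
  have dM: "?d z = 0" if z: "z \<in> M" for z
  proof -
    obtain n u where "0 < n" "u \<in> ?F" "frag_cmul n z = ?d u" using z by (auto simp: M_def)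
    then have "frag_cmul n (?d z) = 0" using D(2) by (metis frag_extend_cmul)
    then show ?thesis using \<open>0 < n\<close> by simp
  qed
  have d_in_M: "?d z \<in> M" if "z \<in> ?F" for z
    using that dF by (auto simp: M_def intro!: exI[of _ 1])
  have MF: "z \<in> M \<Longrightarrow> z \<in> ?F" for z by (auto simp: M_def)
  have twice: "\<exists>y\<in>?F. frag_cmul 2 z = ?d y" if "z \<in> M" for z
    using that exp unfolding torsion_exponent_2_def M_def by blast
  \<comment> \<open>\<open>q\<close> projects to a complement of the cycles and \<rho> to
    \<open>M\<close> along it. Twice an element of \<open>M\<close> is a boundary by the hypothesis
    on torsion, and \<open>h\<close> chooses a primitive additively.\<close>
  define q where "q = (\<lambda>z. s (?d z))"
  define \<rho> where "\<rho> = (\<lambda>z. frag_extend R (z - q z))"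
  define h where "h = (\<lambda>z. s (frag_cmul 2 (\<rho> z)))"
  have q: "q z \<in> ?F" "?d (q z) = ?d z" if "z \<in> ?F" for z using s that by (simp_all add: q_def)
  have q_diff: "q (x - y) = q x - q y" if "x \<in> ?F" "y \<in> ?F" for x y
    using s_diff that by (simp add: q_def frag_extend_simps)
  have q0: "q z = 0" if "?d z = 0" for z using that s0 by (simp add: q_def)
  have \<rho>M: "\<rho> z \<in> M" for z by (simp add: \<rho>_def R)
  have \<rho>_diff: "\<rho> (x - y) = \<rho> x - \<rho> y" if "x \<in> ?F" "y \<in> ?F" for x y
    unfolding \<rho>_def q_diff[OF that] frag_extend_diff[symmetric] by (simp add: algebra_simps)
  have h: "h z \<in> ?F" "?d (h z) = frag_cmul 2 (\<rho> z)" for z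
    using twice[OF \<rho>M[of z]] s unfolding h_def by auto
  have h_diff: "h (x - y) = h x - h y" if xy: "x \<in> ?F" "y \<in> ?F" for x y
  proof -
    obtain u v where uv: "u \<in> ?F" "frag_cmul 2 (\<rho> x) = ?d u" "v \<in> ?F" "frag_cmul 2 (\<rho> y) = ?d v"
      using twice[OF \<rho>M] by metis
    show ?thesis unfolding h_def \<rho>_diff[OF xy] frag_cmul_diff2 uv(2,4) by (rule s_diff[OF uv(1,3)])
  qed
  define H where "H = (\<lambda>g. h (frag_of g))"
  define K where "K = (\<lambda>g. \<rho> (frag_of g) + q (frag_of g))"
  have H: "frag_extend H z = h z" if "z \<in> ?F" for z
    unfolding H_def using that h_diff h_diff[of 0 0] by (intro extend_additive) auto
  have K: "frag_extend K z = \<rho> z + q z" if "z \<in> ?F" for z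
    unfolding K_def using that \<rho>_diff \<rho>_diff[of 0 0] q_diff q_diff[of 0 0]
    by (intro extend_additive[of z S "\<lambda>z. \<rho> z + q z"]) auto
  show ?thesis
  proof (rule that[of H K])
    fix g assume "g \<in> S"
    then show "H g \<in> ?F" "K g \<in> ?F"
      using h q MF[OF \<rho>M] by (auto simp: H_def K_def intro!: frags_add)
  next
    fix z assume z: "z \<in> ?F"
    have \<rho>d: "\<rho> (?d z) = ?d z" using q0[OF D(2)[OF z]] R(2)[OF d_in_M[OF z]] by (simp add: \<rho>_def)
    have hd: "h (?d z) = frag_cmul 2 (q z)"
    proof -
      \<comment> \<open>The section \<open>s\<close> is known to respect differences of boundaries,
        so the double of a boundary is written as a difference.\<close>
      have "h (?d z) = s (?d z - ?d (- z))" by (simp add: h_def \<rho>d frag_cmul_2 frag_extend_simps)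
      also have "\<dots> = s (?d z) - s (?d (0 - z))" using s_diff[OF z frags_minus[OF z]] by simp
      also have "s (?d (0 - z)) = s (?d 0) - s (?d z)"
        using s_diff[OF frags_0 z] by (simp add: frag_extend_simps)
      finally show ?thesis by (simp add: frag_cmul_2 q_def s0)
    qed
    show "?d (frag_extend H z) + frag_extend H (?d z) = frag_cmul 2 (frag_extend K z)"
      unfolding H[OF z] H[OF dF[OF z]] K[OF z] h(2) hd by (simp add: frag_cmul_distrib2)
    show "?d (frag_extend K z) = ?d z"
      unfolding K[OF z] using dM[OF \<rho>M] q(2)[OF z] by (simp add: frag_extend_simps)
    show "frag_extend K (?d z) = ?d z"
      unfolding K[OF dF[OF z]] \<rho>d using q0[OF D(2)[OF z]] by simp
    have 1: "q (\<rho> z) = 0" "\<rho> (\<rho> z) = \<rho> z"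
      using q0[OF dM[OF \<rho>M]] R(2)[OF \<rho>M] by (simp_all add: \<rho>_def)
    have 2: "q (q z) = q z" "\<rho> (q z) = 0"
      using q(2)[OF z] by (simp_all add: q_def \<rho>_def)
    have add: "K' (x + y) = K' x + K' y" if "x \<in> ?F" "y \<in> ?F" "K' = \<rho> \<or> K' = q" for K' x y
    proof -
      have "K' (x + y) = K' ((x + y) - y) + K' y"
        using that \<rho>_diff[OF frags_add[OF that(1,2)] that(2)] q_diff[OF frags_add[OF that(1,2)] that(2)] by auto
      then show ?thesis by simp
    qed
    have "\<rho> (\<rho> z + q z) = \<rho> (\<rho> z) + \<rho> (q z)" "q (\<rho> z + q z) = q (\<rho> z) + q (q z)"
      by (rule add[OF MF[OF \<rho>M] q(1)[OF z]], simp)+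
    then have "\<rho> (\<rho> z + q z) + q (\<rho> z + q z) = \<rho> z + q z" using 1 2 by simp
    then show "frag_extend K (frag_extend K z) = frag_extend K z"
      unfolding K[OF z] using K[OF frags_add[OF MF[OF \<rho>M] q(1)[OF z]]] by simp
  qed
qed

section \<open>Tensor products\<close>

definition act1 :: "('g \<Rightarrow> 'g \<Rightarrow>\<^sub>0 int) \<Rightarrow> 'g \<times> 'h \<Rightarrow> ('g \<times> 'h) \<Rightarrow>\<^sub>0 int" where
  "act1 F = (\<lambda>(g1, g2). frag_extend (\<lambda>g1'. frag_of (g1', g2)) (F g1))"

definition act2 :: "('h \<Rightarrow> 'h \<Rightarrow>\<^sub>0 int) \<Rightarrow> 'g \<times> 'h \<Rightarrow> ('g \<times> 'h) \<Rightarrow>\<^sub>0 int" where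
  "act2 F = (\<lambda>(g1, g2). frag_extend (\<lambda>g2'. frag_of (g1, g2')) (F g2))"

text \<open>The Koszul sign, with \<tau> the sign of the parity in the first factor.\<close>

definition twist :: "('g \<Rightarrow> int) \<Rightarrow> ('g \<times> 'h \<Rightarrow> ('g \<times> 'h) \<Rightarrow>\<^sub>0 int) \<Rightarrow> 'g \<times> 'h \<Rightarrow> ('g \<times> 'h) \<Rightarrow>\<^sub>0 int" where
  "twist \<tau> F = (\<lambda>(g1, g2). frag_cmul (\<tau> g1) (F (g1, g2)))"

definition tensor_diff where
  "tensor_diff \<tau> D1 D2 = (\<lambda>g. act1 D1 g + twist \<tau> (act2 D2) g)"

lemma act1_act1: "frag_extend (act1 F) (act1 G (g1, g2)) = act1 (\<lambda>g. frag_extend F (G g)) (g1, g2)"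
  by (simp add: act1_def extend_compose)

lemma act2_act2: "frag_extend (act2 F) (act2 G (g1, g2)) = act2 (\<lambda>g. frag_extend F (G g)) (g1, g2)"
  by (simp add: act2_def extend_compose)

lemma act1_act2: "frag_extend (act1 F) (act2 G (g1, g2)) = frag_extend (act2 G) (act1 F (g1, g2))"
proof -
  have "frag_extend (\<lambda>x. frag_extend (\<lambda>y. frag_of (x, y)) b) a = frag_extend (\<lambda>y. frag_extend (\<lambda>x. frag_of (x, y)) a) b"
    for a :: "'a \<Rightarrow>\<^sub>0 int" and b :: "'b \<Rightarrow>\<^sub>0 int"
    by (simp add: frag_extend_def frag_cmul_sum sum.swap[of _ "Poly_Mapping.keys a"] mult.commute)
  then show ?thesis by (simp add: act1_def act2_def extend_compose)
qed

lemma act1_in: "F g1 \<in> frags S1 \<Longrightarrow> g2 \<in> S2 \<Longrightarrow> act1 F (g1, g2) \<in> frags (S1 \<times> S2)"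
  by (auto simp: act1_def elim!: frags_extend)

lemma act2_in: "F g2 \<in> frags S2 \<Longrightarrow> g1 \<in> S1 \<Longrightarrow> act2 F (g1, g2) \<in> frags (S1 \<times> S2)"
  by (auto simp: act2_def elim!: frags_extend)

text \<open>With the differential acting on the first factor only, the tensor product is a direct
  sum of copies of it, indexed by \<open>S2\<close>; \<open>sl\<close> and \<open>em\<close> below
  restrict to a copy and include it.\<close>

lemma torsion_act1:
  fixes S1 :: "'a set" and S2 :: "'b set"
  assumes S2: "finite S2" and exp: "torsion_exponent_2 S1 D1" and D1: "\<And>g. g \<in> S1 \<Longrightarrow> D1 g \<in> frags S1"
  shows "torsion_exponent_2 (S1 \<times> S2) (act1 D1)"
  unfolding torsion_exponent_2_def
proof (intro allI impI)
  fix n z w assume n: "0 < (n::int)" and z: "z \<in> frags (S1 \<times> S2)" and w: "w \<in> frags (S1 \<times> S2)"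
    and eq: "frag_cmul n z = frag_extend (act1 D1) w"
  define sl where "sl = (\<lambda>(y :: 'b) (g1, g2). if g2 = y then frag_of g1 else (0 :: 'a \<Rightarrow>\<^sub>0 int))"
  define em where "em = (\<lambda>y g1. frag_of (g1, y) :: ('a \<times> 'b) \<Rightarrow>\<^sub>0 int)"
  have sl_in: "frag_extend (sl y) x \<in> frags S1" if "x \<in> frags (S1 \<times> S2)" for x y
    using that by (rule frags_extend) (auto simp: sl_def)
  have sl_act1: "frag_extend (sl y) (frag_extend (act1 D1) w) = frag_extend D1 (frag_extend (sl y) w)" for y
    unfolding extend_compose
  proof (rule frag_extend_eq)
    fix g :: "'a \<times> 'b"
    obtain g1 g2 where [simp]: "g = (g1, g2)" by (cases g)
    show "frag_extend (sl y) (act1 D1 g) = frag_extend D1 (sl y g)"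
    proof (cases "g2 = y")
      case True
      then have "frag_extend (sl y) (act1 D1 g) = frag_extend frag_of (D1 g1)"
        by (simp add: act1_def extend_compose sl_def)
      then show ?thesis using True by (simp add: sl_def frag_expansion[symmetric])
    next
      case False
      then have "frag_extend (sl y) (act1 D1 g) = frag_extend (\<lambda>_. 0) (D1 g1)"
        by (simp add: act1_def extend_compose sl_def)
      also have "\<dots> = 0" by (rule frag_extend_eq_0) simp
      finally show ?thesis using False by (simp add: sl_def)
    qed
  qed
  have "\<forall>y\<in>S2. \<exists>u. u \<in> frags S1 \<and> frag_cmul 2 (frag_extend (sl y) z) = frag_extend D1 u"
  proof
    fix y
    have "frag_cmul n (frag_extend (sl y) z) = frag_extend D1 (frag_extend (sl y) w)"
      using eq sl_act1 by (metis frag_extend_cmul)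
    then show "\<exists>u. u \<in> frags S1 \<and> frag_cmul 2 (frag_extend (sl y) z) = frag_extend D1 u"
      using exp n sl_in[OF z] sl_in[OF w] unfolding torsion_exponent_2_def by blast
  qed
  from bchoice[OF this] obtain u where u: "\<And>y. y \<in> S2 \<Longrightarrow> u y \<in> frags S1"
    "\<And>y. y \<in> S2 \<Longrightarrow> frag_cmul 2 (frag_extend (sl y) z) = frag_extend D1 (u y)" by blast
  have em_D1: "frag_extend (em y) (frag_extend D1 x) = frag_extend (act1 D1) (frag_extend (em y) x)" for x y
    unfolding extend_compose by (rule frag_extend_eq) (simp add: em_def act1_def)
  have decomp: "(\<Sum>y\<in>S2. frag_extend (em y) (frag_extend (sl y) z)) = z"
  proof -
    have "(\<Sum>y\<in>S2. frag_extend (em y) (frag_extend (sl y) z)) = frag_extend (\<lambda>g. \<Sum>y\<in>S2. frag_extend (em y) (sl y g)) z"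
      unfolding extend_compose by (simp add: frag_extend_def frag_cmul_sum sum.swap[of _ S2])
    also have "\<dots> = z"
      using z
    proof (rule extend_id)
      fix g assume g: "g \<in> S1 \<times> S2"
      have "(\<Sum>y\<in>S2. frag_extend (em y) (sl y g)) = (\<Sum>y\<in>S2. if y = snd g then frag_of g else 0)"
        by (rule sum.cong) (auto simp: em_def sl_def split: prod.splits)
      then show "(\<Sum>y\<in>S2. frag_extend (em y) (sl y g)) = frag_of g" using g S2 by auto
    qed
    finally show ?thesis .
  qed
  let ?y = "\<Sum>y\<in>S2. frag_extend (em y) (u y)"
  have "frag_cmul 2 z = (\<Sum>y\<in>S2. frag_extend (em y) (frag_cmul 2 (frag_extend (sl y) z)))"
    unfolding frag_extend_cmul frag_cmul_sum[symmetric] decomp ..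
  also have "\<dots> = (\<Sum>y\<in>S2. frag_extend (act1 D1) (frag_extend (em y) (u y)))"
    by (rule sum.cong) (simp_all add: u em_D1)
  also have "\<dots> = frag_extend (act1 D1) ?y" using S2 by (simp add: frag_extend_sum)
  finally have "frag_cmul 2 z = frag_extend (act1 D1) ?y" .
  moreover have "?y \<in> frags (S1 \<times> S2)"
    by (intro frags_sum frags_extend[OF u(1)]) (auto simp: em_def)
  ultimately show "\<exists>y\<in>frags (S1 \<times> S2). frag_cmul 2 z = frag_extend (act1 D1) y" by blast
qed

text \<open>The splitting of the second factor yields a projection \<pi> and a homotopy for twice
  \<pi> on the tensor product, so 2 \<pi> z is a boundary for every cycle \<open>z\<close>. The
  second differential vanishes on the image of 1 - \<pi>, and the torsion there comes from the first
  factor alone.\<close>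

lemma torsion_tensor:
  assumes S: "finite S1" "finite S2"
    and D1: "\<And>g. g \<in> S1 \<Longrightarrow> D1 g \<in> frags {g' \<in> S1. \<tau> g' = - \<tau> g}" "\<And>g. g \<in> S1 \<Longrightarrow> frag_extend D1 (D1 g) = 0"
    and D2: "\<And>g. g \<in> S2 \<Longrightarrow> D2 g \<in> frags S2" "\<And>g. g \<in> S2 \<Longrightarrow> frag_extend D2 (D2 g) = 0"
    and \<tau>: "\<And>g. g \<in> S1 \<Longrightarrow> \<tau> g * \<tau> g = 1"
    and exp: "torsion_exponent_2 S1 D1" "torsion_exponent_2 S2 D2"
  shows "torsion_exponent_2 (S1 \<times> S2) (tensor_diff \<tau> D1 D2)"
proof -
  let ?S = "S1 \<times> S2"
  have sq2: "frag_extend D2 (frag_extend D2 z) = 0" if "z \<in> frags S2" for z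
    unfolding extend_compose using that D2(2) by (rule extend_eq_0)
  obtain H K where H: "\<And>g. g \<in> S2 \<Longrightarrow> H g \<in> frags S2" and K: "\<And>g. g \<in> S2 \<Longrightarrow> K g \<in> frags S2"
    and hom: "\<And>z. z \<in> frags S2 \<Longrightarrow> frag_extend D2 (frag_extend H z) + frag_extend H (frag_extend D2 z) = frag_cmul 2 (frag_extend K z)"
    and DK: "\<And>z. z \<in> frags S2 \<Longrightarrow> frag_extend D2 (frag_extend K z) = frag_extend D2 z"
    and KD: "\<And>z. z \<in> frags S2 \<Longrightarrow> frag_extend K (frag_extend D2 z) = frag_extend D2 z"
    and KK: "\<And>z. z \<in> frags S2 \<Longrightarrow> frag_extend K (frag_extend K z) = frag_extend K z"
    by (rule exponent_2_splitting[OF S(2) _ _ exp(2)], erule D2(1), erule sq2, rule that; blast)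
  have D1': "D1 g \<in> frags S1" if "g \<in> S1" for g using D1(1)[OF that] by (rule frags_mono) auto
  let ?d1 = "frag_extend (act1 D1)" and ?d2 = "frag_extend (twist \<tau> (act2 D2))"
  let ?h = "frag_extend (twist \<tau> (act2 H))" and ?\<pi> = "frag_extend (act2 K)"
  have twist2: "frag_extend (twist \<tau> (act2 F)) (act2 G (g1, g2)) = frag_cmul (\<tau> g1) (frag_extend (act2 F) (act2 G (g1, g2)))"
    for F G g1 g2
  proof -
    have "act2 G (g1, g2) \<in> frags (range (Pair g1))"
      using frags_extend[of "G g2" UNIV "\<lambda>g2'. frag_of (g1, g2')" "range (Pair g1)"] by (simp add: act2_def frags_def)
    then have "frag_extend (twist \<tau> (act2 F)) (act2 G (g1, g2)) = frag_extend (\<lambda>g. frag_cmul (\<tau> g1) (act2 F g)) (act2 G (g1, g2))"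
      by (rule extend_cong) (auto simp: twist_def)
    then show ?thesis by (simp add: extend_cmul_fun)
  qed
  have twist1: "frag_extend (twist \<tau> (act2 F)) (act1 D1 (g1, g2)) = frag_cmul (- \<tau> g1) (frag_extend (act2 F) (act1 D1 (g1, g2)))"
    if "g1 \<in> S1" for F g1 g2
  proof -
    have "act1 D1 (g1, g2) \<in> frags ({g' \<in> S1. \<tau> g' = - \<tau> g1} \<times> {g2})"
      using D1(1)[OF that] by (rule act1_in) simp
    then have "frag_extend (twist \<tau> (act2 F)) (act1 D1 (g1, g2)) = frag_extend (\<lambda>g. frag_cmul (- \<tau> g1) (act2 F g)) (act1 D1 (g1, g2))"
      by (rule extend_cong) (auto simp: twist_def)
    then show ?thesis by (simp add: extend_cmul_fun)
  qed
  \<comment> \<open>\<open>D1\<close> reverses \<tau>, so the twist turns the commuting actions on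
    the two factors into anticommuting ones.\<close>
  have anti: "?d1 (frag_extend (twist \<tau> (act2 F)) z) = - frag_extend (twist \<tau> (act2 F)) (?d1 z)" if "z \<in> frags ?S" for F z
  proof -
    have "frag_extend (\<lambda>g. ?d1 (twist \<tau> (act2 F) g) + frag_extend (twist \<tau> (act2 F)) (act1 D1 g)) z = 0"
      using that
    proof (rule extend_eq_0)
      fix g assume "g \<in> ?S"
      then obtain g1 g2 where g: "g = (g1, g2)" "g1 \<in> S1" by blast
      show "?d1 (twist \<tau> (act2 F) g) + frag_extend (twist \<tau> (act2 F)) (act1 D1 g) = 0"
        unfolding g(1) twist1[OF g(2)] by (simp add: twist_def frag_extend_cmul act1_act2 flip: minus_frag_cmul)
    qed
    then show ?thesis unfolding extend_add_fun by (simp add: extend_compose add_eq_0_iff2)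
  qed
  have twist_twist: "frag_extend (twist \<tau> (act2 F)) (frag_extend (twist \<tau> (act2 G)) z) = frag_extend (act2 (\<lambda>g. frag_extend F (G g))) z"
    if "z \<in> frags ?S" for F G z
    unfolding extend_compose using that
  proof (rule extend_cong)
    fix g assume "g \<in> ?S"
    then obtain g1 g2 where g: "g = (g1, g2)" "g1 \<in> S1" by blast
    have "twist \<tau> (act2 G) g = frag_cmul (\<tau> g1) (act2 G (g1, g2))" by (simp add: g twist_def)
    then show "frag_extend (twist \<tau> (act2 F)) (twist \<tau> (act2 G) g) = act2 (\<lambda>g. frag_extend F (G g)) g"
      using \<tau>[OF g(2)] by (simp add: frag_extend_cmul twist2 act2_act2 g(1))
  qed
  have act2_cong: "frag_extend (act2 F) z = frag_extend (act2 G) z"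
    if "z \<in> frags ?S" "\<And>g. g \<in> S2 \<Longrightarrow> F g = G g" for F G z
    using that by (intro extend_cong[OF that(1)]) (auto simp: act2_def)
  have \<pi>_d1: "?\<pi> (?d1 z) = ?d1 (?\<pi> z)" for z
    unfolding extend_compose by (rule frag_extend_eq) (metis act1_act2 surj_pair)
  have \<pi>_d2: "?\<pi> (?d2 z) = ?d2 z" "?d2 (?\<pi> z) = ?d2 z" if z: "z \<in> frags ?S" for z
  proof -
    show "?\<pi> (?d2 z) = ?d2 z"
      unfolding extend_compose using z
    proof (rule extend_cong)
      fix g assume "g \<in> ?S"
      then obtain g1 g2 where g: "g = (g1, g2)" "g2 \<in> S2" by blast
      have "frag_extend K (D2 g2) = D2 g2" using KD[of "frag_of g2"] g by simp
      then have "frag_extend (act2 K) (act2 D2 (g1, g2)) = act2 D2 (g1, g2)"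
        unfolding act2_act2 by (simp add: act2_def)
      then show "frag_extend (act2 K) (twist \<tau> (act2 D2) g) = twist \<tau> (act2 D2) g"
        by (simp add: g twist_def frag_extend_cmul)
    qed
    show "?d2 (?\<pi> z) = ?d2 z"
      unfolding extend_compose using z
    proof (rule extend_cong)
      fix g assume "g \<in> ?S"
      then obtain g1 g2 where g: "g = (g1, g2)" "g2 \<in> S2" by blast
      have "frag_extend D2 (K g2) = D2 g2" using DK[of "frag_of g2"] g by simp
      then have "frag_extend (act2 D2) (act2 K (g1, g2)) = act2 D2 (g1, g2)"
        unfolding act2_act2 by (simp add: act2_def)
      then show "frag_extend (twist \<tau> (act2 D2)) (act2 K g) = twist \<tau> (act2 D2) g"
        unfolding g(1) twist2 by (simp add: twist_def)
    qed
  qed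
  have \<pi>\<pi>: "?\<pi> (?\<pi> z) = ?\<pi> z" if z: "z \<in> frags ?S" for z
    unfolding extend_compose using z
  proof (rule extend_cong)
    fix g assume "g \<in> ?S"
    then obtain g1 g2 where g: "g = (g1, g2)" "g2 \<in> S2" by blast
    have "frag_extend K (K g2) = K g2" using KK[of "frag_of g2"] g by simp
    then show "frag_extend (act2 K) (act2 K g) = act2 K g"
      unfolding g(1) act2_act2 by (simp add: act2_def)
  qed
  have in_S: "?d1 z \<in> frags ?S" "?d2 z \<in> frags ?S" "?h z \<in> frags ?S" "?\<pi> z \<in> frags ?S" if z: "z \<in> frags ?S" for z
    using D1' D2(1) H K by (auto intro!: frags_extend[OF z] act1_in act2_in frags_cmul simp: twist_def)
  have hom': "?d2 (?h z) + ?h (?d2 z) = frag_cmul 2 (?\<pi> z)" if z: "z \<in> frags ?S" for z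
  proof -
    have "?d2 (?h z) + ?h (?d2 z) = frag_extend (act2 (\<lambda>g. frag_extend D2 (H g) + frag_extend H (D2 g))) z"
      unfolding twist_twist[OF z] extend_add_fun[symmetric]
      by (rule frag_extend_eq) (auto simp: act2_def frag_extend_add)
    also have "\<dots> = frag_extend (act2 (\<lambda>g. frag_cmul 2 (K g))) z"
      using z
    proof (rule act2_cong)
      fix g assume "g \<in> S2"
      then show "frag_extend D2 (H g) + frag_extend H (D2 g) = frag_cmul 2 (K g)" using hom[of "frag_of g"] by simp
    qed
    also have "\<dots> = frag_cmul 2 (?\<pi> z)"
      unfolding extend_cmul_fun[symmetric] by (rule frag_extend_eq) (auto simp: act2_def frag_extend_cmul)
    finally show ?thesis .
  qed
  have d1d1: "?d1 (?d1 z) = 0" if z: "z \<in> frags ?S" for z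
    unfolding extend_compose using z
  proof (rule extend_eq_0)
    fix g assume "g \<in> ?S"
    then obtain g1 g2 where g: "g = (g1, g2)" "g1 \<in> S1" by blast
    show "frag_extend (act1 D1) (act1 D1 g) = 0" unfolding g(1) act1_act1 using D1(2)[OF g(2)] by (simp add: act1_def)
  qed
  have d2d2: "?d2 (?d2 z) = 0" if z: "z \<in> frags ?S" for z
    unfolding twist_twist[OF z] using z by (rule extend_eq_0) (auto simp: act2_def D2(2))
  have d: "frag_extend (tensor_diff \<tau> D1 D2) z = ?d1 z + ?d2 z" for z
    unfolding tensor_diff_def extend_add_fun ..
  show ?thesis
    unfolding torsion_exponent_2_def d
  proof (intro allI impI)
    fix n z w assume n: "0 < (n::int)" and z: "z \<in> frags ?S" and w: "w \<in> frags ?S"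
      and eq: "frag_cmul n z = ?d1 w + ?d2 w"
    have "frag_cmul n (?d1 z + ?d2 z) = ?d1 (?d1 w + ?d2 w) + ?d2 (?d1 w + ?d2 w)"
      unfolding eq[symmetric] by (simp add: frag_extend_cmul frag_cmul_distrib2)
    also have "\<dots> = 0" using d1d1[OF w] d2d2[OF w] anti[OF w] by (simp add: frag_extend_simps)
    finally have dz: "?d1 z + ?d2 z = 0" using n by simp
    have "?d1 (?h z) + ?d2 (?h z) + ?h (?d1 z + ?d2 z) = frag_cmul 2 (?\<pi> z)"
      unfolding hom'[OF z, symmetric] anti[OF z] by (simp add: frag_extend_simps)
    then have A: "frag_cmul 2 (?\<pi> z) = ?d1 (?h z) + ?d2 (?h z)" using dz by simp
    have "frag_cmul n (z - ?\<pi> z) = (?d1 w + ?d2 w) - ?\<pi> (?d1 w + ?d2 w)"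
      unfolding eq[symmetric] by (simp add: frag_extend_cmul frag_cmul_diff2)
    also have "\<dots> = ?d1 (w - ?\<pi> w)" using \<pi>_d1 \<pi>_d2(1)[OF w] by (simp add: frag_extend_simps)
    finally have "frag_cmul n (z - ?\<pi> z) = ?d1 (w - ?\<pi> w)" .
    moreover have "z - ?\<pi> z \<in> frags ?S" "w - ?\<pi> w \<in> frags ?S"
      by (intro frags_diff z w in_S(4))+
    ultimately obtain y where y: "y \<in> frags ?S" "frag_cmul 2 (z - ?\<pi> z) = ?d1 y"
      using torsion_act1[OF S(2) exp(1) D1'] n unfolding torsion_exponent_2_def by blast
    \<comment> \<open>Replacing \<open>y\<close> by \<open>y - \<pi> y\<close> keeps its boundary
      under the first differential and makes it closed under the second.\<close>
    have "?\<pi> (frag_cmul 2 (z - ?\<pi> z)) = 0" using \<pi>\<pi>[OF z] by (simp add: frag_extend_simps)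
    then have "?d1 (?\<pi> y) = 0" unfolding y(2) \<pi>_d1 .
    then have "?d1 (y - ?\<pi> y) = frag_cmul 2 (z - ?\<pi> z)" unfolding y(2) by (simp add: frag_extend_simps)
    moreover have "?d2 (y - ?\<pi> y) = 0" using \<pi>_d2(2)[OF y(1)] by (simp add: frag_extend_simps)
    moreover have "frag_cmul 2 z = frag_cmul 2 (?\<pi> z) + frag_cmul 2 (z - ?\<pi> z)"
      by (simp add: frag_cmul_diff2)
    ultimately have "frag_cmul 2 z = ?d1 (?h z + (y - ?\<pi> y)) + ?d2 (?h z + (y - ?\<pi> y))"
      unfolding A by (simp add: frag_extend_add)
    moreover have "?h z + (y - ?\<pi> y) \<in> frags ?S" using z y(1) in_S by (intro frags_add frags_diff)
    ultimately show "\<exists>y\<in>frags ?S. frag_cmul 2 z = ?d1 y + ?d2 y" by blast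
  qed
qed

section \<open>Disconnected graphs\<close>

definition inversions :: "nat set \<Rightarrow> nat set \<Rightarrow> nat" where
  "inversions P1 P2 = card {(l, r). l \<in> P1 \<and> r \<in> P2 \<and> r < l}"

lemma inversions_insert:
  assumes fin: "finite P1" "finite P2"
  shows "r \<notin> P1 \<Longrightarrow> inversions (insert r P1) P2 = inversions P1 P2 + card {s \<in> P2. s < r}"
    "r \<notin> P2 \<Longrightarrow> inversions P1 (insert r P2) = inversions P1 P2 + card {l \<in> P1. r < l}"
proof -
  have f: "finite {(l, r). l \<in> P1 \<and> r \<in> P2 \<and> r < l}"
    by (rule finite_subset[of _ "P1 \<times> P2"]) (use fin in auto)
  assume r: "r \<notin> P1"
  have "{(l, s). l \<in> insert r P1 \<and> s \<in> P2 \<and> s < l} =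
    {(l, r). l \<in> P1 \<and> r \<in> P2 \<and> r < l} \<union> Pair r ` {s \<in> P2. s < r}" by auto
  moreover have "card ({(l, r). l \<in> P1 \<and> r \<in> P2 \<and> r < l} \<union> Pair r ` {s \<in> P2. s < r}) =
      card {(l, r). l \<in> P1 \<and> r \<in> P2 \<and> r < l} + card (Pair r ` {s \<in> P2. s < r})"
    using f fin r by (intro card_Un_disjoint) auto
  moreover have "card (Pair r ` {s \<in> P2. s < r}) = card {s \<in> P2. s < r}"
    by (rule card_image) (simp add: inj_on_def)
  ultimately show "inversions (insert r P1) P2 = inversions P1 P2 + card {s \<in> P2. s < r}"
    by (simp add: inversions_def)
next
  have f: "finite {(l, r). l \<in> P1 \<and> r \<in> P2 \<and> r < l}"
    by (rule finite_subset[of _ "P1 \<times> P2"]) (use fin in auto)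
  assume r: "r \<notin> P2"
  have "{(l, s). l \<in> P1 \<and> s \<in> insert r P2 \<and> s < l} =
    {(l, r). l \<in> P1 \<and> r \<in> P2 \<and> r < l} \<union> (\<lambda>l. (l, r)) ` {l \<in> P1. r < l}" by auto
  moreover have "card ({(l, r). l \<in> P1 \<and> r \<in> P2 \<and> r < l} \<union> (\<lambda>l. (l, r)) ` {l \<in> P1. r < l}) =
      card {(l, r). l \<in> P1 \<and> r \<in> P2 \<and> r < l} + card ((\<lambda>l. (l, r)) ` {l \<in> P1. r < l})"
    using f fin r by (intro card_Un_disjoint) auto
  moreover have "card ((\<lambda>l. (l, r)) ` {l \<in> P1. r < l}) = card {l \<in> P1. r < l}"
    by (rule card_image) (simp add: inj_on_def)
  ultimately show "inversions P1 (insert r P2) = inversions P1 P2 + card {l \<in> P1. r < l}"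
    by (simp add: inversions_def)
qed

text \<open>The sign of the permutation that lists the edges of \<open>P1\<close> before those of
  \<open>P2\<close>. It reconciles the signs of the cube of a union with those of a tensor
  product.\<close>

definition shuffle_sign :: "nat set \<Rightarrow> nat set \<Rightarrow> int" where
  "shuffle_sign P1 P2 = (-1) ^ inversions P1 P2"

lemma shuffle_sign_square [simp]: "shuffle_sign P1 P2 * shuffle_sign P1 P2 = 1"
  by (simp add: shuffle_sign_def flip: power_add mult_2)

text \<open>In the shuffled order a new edge of \<open>P2\<close> has to pass all edges of
  \<open>P1\<close>; this is the Koszul sign of the second factor.\<close>

lemma shuffle_sign_insert:
  assumes fin: "finite P1" "finite P2" and disj: "P1 \<inter> P2 = {}" and r: "r \<notin> P1" "r \<notin> P2"
  shows "shuffle_sign P1 P2 * esign (P1 \<union> P2) r = esign P1 r * shuffle_sign (insert r P1) P2"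
    "shuffle_sign P1 P2 * esign (P1 \<union> P2) r = (-1) ^ card P1 * (esign P2 r * shuffle_sign P1 (insert r P2))"
proof -
  have "{l \<in> P1 \<union> P2. l < r} = {l \<in> P1. l < r} \<union> {l \<in> P2. l < r}" by auto
  moreover have "card ({l \<in> P1. l < r} \<union> {l \<in> P2. l < r}) = card {l \<in> P1. l < r} + card {l \<in> P2. l < r}"
    using fin disj by (intro card_Un_disjoint) auto
  ultimately have e: "esign (P1 \<union> P2) r = esign P1 r * esign P2 r" by (simp add: esign_def power_add)
  show "shuffle_sign P1 P2 * esign (P1 \<union> P2) r = esign P1 r * shuffle_sign (insert r P1) P2"
    by (simp add: e shuffle_sign_def inversions_insert(1)[OF fin r(1)] power_add) (simp add: esign_def)
  have "P1 = {l \<in> P1. l < r} \<union> {l \<in> P1. r < l}" using r(1) by (auto simp: not_less_iff_gr_or_eq)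
  moreover have "card ({l \<in> P1. l < r} \<union> {l \<in> P1. r < l}) = card {l \<in> P1. l < r} + card {l \<in> P1. r < l}"
    by (intro card_Un_disjoint finite_Collect_conjI disjI1) (use fin in \<open>simp_all add: disjoint_iff\<close>)
  ultimately have "(-1 :: int) ^ card P1 = esign P1 r * (-1) ^ card {l \<in> P1. r < l}"
    by (simp add: esign_def power_add)
  moreover have "(-1 :: int) ^ card {l \<in> P1. r < l} * (-1) ^ card {l \<in> P1. r < l} = 1"
    by (simp flip: power_add mult_2)
  ultimately show "shuffle_sign P1 P2 * esign (P1 \<union> P2) r = (-1) ^ card P1 * (esign P2 r * shuffle_sign P1 (insert r P2))"
    by (simp add: e shuffle_sign_def inversions_insert(2)[OF fin r(2)] power_add mult_ac)
qed

context graph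
begin

text \<open>A connection that starts in a closed set stays in it and cannot use edges that lie
  outside.\<close>

lemma eq_restrict:
  assumes cl: "closed P V'" and x: "x \<in> V'" and P': "P' \<subseteq> P" and out: "\<And>r. r \<in> P - P' \<Longrightarrow> a r \<notin> V'"
  shows "(x, y) \<in> eq P \<longleftrightarrow> (x, y) \<in> eq P'"
proof
  let ?T = "{y. (x, y) \<in> eq P'}"
  have TV: "?T \<subseteq> V'" using closedD[OF closed_mono[OF cl P']] x by blast
  have "closed P ?T"
  proof (rule closedI)
    fix u w assume "(u, w) \<in> gen P"
    then consider "(u, w) \<in> gen P'" | r where "r \<in> P - P'" "u = a r" "w = b r" by (auto simp: gen_def)
    then show "u \<in> ?T \<longleftrightarrow> w \<in> ?T"
    proof cases
      case 1
      then have "(u, w) \<in> eq P'" by (auto simp: eq_def)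
      then show ?thesis using eq_trans eq_sym by blast
    next
      case 2
      then have "(u, w) \<in> eq P" using eq_edge by blast
      then have "u \<notin> V'" "w \<notin> V'" using out[OF 2(1)] 2(2) closedD[OF cl] by blast+
      then show ?thesis using TV by blast
    qed
  qed
  moreover assume "(x, y) \<in> eq P"
  ultimately show "(x, y) \<in> eq P'" using closedD by fastforce
qed (rule eq_mono[OF P'])

lemma Image_restrict:
  assumes "closed P V'" "W \<subseteq> V'" "P' \<subseteq> P" "\<And>r. r \<in> P - P' \<Longrightarrow> a r \<notin> V'"
  shows "eq P `` W = eq P' `` W" "ncomp P W = ncomp P' W"
proof -
  have *: "(x, y) \<in> eq P \<longleftrightarrow> (x, y) \<in> eq P'" if "x \<in> W" for x y
    using eq_restrict[OF assms(1) _ assms(3,4)] that assms(2) by blast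
  then show "eq P `` W = eq P' `` W" by blast
  have "W // eq P = W // eq P'" unfolding quotient_def using * by (intro SUP_cong) auto
  then show "ncomp P W = ncomp P' W" by (simp add: ncomp_def)
qed

text \<open>Edges added in one part do not touch the components of the other, so the merge takes
  place in one tensor factor and no label is lost in the other.\<close>

lemma push_union:
  assumes disj: "V1 \<inter> V2 = {}" and fin: "finite V1" "finite V2"
    and W: "W1 \<subseteq> V1" "W2 \<subseteq> V2" and Q: "P1 \<subseteq> Q1"
    and cl: "closed (Q1 \<union> P2) V1" "closed (Q1 \<union> P2) V2" "closed P2 W2"
    and out: "\<And>r. r \<in> P2 \<Longrightarrow> a r \<notin> V1" "\<And>r. r \<in> Q1 \<Longrightarrow> a r \<notin> V2" and P1: "closed P1 W1"
  shows "push 0 {} (Q1 \<union> P2) (P1 \<union> P2, W1 \<union> W2) =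
    frag_extend (\<lambda>(P, W). frag_of (P \<union> P2, W \<union> W2)) (push 0 {} Q1 (P1, W1))"
proof -
  let ?Q = "Q1 \<union> P2" and ?P = "P1 \<union> P2"
  have PQ: "?P \<subseteq> ?Q" using Q by auto
  have r1: "eq ?Q `` W = eq Q1 `` W" "ncomp ?Q W = ncomp Q1 W" if "W \<subseteq> V1" for W
    by (rule Image_restrict[OF cl(1) that]; use out in blast)+
  have r2: "eq ?Q `` W = eq P2 `` W" "ncomp ?Q W = ncomp P2 W" if "W \<subseteq> V2" for W
    by (rule Image_restrict[OF cl(2) that]; use out in blast)+
  have p1: "ncomp ?P W = ncomp P1 W" if "W \<subseteq> V1" for W
    by (rule Image_restrict(2)[OF closed_mono[OF cl(1) PQ] that]) (use out in auto)
  have p2: "ncomp ?P W = ncomp P2 W" if "W \<subseteq> V2" for W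
    by (rule Image_restrict(2)[OF closed_mono[OF cl(2) PQ] that]) (use out Q in auto)
  have W2: "eq ?Q `` W2 = W2" using r2(1)[OF W(2)] Image_closed[OF cl(3)] by simp
  have W1': "eq Q1 `` W1 \<subseteq> V1" using r1(1)[OF W(1)] Image_subset[OF cl(1) W(1)] by simp
  have img: "eq ?Q `` (W1 \<union> W2) = eq Q1 `` W1 \<union> W2" unfolding Image_Un r1(1)[OF W(1)] W2 ..
  have finW: "finite W1" "finite W2" "finite (eq Q1 `` W1)" using W W1' fin finite_subset by blast+
  have clQ: "closed ?Q (eq Q1 `` W1)" "closed ?Q W2"
    using closed_Image[of ?Q W1] closed_Image[of ?Q W2] unfolding r1(1)[OF W(1)] W2 by auto
  have clP: "closed ?P W1" "closed ?P W2"
  proof -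
    show "closed ?P W2" by (rule closed_mono[OF clQ(2) PQ])
    have "eq ?P `` W1 = eq P1 `` W1"
      by (rule Image_restrict(1)[OF closed_mono[OF cl(1) PQ] W(1)]) (use out in auto)
    then have "eq ?P `` W1 = W1" using Image_closed[OF P1] by simp
    then show "closed ?P W1" using closed_Image[of ?P W1] by simp
  qed
  have nQ: "ncomp ?Q (eq Q1 `` W1 \<union> W2) = ncomp Q1 (eq Q1 `` W1) + ncomp P2 W2"
    using ncomp_Un[OF finW(3,2) clQ] r1(2)[OF W1'] r2(2)[OF W(2)] W1' W(2) disj by auto
  have nP: "ncomp ?P (W1 \<union> W2) = ncomp P1 W1 + ncomp P2 W2"
    using ncomp_Un[OF finW(1,2) clP] p1[OF W(1)] p2[OF W(2)] W disj by auto
  show ?thesis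
    unfolding push_def prod.case Let_def img nQ nP by (simp add: frag_extend_simps)
qed

section \<open>The complex of a disjoint union as a tensor product\<close>

context
  fixes V1 V2 :: "'v set" and U1 U2 :: "nat set"
  assumes finV: "finite V1" "finite V2" and finU: "finite U1" "finite U2"
    and disjV: "V1 \<inter> V2 = {}" and disjU: "U1 \<inter> U2 = {}"
    and cl: "closed (U1 \<union> U2) V1" "closed (U1 \<union> U2) V2"
    and ends: "\<And>r. r \<in> U1 \<Longrightarrow> a r \<in> V1" "\<And>r. r \<in> U2 \<Longrightarrow> a r \<in> V2"
begin

abbreviation (input) "G1 \<equiv> gens V1 {} U1 {}"
abbreviation (input) "G2 \<equiv> gens V2 {} U2 {}"
abbreviation (input) "G \<equiv> gens (V1 \<union> V2) {} (U1 \<union> U2) {}"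

definition join :: "(nat set \<times> 'v set) \<times> (nat set \<times> 'v set) \<Rightarrow> (nat set \<times> 'v set) \<Rightarrow>\<^sub>0 int" where
  "join = (\<lambda>((P1, W1), (P2, W2)). frag_cmul (shuffle_sign P1 P2) (frag_of (P1 \<union> P2, W1 \<union> W2)))"

definition unjoin :: "nat set \<times> 'v set \<Rightarrow> ((nat set \<times> 'v set) \<times> (nat set \<times> 'v set)) \<Rightarrow>\<^sub>0 int" where
  "unjoin = (\<lambda>(P, W). frag_cmul (shuffle_sign (P \<inter> U1) (P \<inter> U2)) (frag_of ((P \<inter> U1, W \<inter> V1), (P \<inter> U2, W \<inter> V2))))"

lemma closed_join:
  assumes "P1 \<subseteq> U1" "P2 \<subseteq> U2" "W1 \<subseteq> V1" "W2 \<subseteq> V2" "closed P1 W1" "closed P2 W2"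
  shows "closed (P1 \<union> P2) (W1 \<union> W2)"
proof -
  have cl': "closed (P1 \<union> P2) V1" "closed (P1 \<union> P2) V2"
    using cl closed_mono assms(1,2) by (meson Un_mono)+
  have out: "\<And>r. r \<in> P2 \<Longrightarrow> a r \<notin> V1" "\<And>r. r \<in> P1 \<Longrightarrow> a r \<notin> V2"
    using assms(1,2) ends disjV by blast+
  have "eq (P1 \<union> P2) `` W1 = eq P1 `` W1"
    by (rule Image_restrict(1)[OF cl'(1) assms(3)]) (use out in auto)
  moreover have "eq (P1 \<union> P2) `` W2 = eq P2 `` W2"
    by (rule Image_restrict(1)[OF cl'(2) assms(4)]) (use out in auto)
  ultimately have "eq (P1 \<union> P2) `` (W1 \<union> W2) = W1 \<union> W2"
    using Image_closed assms(5,6) by (simp add: Image_Un)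
  then show ?thesis using closed_Image by metis
qed

lemma join_in: "g \<in> G1 \<times> G2 \<Longrightarrow> join g \<in> frags G"
  by (auto simp: join_def gens_def intro!: frags_cmul closed_join)

lemma unjoin_in: "g \<in> G \<Longrightarrow> unjoin g \<in> frags (G1 \<times> G2)"
proof -
  assume g: "g \<in> G"
  obtain P W where [simp]: "g = (P, W)" by (cases g)
  have P: "P \<subseteq> U1 \<union> U2" "closed P W" using g by (auto simp: gens_def)
  have "closed P (W \<inter> V1)" "closed P (W \<inter> V2)" using closed_mono[OF cl(1) P(1)] closed_mono[OF cl(2) P(1)] P(2)
    by (auto intro: closed_Int)
  then have "closed (P \<inter> U1) (W \<inter> V1)" "closed (P \<inter> U2) (W \<inter> V2)" by (auto elim: closed_mono)
  then show ?thesis by (auto simp: unjoin_def gens_def intro!: frags_cmul)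
qed

lemma join_unjoin: "g \<in> G \<Longrightarrow> frag_extend join (unjoin g) = frag_of g"
proof -
  assume g: "g \<in> G"
  obtain P W where [simp]: "g = (P, W)" by (cases g)
  have "P \<inter> U1 \<union> P \<inter> U2 = P" "W \<inter> V1 \<union> W \<inter> V2 = W" using g by (auto simp: gens_def)
  then show ?thesis by (simp add: join_def unjoin_def frag_extend_simps)
qed

lemma unjoin_join: "g \<in> G1 \<times> G2 \<Longrightarrow> frag_extend unjoin (join g) = frag_of g"
proof -
  assume g: "g \<in> G1 \<times> G2"
  obtain P1 W1 P2 W2 where [simp]: "g = ((P1, W1), (P2, W2))" by (metis surj_pair)
  have "P1 \<subseteq> U1" "P2 \<subseteq> U2" "W1 \<subseteq> V1" "W2 \<subseteq> V2" using g by (auto simp: gens_def)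
  then have "(P1 \<union> P2) \<inter> U1 = P1" "(P1 \<union> P2) \<inter> U2 = P2" "(W1 \<union> W2) \<inter> V1 = W1" "(W1 \<union> W2) \<inter> V2 = W2"
    using disjU disjV by auto
  then show ?thesis by (simp add: join_def unjoin_def frag_extend_simps)
qed

lemma join_diff:
  assumes g: "g \<in> G1 \<times> G2"
  shows "frag_extend (diff 0 (U1 \<union> U2) {}) (join g) =
    frag_extend join (tensor_diff (\<lambda>(P, W). (-1) ^ card P) (diff 0 U1 {}) (diff 0 U2 {}) g)"
proof -
  obtain P1 W1 P2 W2 where g_eq [simp]: "g = ((P1, W1), (P2, W2))" by (metis surj_pair)
  have P: "P1 \<subseteq> U1" "P2 \<subseteq> U2" and W: "W1 \<subseteq> V1" "W2 \<subseteq> V2" and c: "closed P1 W1" "closed P2 W2"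
    using g by (auto simp: gens_def)
  have fin: "finite P1" "finite P2" using P finU finite_subset by auto
  let ?P = "P1 \<union> P2" and ?W = "W1 \<union> W2"
  have disjP: "P1 \<inter> P2 = {}" using P disjU by blast
  have out: "\<And>r. r \<in> U2 \<Longrightarrow> a r \<notin> V1" "\<And>r. r \<in> U1 \<Longrightarrow> a r \<notin> V2"
    "\<And>r. r \<in> P2 \<Longrightarrow> a r \<notin> V1" "\<And>r. r \<in> P1 \<Longrightarrow> a r \<notin> V2"
    using P ends disjV by blast+
  have sub: "closed Q V1" "closed Q V2" if "Q \<subseteq> U1 \<union> U2" for Q using cl closed_mono that by blast+
  let ?t = "\<lambda>r. frag_cmul (shuffle_sign P1 P2 * esign ?P r) (push 0 {} (insert r ?P) (?P, ?W))"
  have term1: "?t r = frag_cmul (esign P1 r) (frag_extend (\<lambda>g1. join (g1, (P2, W2))) (push 0 {} (insert r P1) (P1, W1)))"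
    if r: "r \<in> U1 - P1" for r
  proof -
    have rn: "r \<notin> P1" "r \<notin> P2" using r P disjU by blast+
    have "push 0 {} (insert r P1 \<union> P2) (?P, ?W) =
      frag_extend (\<lambda>(P, W). frag_of (P \<union> P2, W \<union> W2)) (push 0 {} (insert r P1) (P1, W1))"
      by (rule push_union[of V1 V2])
         (use r P out disjV finV W c in \<open>auto intro!: sub\<close>)
    then have "?t r = frag_cmul (esign P1 r) (frag_cmul (shuffle_sign (insert r P1) P2)
       (frag_extend (\<lambda>(P, W). frag_of (P \<union> P2, W \<union> W2)) (push 0 {} (insert r P1) (P1, W1))))"
      using shuffle_sign_insert(1)[OF fin disjP rn] by simp
    also have "frag_cmul (shuffle_sign (insert r P1) P2)
       (frag_extend (\<lambda>(P, W). frag_of (P \<union> P2, W \<union> W2)) (push 0 {} (insert r P1) (P1, W1))) =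
       frag_extend (\<lambda>g1. join (g1, (P2, W2))) (push 0 {} (insert r P1) (P1, W1))"
      unfolding extend_cmul_fun[symmetric]
    proof (rule extend_cong)
      show "push 0 {} (insert r P1) (P1, W1) \<in> frags (range (Pair (insert r P1)))"
        by (auto simp: push_def Let_def intro!: frags_cmul)
    qed (auto simp: join_def)
    finally show ?thesis .
  qed
  have term2: "?t r = frag_cmul ((-1) ^ card P1) (frag_cmul (esign P2 r) (frag_extend (\<lambda>g2. join ((P1, W1), g2)) (push 0 {} (insert r P2) (P2, W2))))"
    if r: "r \<in> U2 - P2" for r
  proof -
    have rn: "r \<notin> P1" "r \<notin> P2" using r P disjU by blast+
    have "push 0 {} (insert r P2 \<union> P1) (P2 \<union> P1, W2 \<union> W1) =
      frag_extend (\<lambda>(P, W). frag_of (P \<union> P1, W \<union> W1)) (push 0 {} (insert r P2) (P2, W2))"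
      by (rule push_union[of V2 V1])
         (use r P out disjV finV W c in \<open>auto intro!: sub\<close>)
    then have "push 0 {} (insert r ?P) (?P, ?W) =
      frag_extend (\<lambda>(P, W). frag_of (P \<union> P1, W \<union> W1)) (push 0 {} (insert r P2) (P2, W2))"
      by (simp add: Un_commute)
    then have "?t r = frag_cmul ((-1) ^ card P1) (frag_cmul (esign P2 r) (frag_cmul (shuffle_sign P1 (insert r P2))
       (frag_extend (\<lambda>(P, W). frag_of (P \<union> P1, W \<union> W1)) (push 0 {} (insert r P2) (P2, W2)))))"
      using shuffle_sign_insert(2)[OF fin disjP rn] by simp
    also have "frag_cmul (shuffle_sign P1 (insert r P2))
       (frag_extend (\<lambda>(P, W). frag_of (P \<union> P1, W \<union> W1)) (push 0 {} (insert r P2) (P2, W2))) =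
       frag_extend (\<lambda>g2. join ((P1, W1), g2)) (push 0 {} (insert r P2) (P2, W2))"
      unfolding extend_cmul_fun[symmetric]
    proof (rule extend_cong)
      show "push 0 {} (insert r P2) (P2, W2) \<in> frags (range (Pair (insert r P2)))"
        by (auto simp: push_def Let_def intro!: frags_cmul)
    qed (auto simp: join_def Un_commute)
    finally show ?thesis .
  qed
  have "U1 \<union> U2 - ?P = (U1 - P1) \<union> (U2 - P2)" using P disjU by auto
  then have "frag_extend (diff 0 (U1 \<union> U2) {}) (join g) = (\<Sum>r\<in>(U1 - P1) \<union> (U2 - P2). ?t r)"
    by (simp add: join_def frag_extend_cmul diff_def frag_cmul_sum)
  also have "\<dots> = (\<Sum>r\<in>U1 - P1. ?t r) + (\<Sum>r\<in>U2 - P2. ?t r)"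
    using finU disjU by (intro sum.union_disjoint) auto
  also have "(\<Sum>r\<in>U1 - P1. ?t r) = frag_extend join (act1 (diff 0 U1 {}) g)"
    using finU by (simp add: term1 act1_def diff_def extend_compose frag_extend_sum frag_extend_cmul)
  also have "(\<Sum>r\<in>U2 - P2. ?t r) = frag_extend join (twist (\<lambda>(P, W). (-1) ^ card P) (act2 (diff 0 U2 {})) g)"
    using finU by (simp add: term2 act2_def twist_def diff_def extend_compose frag_extend_sum frag_extend_cmul
        frag_cmul_sum[symmetric] del: frag_cmul_cmul)
  finally show ?thesis by (simp add: tensor_diff_def frag_extend_add)
qed

lemma torsion_disjoint_union:
  assumes t: "torsion_exponent_2 G1 (diff 0 U1 {})" "torsion_exponent_2 G2 (diff 0 U2 {})"
  shows "torsion_exponent_2 G (diff 0 (U1 \<union> U2) {})"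
proof -
  let ?\<tau> = "\<lambda>(P, W). (-1 :: int) ^ card P"
  let ?T = "tensor_diff ?\<tau> (diff 0 U1 {}) (diff 0 U2 {})"
  have cl1: "closed U1 V1" "closed U2 V2" using cl closed_mono by blast+
  have fing: "finite (gens V' {} U' {})" if "finite V'" "finite U'" for V' U'
    by (rule finite_subset[of _ "Pow U' \<times> Pow V'"]) (use that in \<open>auto simp: gens_def\<close>)
  have tt: "torsion_exponent_2 (G1 \<times> G2) ?T"
  proof (rule torsion_tensor[OF fing[OF finV(1) finU(1)] fing[OF finV(2) finU(2)] _ _ _ _ _ t])
    show "frag_extend (diff 0 U1 {}) (diff 0 U1 {} g) = 0" if "g \<in> G1" for g
      by (rule diff_square[OF finV(1) finU(1) cl1(1) that])
    show "frag_extend (diff 0 U2 {}) (diff 0 U2 {} g) = 0" if "g \<in> G2" for g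
      by (rule diff_square[OF finV(2) finU(2) cl1(2) that])
    show "diff 0 U2 {} g \<in> frags G2" if "g \<in> G2" for g
      by (rule diff_in_gens[OF finV(2) finU(2) cl1(2) that])
    show "diff 0 U1 {} g \<in> frags {g' \<in> G1. ?\<tau> g' = - ?\<tau> g}" if "g \<in> G1" for g
      by (rule frags_mono[OF diff_deg[OF finV(1) finU(1) cl1(1) that]]) (auto split: prod.splits)
  qed (auto split: prod.splits simp flip: power_add mult_2)
  show ?thesis
    unfolding torsion_exponent_2_def
  proof (intro allI impI)
    fix n z w assume n: "0 < (n::int)" and z: "z \<in> frags G" and w: "w \<in> frags G"
      and eq: "frag_cmul n z = frag_extend (diff 0 (U1 \<union> U2) {}) w"
    let ?j = "frag_extend join" and ?u = "frag_extend unjoin"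
    have ju: "?j (?u x) = x" if "x \<in> frags G" for x
      unfolding extend_compose using that join_unjoin by (rule extend_id)
    have uj: "?u (?j x) = x" if "x \<in> frags (G1 \<times> G2)" for x
      unfolding extend_compose using that unjoin_join by (rule extend_id)
    have jd: "frag_extend (diff 0 (U1 \<union> U2) {}) (?j x) = ?j (frag_extend ?T x)" if "x \<in> frags (G1 \<times> G2)" for x
      unfolding extend_compose using that join_diff by (rule extend_cong)
    have uin: "?u x \<in> frags (G1 \<times> G2)" if "x \<in> frags G" for x using that unjoin_in by (rule frags_extend)
    have jin: "?j x \<in> frags G" if "x \<in> frags (G1 \<times> G2)" for x using that join_in by (rule frags_extend)
    have Tin: "frag_extend ?T x \<in> frags (G1 \<times> G2)" if "x \<in> frags (G1 \<times> G2)" for x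
      using that
    proof (rule frags_extend)
      fix g assume "g \<in> G1 \<times> G2"
      then show "?T g \<in> frags (G1 \<times> G2)"
        using diff_in_gens[OF finV(1) finU(1) cl1(1)] diff_in_gens[OF finV(2) finU(2) cl1(2)]
        by (cases g) (auto simp: tensor_diff_def twist_def intro!: frags_add frags_cmul act1_in act2_in)
    qed
    have "frag_cmul n (?u z) = ?u (frag_extend (diff 0 (U1 \<union> U2) {}) w)"
      unfolding eq[symmetric] frag_extend_cmul ..
    also have "\<dots> = ?u (?j (frag_extend ?T (?u w)))" using jd[OF uin[OF w]] ju[OF w] by simp
    also have "\<dots> = frag_extend ?T (?u w)" by (rule uj[OF Tin[OF uin[OF w]]])
    finally have "\<exists>y\<in>frags (G1 \<times> G2). frag_cmul 2 (?u z) = frag_extend ?T y"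
      using tt n uin[OF z] uin[OF w] unfolding torsion_exponent_2_def by blast
    then obtain y where y: "y \<in> frags (G1 \<times> G2)" "frag_cmul 2 (?u z) = frag_extend ?T y" by blast
    have "frag_cmul 2 z = ?j (frag_cmul 2 (?u z))" unfolding frag_extend_cmul ju[OF z] ..
    also have "\<dots> = frag_extend (diff 0 (U1 \<union> U2) {}) (?j y)" unfolding y(2) jd[OF y(1)] ..
    finally show "\<exists>y\<in>frags G. frag_cmul 2 z = frag_extend (diff 0 (U1 \<union> U2) {}) y" using jin[OF y(1)] by blast
  qed
qed

end

text \<open>The connected component of a vertex is split off as a tensor factor, and the rest has
  fewer vertices.\<close>

theorem torsion_graph:
  assumes "finite V" "finite U" "closed U V" "\<And>r. r \<in> U \<Longrightarrow> a r \<in> V \<and> b r \<in> V"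
  shows "torsion_exponent_2 (gens V {} U {}) (diff 0 U {})"
  using assms
proof (induction "card V" arbitrary: V U rule: less_induct)
  case less
  note fin = less.prems(1,2) and V = less.prems(3) and ends = less.prems(4)
  show ?case
  proof (cases "V = {}")
    case True
    then have "U = {}" using ends by blast
    have "frag_extend (diff 0 U {}) w = 0" for w
      by (rule extend_eq_0[of w UNIV]) (auto simp: frags_def diff_def \<open>U = {}\<close>)
    then show ?thesis by (auto simp: torsion_exponent_2_def intro!: bexI[of _ 0])
  next
    case False
    then obtain v where v: "v \<in> V" by blast
    define V2 where "V2 = eq U `` {v}"
    define V1 where "V1 = V - V2"
    define U2 where "U2 = {r \<in> U. a r \<in> V2}"
    define U1 where "U1 = U - U2"
    have V2: "V2 \<subseteq> V" unfolding V2_def by (rule Image_subset[OF V]) (use v in simp)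
    have cl2: "closed U V2" unfolding V2_def by (rule closed_Image)
    have cl1: "closed U V1" unfolding V1_def by (rule closed_Diff[OF V cl2])
    have UU: "U = U1 \<union> U2" "U1 \<inter> U2 = {}" by (auto simp: U1_def U2_def)
    have VV: "V = V1 \<union> V2" "V1 \<inter> V2 = {}" using V2 by (auto simp: V1_def)
    have fins: "finite V1" "finite V2" "finite U1" "finite U2" using fin VV(1) UU(1) by auto
    have ab: "a r \<in> V' \<longleftrightarrow> b r \<in> V'" if "r \<in> U" "closed U V'" for r V'
      using closedD[OF that(2) eq_edge[OF that(1)]] .
    have ends1: "a r \<in> V1 \<and> b r \<in> V1" if "r \<in> U1" for r
      using that ends ab[OF _ cl1] by (auto simp: U1_def U2_def V1_def)
    have ends2: "a r \<in> V2 \<and> b r \<in> V2" if "r \<in> U2" for r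
      using that ab[OF _ cl2] by (auto simp: U2_def)
    have c: "closed U1 V1" "closed U2 V2" using cl1 cl2 UU(1) closed_mono by blast+
    have "v \<in> V2" by (simp add: V2_def)
    have "card V1 < card V"
      using fin(1) v \<open>v \<in> V2\<close> by (intro psubset_card_mono) (auto simp: V1_def)
    then have t1: "torsion_exponent_2 (gens V1 {} U1 {}) (diff 0 U1 {})"
      using less.hyps[OF _ fins(1,3) c(1) ends1] by blast
    have conn: "(x, v) \<in> eq U2" if "x \<in> V2" for x
    proof -
      have "(v, x) \<in> eq U" using that by (simp add: V2_def)
      then have "(v, x) \<in> eq U2"
      proof (subst (asm) eq_restrict[OF cl2 \<open>v \<in> V2\<close>, of U2])
        show "U2 \<subseteq> U" by (auto simp: U2_def)
        show "a r \<notin> V2" if "r \<in> U - U2" for r using that by (simp add: U2_def)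
      qed
      then show ?thesis by (rule eq_sym)
    qed
    have t2: "torsion_exponent_2 (gens V2 {} U2 {}) (diff 0 U2 {})"
      unfolding torsion_exponent_2_def
      using torsion_connected[OF fins(2,4) c(2) \<open>v \<in> V2\<close> ends2 conn] by blast
    show ?thesis
      unfolding VV(1) UU(1)
      by (rule torsion_disjoint_union[OF fins VV(2) UU(2) _ _ _ _ t1 t2])
         (use cl1 cl2 UU(1) ends1 ends2 in auto)
  qed
qed

end

section \<open>Kauffman states with few B-resolutions\<close>

definition resolution :: "'a diagram \<Rightarrow> nat set \<Rightarrow> nat \<Rightarrow> ('a \<times> 'a) set" where
  "resolution D I r = (if r \<in> I then B_resolution (crossings D ! r) else A_resolution (crossings D ! r))"

definition equivcl :: "('b \<times> 'b) set \<Rightarrow> ('b \<times> 'b) set" where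
  "equivcl R = (R \<union> R\<inverse>)\<^sup>*"

lemma equivcl_refl [simp]: "(x, x) \<in> equivcl R"
  by (simp add: equivcl_def)

lemma equivcl_trans: "(x, y) \<in> equivcl R \<Longrightarrow> (y, z) \<in> equivcl R \<Longrightarrow> (x, z) \<in> equivcl R"
  by (simp add: equivcl_def)

lemma equivcl_sym: "(x, y) \<in> equivcl R \<Longrightarrow> (y, x) \<in> equivcl R"
  unfolding equivcl_def by (rule symD[OF sym_rtrancl[OF sym_Un_converse]])

lemma equivcl_incl: "R \<subseteq> equivcl R"
  by (auto simp: equivcl_def)

lemma equivcl_least: "R \<subseteq> equivcl S \<Longrightarrow> equivcl R \<subseteq> equivcl S"
proof -
  assume "R \<subseteq> equivcl S"
  then have "R \<union> R\<inverse> \<subseteq> equivcl S" using equivcl_sym[of _ _ S] by blast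
  then have "(R \<union> R\<inverse>)\<^sup>* \<subseteq> (equivcl S)\<^sup>*" by (rule rtrancl_mono)
  then show ?thesis by (simp add: equivcl_def)
qed

lemma generated_classes_eq:
  assumes "\<And>x y. (x, y) \<in> R \<Longrightarrow> x \<in> A \<longleftrightarrow> y \<in> A"
  shows "generated_classes A R = A // equivcl R"
proof -
  have "y \<in> A" if "(x, y) \<in> (R \<union> R\<inverse>)\<^sup>*" "x \<in> A" for x y
    using that by (induction rule: rtrancl_induct) (use assms in auto)
  then have "((R \<union> R\<inverse>)\<^sup>* \<inter> A \<times> A) `` {x} = equivcl R `` {x}" if "x \<in> A" for x
    using that by (auto simp: equivcl_def)
  then show ?thesis unfolding generated_classes_def quotient_def by (intro SUP_cong) auto
qed

locale link =
  fixes D :: "'a diagram"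
  assumes link: "link_diagram D"

text \<open>Arcs serve as vertices and are identified from the start along the circles of the all-A
  state. The trace of a crossing becomes an edge from \<open>under_in\<close> to
  \<open>under_out\<close>, so the components for the empty edge set are the vertices of the state
  graph.\<close>

sublocale link \<subseteq> graph "\<Union>r<num_crossings D. A_resolution (crossings D ! r)"
  "\<lambda>r. under_in (crossings D ! r)" "\<lambda>r. under_out (crossings D ! r)" .

context link
begin

abbreviation "xing r \<equiv> crossings D ! r"
abbreviation "X \<equiv> {..<num_crossings D}"

definition states :: "nat set \<Rightarrow> ('a \<times> 'a) set" where
  "states I = equivcl (\<Union>r<num_crossings D. resolution D I r)"

lemma finite_arcs: "finite (arcs D)"
  using link by (simp add: link_diagram_def)

lemma crossing_arcs:
  assumes "r \<in> X"
  shows "under_in (xing r) \<in> arcs D" "under_out (xing r) \<in> arcs D" "left (xing r) \<in> arcs D" "right (xing r) \<in> arcs D"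
proof -
  have c: "xing r \<in> set (crossings D)" using assms by (simp add: num_crossings_def)
  have "set (incoming (xing r)) \<subseteq> arcs D" "set (outgoing (xing r)) \<subseteq> arcs D"
    using c link by (auto simp: link_diagram_def)
  then show "under_in (xing r) \<in> arcs D" "under_out (xing r) \<in> arcs D" "left (xing r) \<in> arcs D" "right (xing r) \<in> arcs D"
    by (auto simp: incoming_def outgoing_def split: if_splits)
qed

lemma components_states: "components D I = arcs D // states I"
proof -
  have "components D I = generated_classes (arcs D) (\<Union>r<num_crossings D. resolution D I r)"
    by (simp add: components_def resolution_def)
  also have "\<dots> = arcs D // states I"
    unfolding states_def
    by (rule generated_classes_eq) (auto simp: resolution_def A_resolution_def B_resolution_def crossing_arcs split: if_splits)
  finally show ?thesis .
qed

lemma eq_equivcl: "eq P = equivcl (gen P)"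
  by (simp add: eq_def equivcl_def)

definition ends_in :: "'a set \<Rightarrow> 'a list \<Rightarrow> nat" where
  "ends_in S l = length (filter (\<lambda>x. x \<in> S) l)"

text \<open>Every arc has two ends, and the resolved crossings pair up the arc ends.\<close>

lemma even_ends:
  assumes r: "r \<in> X" and S: "\<And>s x y. s \<in> X \<Longrightarrow> s \<noteq> r \<Longrightarrow> (x, y) \<in> resolution D I s \<Longrightarrow> x \<in> S \<longleftrightarrow> y \<in> S"
  shows "even (ends_in S [under_in (xing r), right (xing r), under_out (xing r), left (xing r)])"
proof -
  let ?ends = "\<lambda>c. [under_in c, right c, under_out c, left c]"
  have app: "ends_in S (l @ l') = ends_in S l + ends_in S l'" for l l' by (simp add: ends_in_def)
  have concat: "ends_in S (concat (map f xs)) = (\<Sum>s<length xs. ends_in S (f (xs ! s)))"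
    for f :: "'a crossing \<Rightarrow> 'a list" and xs
  proof (induction xs rule: rev_induct)
    case Nil
    then show ?case by (simp add: ends_in_def)
  next
    case (snoc x xs)
    have "(\<Sum>s<length xs. ends_in S (f ((xs @ [x]) ! s))) = (\<Sum>s<length xs. ends_in S (f (xs ! s)))"
      by (rule sum.cong) (auto simp: nth_append)
    then show ?case using snoc by (simp add: app)
  qed
  have dist: "ends_in S l = card (S \<inter> set l)" if "distinct l" for l
  proof -
    have "length (filter (\<lambda>x. x \<in> S) l) = card (set (filter (\<lambda>x. x \<in> S) l))"
      using that by (intro distinct_card[symmetric]) simp
    also have "set (filter (\<lambda>x. x \<in> S) l) = S \<inter> set l" by auto
    finally show ?thesis by (simp add: ends_in_def)
  qed
  \<comment> \<open>Grouped by direction: an arc that meets crossings occurs once as incoming and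
    once as outgoing.\<close>
  have "(\<Sum>s\<in>X. ends_in S (?ends (xing s))) = (\<Sum>s\<in>X. ends_in S (incoming (xing s))) + (\<Sum>s\<in>X. ends_in S (outgoing (xing s)))"
    unfolding sum.distrib[symmetric]
    by (rule sum.cong) (auto simp: ends_in_def incoming_def outgoing_def)
  also have "\<dots> = ends_in S (concat (map incoming (crossings D))) + ends_in S (concat (map outgoing (crossings D)))"
    by (simp add: concat num_crossings_def)
  also have "\<dots> = 2 * card (S \<inter> set (concat (map incoming (crossings D))))"
  proof -
    have "distinct (concat (map incoming (crossings D)))" "distinct (concat (map outgoing (crossings D)))"
      "set (concat (map outgoing (crossings D))) = set (concat (map incoming (crossings D)))"
      using link by (simp_all only: link_diagram_def)
    then show ?thesis by (simp only: dist mult_2)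
  qed
  finally have "even (\<Sum>s\<in>X. ends_in S (?ends (xing s)))" by simp
  moreover have "even (ends_in S (?ends (xing s)))" if "s \<in> X - {r}" for s
  proof (cases "s \<in> I")
    case True
    then have "right (xing s) \<in> S \<longleftrightarrow> under_out (xing s) \<in> S" "left (xing s) \<in> S \<longleftrightarrow> under_in (xing s) \<in> S"
      using S[of s] that by (auto simp: resolution_def B_resolution_def)
    then show ?thesis by (auto simp: ends_in_def)
  next
    case False
    then have "under_in (xing s) \<in> S \<longleftrightarrow> right (xing s) \<in> S" "under_out (xing s) \<in> S \<longleftrightarrow> left (xing s) \<in> S"
      using S[of s] that by (auto simp: resolution_def A_resolution_def)
    then show ?thesis by (auto simp: ends_in_def)
  qed
  then have "even (\<Sum>s\<in>X - {r}. ends_in S (?ends (xing s)))" by (rule dvd_sum)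
  moreover have "(\<Sum>s\<in>X. ends_in S (?ends (xing s))) = ends_in S (?ends (xing r)) + (\<Sum>s\<in>X - {r}. ends_in S (?ends (xing s)))"
    using r by (intro sum.remove) auto
  ultimately show ?thesis by (simp only: dvd_add_left_iff)
qed

text \<open>Acyclicity in the all-A state graph, expressed through connectivity; multiple edges and
  loops are excluded with it.\<close>

definition forest :: "nat set \<Rightarrow> bool" where
  "forest I \<longleftrightarrow> (\<forall>r\<in>I. (under_in (xing r), under_out (xing r)) \<notin> eq (I - {r}))"

lemma forest_subset: "forest I \<Longrightarrow> J \<subseteq> I \<Longrightarrow> forest J"
  unfolding forest_def using eq_mono[of "J - {r}" "I - {r}" for r] by blast

lemma states_empty: "states {} = eq {}"
  by (simp add: states_def eq_equivcl gen_def resolution_def)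

text \<open>In a forest the next trace joins two different circles. Each of them stays in one piece
  when cut open at the crossing, so the B-resolution reconnects the two pieces to a single circle;
  parity of arc ends shows that the pieces are what they should be.\<close>

lemma states_forest:
  assumes "finite I" "I \<subseteq> X" "forest I"
  shows "states I = eq I"
  using assms
proof (induction I rule: finite_induct)
  case empty
  show ?case by (rule states_empty)
next
  case (insert r I)
  let ?c = "xing r"
  have r: "r \<in> X" using insert by simp
  have IH: "states I = eq I" using insert forest_subset by blast
  have nab: "(under_in ?c, under_out ?c) \<notin> eq I"
    using insert.prems(2) insert.hyps(2) by (auto simp: forest_def)
  define Rm where "Rm = (\<Union>s\<in>X - {r}. resolution D I s)"
  have Rm': "(\<Union>s\<in>X - {r}. resolution D (insert r I) s) = Rm" by (auto simp: Rm_def resolution_def)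
  have dec: "(\<Union>s<num_crossings D. resolution D J s) = (\<Union>s\<in>X - {r}. resolution D J s) \<union> resolution D J r" for J
    using r by blast
  have A: "states I = equivcl (Rm \<union> A_resolution ?c)"
    unfolding states_def dec Rm_def using insert.hyps(2) by (simp add: resolution_def)
  have B: "states (insert r I) = equivcl (Rm \<union> B_resolution ?c)"
    unfolding states_def dec Rm' by (simp add: resolution_def)
  have Rm_A: "equivcl Rm \<subseteq> states I" unfolding A by (rule equivcl_least) (use equivcl_incl in blast)
  have Rm_B: "equivcl Rm \<subseteq> states (insert r I)" unfolding B by (rule equivcl_least) (use equivcl_incl in blast)
  have ur: "(under_in ?c, right ?c) \<in> states I" "(under_out ?c, left ?c) \<in> states I"
    unfolding A using equivcl_incl[of "Rm \<union> A_resolution ?c"] by (auto simp: A_resolution_def)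
  have ur': "(right ?c, under_out ?c) \<in> states (insert r I)" "(left ?c, under_in ?c) \<in> states (insert r I)"
    unfolding B using equivcl_incl[of "Rm \<union> B_resolution ?c"] by (auto simp: B_resolution_def)
  have st: "\<And>x y. (x, y) \<in> states J \<Longrightarrow> (y, x) \<in> states J"
     "\<And>x y z. (x, y) \<in> states J \<Longrightarrow> (y, z) \<in> states J \<Longrightarrow> (x, z) \<in> states J" for J
    unfolding states_def by (blast intro: equivcl_sym equivcl_trans)+
  have sep: "(under_in ?c, under_out ?c) \<notin> states I" using nab IH by simp
  \<comment> \<open>The classes of \<open>Rm\<close> are the parts of the state after the crossing
    \<open>r\<close> is cut open.\<close>
  have even: "even (ends_in (equivcl Rm `` {x}) [under_in ?c, right ?c, under_out ?c, left ?c])" for x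
  proof (rule even_ends[OF r, of I])
    fix s y z assume "s \<in> X" "s \<noteq> r" "(y, z) \<in> resolution D I s"
    then have "(y, z) \<in> equivcl Rm" using equivcl_incl[of Rm] by (auto simp: Rm_def)
    then show "y \<in> equivcl Rm `` {x} \<longleftrightarrow> z \<in> equivcl Rm `` {x}"
      using equivcl_sym equivcl_trans by (metis Image_singleton_iff)
  qed
  \<comment> \<open>Otherwise \<open>under_in\<close> would be the only end at \<open>r\<close> in
    its class, since the other two ends lie on a different circle.\<close>
  have 1: "(under_in ?c, right ?c) \<in> equivcl Rm"
  proof (rule ccontr)
    assume n: "(under_in ?c, right ?c) \<notin> equivcl Rm"
    have "(under_in ?c, under_out ?c) \<notin> equivcl Rm" "(under_in ?c, left ?c) \<notin> equivcl Rm"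
      using sep Rm_A st ur by blast+
    then show False using even[of "under_in ?c"] n by (simp add: ends_in_def)
  qed
  have 2: "(under_out ?c, left ?c) \<in> equivcl Rm"
  proof (rule ccontr)
    assume n: "(under_out ?c, left ?c) \<notin> equivcl Rm"
    have "(under_out ?c, under_in ?c) \<notin> equivcl Rm" "(under_out ?c, right ?c) \<notin> equivcl Rm"
      using sep Rm_A st ur by blast+
    then show False using even[of "under_out ?c"] n by (simp add: ends_in_def)
  qed
  have I_sub: "eq I \<subseteq> states (insert r I)"
    unfolding IH[symmetric] unfolding A B
  proof (rule equivcl_least)
    show "Rm \<union> A_resolution ?c \<subseteq> equivcl (Rm \<union> B_resolution ?c)"
      unfolding B[symmetric] using 1 2 Rm_B equivcl_incl[of Rm] by (auto simp: A_resolution_def)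
  qed
  show ?case
  proof (rule equalityI)
    show "states (insert r I) \<subseteq> eq (insert r I)"
      unfolding B eq_equivcl[of "insert r I"]
    proof (rule equivcl_least)
      have m: "eq I \<subseteq> eq (insert r I)" using eq_mono[of I "insert r I"] by auto
      have "Rm \<subseteq> eq (insert r I)" using equivcl_incl[of Rm] Rm_A IH m by blast
      moreover have "(under_in ?c, under_out ?c) \<in> eq (insert r I)" using eq_edge[of r "insert r I"] by simp
      then have "B_resolution ?c \<subseteq> eq (insert r I)"
        using ur IH m eq_sym eq_trans unfolding B_resolution_def by blast
      ultimately show "Rm \<union> B_resolution ?c \<subseteq> equivcl (gen (insert r I))" unfolding eq_equivcl by blast
    qed
    show "eq (insert r I) \<subseteq> states (insert r I)"
    proof -
      have "(under_in ?c, right ?c) \<in> states (insert r I)" using 1 Rm_B by blast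
      then have "(under_in ?c, under_out ?c) \<in> states (insert r I)" using ur'(1) st(2) by blast
      moreover have "gen I \<subseteq> eq I" unfolding eq_equivcl by (rule equivcl_incl)
      ultimately have "gen (insert r I) \<subseteq> equivcl (Rm \<union> B_resolution ?c)"
        using I_sub unfolding B[symmetric] by (auto simp: gen_def)
      then show ?thesis unfolding eq_equivcl[of "insert r I"] B by (rule equivcl_least)
    qed
  qed
qed

lemma components_forest: "I \<subseteq> X \<Longrightarrow> forest I \<Longrightarrow> components D I = arcs D // eq I"
  using components_states states_forest finite_subset by (metis finite_lessThan)

section \<open>Girth\<close>

lemma closed_arcs: "I \<subseteq> X \<Longrightarrow> closed I (arcs D)"
  by (rule closedI) (auto simp: graph.gen_def A_resolution_def crossing_arcs)

lemma endpoints_classes: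
  assumes "r \<in> X"
  shows "endpoints (A_state_graph D) r = {eq {} `` {under_in (xing r)}, eq {} `` {under_out (xing r)}}"
proof -
  have c: "components D {} = arcs D // eq {}" using components_states states_empty by simp
  have "K = eq {} `` {x}" if K: "K \<in> arcs D // eq {}" "x \<in> K" for K x
  proof -
    obtain y where "K = eq {} `` {y}" using K(1) by (rule quotientE)
    then show ?thesis using K(2) eq_classI[of y x "{}"] by simp
  qed
  moreover have "eq {} `` {x} \<in> arcs D // eq {}" if "x \<in> arcs D" for x using that by (rule quotientI)
  ultimately show ?thesis
    using crossing_arcs[OF assms] by (auto simp: A_state_graph_def c)
qed

text \<open>A simple path in the state graph. That its vertices meet the component of
  \<open>x\<close> is recorded so that paths in different components are disjoint when an edge joins
  them.\<close>

definition is_path :: "nat set \<Rightarrow> 'a \<Rightarrow> 'a \<Rightarrow> 'a set list \<Rightarrow> nat list \<Rightarrow> bool" where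
  "is_path I x y vs es \<longleftrightarrow> length vs = Suc (length es) \<and> distinct vs \<and> distinct es \<and> set es \<subseteq> I \<and>
     set vs \<subseteq> (\<lambda>u. eq {} `` {u}) ` (arcs D \<inter> eq I `` {x}) \<and> vs ! 0 = eq {} `` {x} \<and> vs ! length es = eq {} `` {y} \<and>
     (\<forall>t<length es. endpoints (A_state_graph D) (es ! t) = {vs ! t, vs ! Suc t})"

lemma is_pathD:
  assumes "is_path I x y vs es"
  shows "length vs = Suc (length es)" "distinct vs" "distinct es" "set es \<subseteq> I"
    "set vs \<subseteq> (\<lambda>u. eq {} `` {u}) ` (arcs D \<inter> eq I `` {x})" "vs ! 0 = eq {} `` {x}"
    "vs ! length es = eq {} `` {y}"
    "\<forall>t<length es. endpoints (A_state_graph D) (es ! t) = {vs ! t, vs ! Suc t}"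
  using assms by (auto simp: is_path_def)

text \<open>If \<open>x\<close> and \<open>y\<close> are connected only through \<open>r\<close>,
  the paths before and after \<open>r\<close> run in different components for \<open>I\<close>, so
  their concatenation is again simple.\<close>

lemma path_exists:
  assumes "finite I" "I \<subseteq> X" "(x, y) \<in> eq I" "x \<in> arcs D"
  shows "\<exists>vs es. is_path I x y vs es"
  using assms
proof (induction I arbitrary: x y rule: finite_induct)
  case empty
  then show ?case
    by (intro exI[of _ "[eq {} `` {x}]"] exI[of _ "[]"]) (auto simp: is_path_def intro!: eq_classI)
next
  case (insert r I)
  have mono: "eq I `` {x} \<subseteq> eq (insert r I) `` {x}" using eq_mono[of I "insert r I"] by auto
  have IX: "I \<subseteq> X" and r: "r \<in> X" using insert.prems by auto
  show ?case
  proof (cases "(x, y) \<in> eq I")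
    case True
    from insert.IH[OF IX True insert.prems(3)] obtain vs es where p: "is_path I x y vs es" by blast
    have "(\<lambda>u. eq {} `` {u}) ` (arcs D \<inter> eq I `` {x}) \<subseteq> (\<lambda>u. eq {} `` {u}) ` (arcs D \<inter> eq (insert r I) `` {x})"
      using mono by (intro image_mono Int_mono order_refl)
    then have "is_path (insert r I) x y vs es"
      using is_pathD[OF p] unfolding is_path_def by (simp add: subset_insertI2)
    then show ?thesis by blast
  next
    case False
    obtain p q where pq: "(x, p) \<in> eq I" "(q, y) \<in> eq I"
      "(p = under_in (xing r) \<and> q = under_out (xing r)) \<or> (p = under_out (xing r) \<and> q = under_in (xing r))"
      using insert.prems(2) False unfolding eq_insert_iff by blast
    have parcs: "q \<in> arcs D" using pq(3) crossing_arcs[OF r] by blast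
    obtain vs es where "is_path I x p vs es"
      using insert.IH[OF IX pq(1) insert.prems(3)] by blast
    note 1 = is_pathD[OF this]
    obtain vs' es' where "is_path I q y vs' es'"
      using insert.IH[OF IX pq(2) parcs] by blast
    note 2 = is_pathD[OF this]
    have xq: "(x, q) \<notin> eq I" using False pq(2) eq_trans by blast
    have disjv: "set vs \<inter> set vs' = {}"
    proof (rule ccontr)
      assume "set vs \<inter> set vs' \<noteq> {}"
      then obtain u u' where "(x, u) \<in> eq I" "(q, u') \<in> eq I" "eq {} `` {u} = eq {} `` {u'}" using 1(5) 2(5) by blast
      then have "(u, u') \<in> eq I" using eq_class_iff eq_mono[of "{}" I] by blast
      then show False using xq \<open>(x, u) \<in> eq I\<close> \<open>(q, u') \<in> eq I\<close> eq_trans eq_sym by blast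
    qed
    have disje: "set es \<inter> set es' = {}"
    proof (rule ccontr)
      assume "set es \<inter> set es' \<noteq> {}"
      then obtain e where "e \<in> set es" "e \<in> set es'" by blast
      then obtain t t' where t: "t < length es" "es ! t = e" "t' < length es'" "es' ! t' = e" by (metis in_set_conv_nth)
      then have "{vs ! t, vs ! Suc t} = {vs' ! t', vs' ! Suc t'}" using 1(8) 2(8) by metis
      then have "vs ! t \<in> {vs' ! t', vs' ! Suc t'}" by blast
      moreover have "vs ! t \<in> set vs" "vs' ! t' \<in> set vs'" "vs' ! Suc t' \<in> set vs'" using t 1(1) 2(1) by simp_all
      ultimately show False using disjv by (metis disjoint_iff insert_iff singletonD)
    qed
    let ?vs = "vs @ vs'" and ?es = "es @ r # es'"
    have "endpoints (A_state_graph D) (?es ! t) = {?vs ! t, ?vs ! Suc t}" if t: "t < length ?es" for t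
    proof -
      consider "t < length es" | "t = length es" | s where "t = Suc (length es + s)" "s < length es'"
        using t by (cases "t < length es"; cases "t = length es") (auto dest!: less_imp_Suc_add simp: not_less_iff_gr_or_eq)
      then show ?thesis
      proof cases
        case 1
        then show ?thesis using \<open>\<forall>t<length es. endpoints (A_state_graph D) (es ! t) = {vs ! t, vs ! Suc t}\<close> \<open>length vs = Suc (length es)\<close>
          by (simp add: nth_append)
      next
        case 2
        then show ?thesis
          using endpoints_classes[OF r] pq(3) \<open>vs ! length es = eq {} `` {p}\<close> \<open>vs' ! 0 = eq {} `` {q}\<close> \<open>length vs = Suc (length es)\<close>
          by (auto simp: nth_append)
      next
        case 3
        then show ?thesis using 2(8) 1(1) by (simp add: nth_append)
      qed
    qed
    moreover have "set ?vs \<subseteq> (\<lambda>u. eq {} `` {u}) ` (arcs D \<inter> eq (insert r I) `` {x})"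
    proof -
      have "(x, q) \<in> eq (insert r I)"
        using pq by (auto simp: eq_insert_iff)
      then have "eq I `` {q} \<subseteq> eq (insert r I) `` {x}" using eq_mono[of I "insert r I"] eq_trans by blast
      then have "(\<lambda>u. eq {} `` {u}) ` (arcs D \<inter> eq I `` {q}) \<subseteq> (\<lambda>u. eq {} `` {u}) ` (arcs D \<inter> eq (insert r I) `` {x})"
        by (intro image_mono Int_mono order_refl)
      moreover have "(\<lambda>u. eq {} `` {u}) ` (arcs D \<inter> eq I `` {x}) \<subseteq> (\<lambda>u. eq {} `` {u}) ` (arcs D \<inter> eq (insert r I) `` {x})"
        by (intro image_mono Int_mono order_refl mono)
      ultimately show ?thesis using 1(5) 2(5) unfolding set_append by (intro Un_least) (rule order_trans, assumption, assumption)+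
    qed
    moreover have "?vs ! 0 = eq {} `` {x}" "?vs ! length ?es = eq {} `` {y}"
      using 1(1,6) 2(7) by (simp_all add: nth_append)
    ultimately show ?thesis
      using 1 2 disjv disje insert.hyps(2)
      by (intro exI[of _ ?vs] exI[of _ ?es]) (auto simp: is_path_def)
  qed
qed

text \<open>A path in the other edges between the ends of \<open>r\<close>, closed up by
  \<open>r\<close>, is a cycle with at most \<open>card I\<close> edges. The path of length zero
  yields a loop.\<close>

lemma forest_girth:
  assumes I: "I \<subseteq> X" and g: "enat (card I) < girth (A_state_graph D)"
  shows "forest I"
  unfolding forest_def
proof (rule ballI, rule notI)
  fix r assume r: "r \<in> I" and conn: "(under_in (xing r), under_out (xing r)) \<in> eq (I - {r})"
  have rX: "r \<in> X" using r I by blast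
  have fin: "finite I" using I finite_subset by blast
  have "finite (I - {r})" "I - {r} \<subseteq> X" using fin I by auto
  from path_exists[OF this conn crossing_arcs(1)[OF rX]]
  obtain vs es where "is_path (I - {r}) (under_in (xing r)) (under_out (xing r)) vs es" by blast
  note p = is_pathD[OF this]
  have "is_cycle (A_state_graph D) vs (es @ [r])"
    unfolding is_cycle_def
  proof (intro conjI allI impI)
    show "set vs \<subseteq> vertices (A_state_graph D)"
      using p(5) components_states[of "{}"] states_empty by (auto simp: A_state_graph_def intro: quotientI)
    show "set (es @ [r]) \<subseteq> edges (A_state_graph D)" using p(4) I rX by (auto simp: A_state_graph_def)
    fix t assume t: "t < length (es @ [r])"
    show "endpoints (A_state_graph D) ((es @ [r]) ! t) = {vs ! t, vs ! ((t + 1) mod length (es @ [r]))}"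
    proof (cases "t < length es")
      case True
      then show ?thesis using p(8) by (simp add: nth_append)
    next
      case False
      then have "t = length es" using t by simp
      then show ?thesis using endpoints_classes[OF rX] p(6,7) by auto
    qed
  qed (use p in auto)
  then have "girth (A_state_graph D) \<le> enat (length (es @ [r]))"
    unfolding girth_def by (intro Inf_lower) blast
  moreover have "length es \<le> card (I - {r})"
    using p(3,4) fin by (metis card_mono distinct_card finite_Diff)
  moreover have "Suc (card (I - {r})) = card I" by (rule card_Suc_Diff1[OF fin r])
  ultimately have "girth (A_state_graph D) \<le> enat (card I)" by (metis Suc_le_mono enat_ord_simps(1) length_append_singleton order_trans)
  then show False using g by simp
qed

end

section \<open>Comparison with the Khovanov complex\<close>

context link
begin

text \<open>Passes from labelled circles to the encoding by unions. For forests the circles are the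
  classes of \<open>eq I\<close>, and the labels can be recovered from the union.\<close>

definition flatten :: "'a generator \<Rightarrow> nat set \<times> 'a set" where
  "flatten = (\<lambda>(I, Y). (I, \<Union>Y))"

lemma class_Union:
  assumes "Y \<subseteq> arcs D // eq I"
  shows "x \<in> \<Union>Y \<longleftrightarrow> eq I `` {x} \<in> Y"
proof
  assume "x \<in> \<Union>Y"
  then obtain K where K: "K \<in> Y" "x \<in> K" by blast
  then obtain y where y: "K = eq I `` {y}" using assms by (blast elim: quotientE)
  then have "eq I `` {x} = K" using K eq_classI[of y x I] by simp
  then show "eq I `` {x} \<in> Y" using K by simp
next
  assume "eq I `` {x} \<in> Y"
  moreover have "x \<in> eq I `` {x}" by simp
  ultimately show "x \<in> \<Union>Y" by blast
qed

lemma Union_quotient: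
  assumes "Y \<subseteq> arcs D // eq I" "I \<subseteq> X"
  shows "\<Union>Y // eq I = Y" "closed I (\<Union>Y)" "\<Union>Y \<subseteq> arcs D"
proof -
  note m = class_Union[OF assms(1)]
  show "\<Union>Y // eq I = Y"
  proof (intro equalityI subsetI)
    fix K assume "K \<in> \<Union>Y // eq I"
    then obtain x where "x \<in> \<Union>Y" "K = eq I `` {x}" by (rule quotientE)
    then show "K \<in> Y" using m by blast
  next
    fix K assume K: "K \<in> Y"
    then obtain x where x: "K = eq I `` {x}" using assms(1) by (blast elim: quotientE)
    then have "x \<in> \<Union>Y" using K m by blast
    then show "K \<in> \<Union>Y // eq I" unfolding x by (rule quotientI)
  qed
  show "closed I (\<Union>Y)"
    unfolding closed_def
  proof (intro allI impI)
    fix x y assume "(x, y) \<in> eq I" "x \<in> \<Union>Y"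
    then show "y \<in> \<Union>Y" using m[of x] m[of y] eq_classI[of x y I] by simp
  qed
  show "\<Union>Y \<subseteq> arcs D"
  proof
    fix x assume "x \<in> \<Union>Y"
    then obtain K where "K \<in> arcs D // eq I" "x \<in> K" using assms(1) by blast
    then obtain y where "y \<in> arcs D" "(y, x) \<in> eq I" by (blast elim: quotientE)
    then show "x \<in> arcs D" using closedD[OF closed_arcs[OF assms(2)]] by blast
  qed
qed

text \<open>In a forest the two strands at \<open>r\<close> lie on different circles, so only the
  multiplication branch of \<open>edge_map\<close> occurs. Its cases of zero, one and two labels are
  those of \<open>push\<close> with t = 0.\<close>

lemma edge_map_push:
  assumes I: "I \<subseteq> X" and r: "r \<in> X - I" and forest: "forest (insert r I)" and Y: "Y \<subseteq> components D I"
  shows "frag_extend (frag_of \<circ> flatten) (edge_map D r (I, Y)) = push 0 {} (insert r I) (flatten (I, Y))"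
proof -
  let ?J = "insert r I" and ?a = "under_in (xing r)" and ?b = "under_out (xing r)"
  let ?Ka = "eq I `` {?a}" and ?Kb = "eq I `` {?b}" and ?W = "\<Union>Y"
  let ?C = "arcs D // eq I" and ?C' = "arcs D // eq ?J"
  have JX: "?J \<subseteq> X" using I r by auto
  have C: "components D I = ?C" "components D ?J = ?C'"
    using components_forest[OF I forest_subset[OF forest]] components_forest[OF JX forest] by auto
  have Y': "Y \<subseteq> ?C" using Y C by simp
  have nab: "(?a, ?b) \<notin> eq I" using forest r by (auto simp: forest_def)
  have ab: "?a \<in> arcs D" "?b \<in> arcs D" using crossing_arcs[of r] r by auto
  have neq: "?Ka \<noteq> ?Kb" using nab eq_class_iff by blast
  have Kab: "?a \<notin> ?Kb" "?b \<notin> ?Ka" using nab eq_sym by blast+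
  \<comment> \<open>Guarantees that the merged circle counts as new.\<close>
  have nC: "?Ka \<union> ?Kb \<notin> ?C"
  proof
    assume "?Ka \<union> ?Kb \<in> ?C"
    then obtain x where x: "?Ka \<union> ?Kb = eq I `` {x}" by (rule quotientE)
    have "?a \<in> eq I `` {x}" "?b \<in> eq I `` {x}" unfolding x[symmetric] by simp_all
    then have "(x, ?a) \<in> eq I" "(x, ?b) \<in> eq I" by simp_all
    then show False using nab eq_sym eq_trans by blast
  qed
  have cls: "eq ?J `` {x} = (if x \<in> ?Ka \<union> ?Kb then ?Ka \<union> ?Kb else eq I `` {x})" for x
  proof (cases "x \<in> ?Ka \<union> ?Kb")
    case True
    then have "(x, ?a) \<in> eq I \<or> (x, ?b) \<in> eq I" using eq_sym by blast
    then have "(x, y) \<in> eq ?J \<longleftrightarrow> y \<in> ?Ka \<union> ?Kb" for y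
      unfolding eq_insert_iff using eq_sym eq_trans by blast
    then show ?thesis using True by auto
  next
    case False
    then have "(x, ?a) \<notin> eq I" "(x, ?b) \<notin> eq I" using eq_sym by blast+
    then show ?thesis using False by (auto simp: eq_insert_iff)
  qed
  have C': "?C' = (?C - {?Ka, ?Kb}) \<union> {?Ka \<union> ?Kb}"
  proof (intro equalityI subsetI)
    fix K assume "K \<in> ?C'"
    then obtain x where x: "x \<in> arcs D" "K = eq ?J `` {x}" by (rule quotientE)
    show "K \<in> (?C - {?Ka, ?Kb}) \<union> {?Ka \<union> ?Kb}"
    proof (cases "x \<in> ?Ka \<union> ?Kb")
      case False
      then have "K = eq I `` {x}" "eq I `` {x} \<noteq> ?Ka" "eq I `` {x} \<noteq> ?Kb"
        using x cls eq_class_iff eq_sym by auto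
      then show ?thesis using x(1) by (simp add: quotientI)
    qed (use x cls in simp)
  next
    fix K assume "K \<in> (?C - {?Ka, ?Kb}) \<union> {?Ka \<union> ?Kb}"
    then consider "K \<in> ?C" "K \<noteq> ?Ka" "K \<noteq> ?Kb" | "K = ?Ka \<union> ?Kb" by blast
    then show "K \<in> ?C'"
    proof cases
      case 1
      then obtain x where x: "x \<in> arcs D" "K = eq I `` {x}" by (blast elim: quotientE)
      have "x \<notin> ?Ka" "x \<notin> ?Kb" using 1(2,3) x(2) eq_classI[of ?a x I] eq_classI[of ?b x I] by auto
      then have "x \<notin> ?Ka \<union> ?Kb" by blast
      then have "K = eq ?J `` {x}" using x cls[of x] by simp
      then show ?thesis using x(1) by (simp add: quotientI)
    next
      case 2
      then have "K = eq ?J `` {?a}" using cls[of ?a] by simp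
      then show ?thesis using ab(1) by (simp add: quotientI)
    qed
  qed
  have KC: "?Ka \<in> ?C" "?Kb \<in> ?C" using ab by (auto intro: quotientI)
  have "?b \<in> ?Ka \<union> ?Kb" "?a \<in> ?Ka \<union> ?Kb" by simp_all
  then have "?Ka \<union> ?Kb \<noteq> ?Ka" "?Ka \<union> ?Kb \<noteq> ?Kb" using Kab by metis+
  then have old: "?C - ?C' = {?Ka, ?Kb}" and new: "?C' - ?C = {?Ka \<union> ?Kb}"
    unfolding C' using KC nC by auto
  have em: "edge_map D r (I, Y) = (if card (Y \<inter> {?Ka, ?Kb}) = 0 then frag_of (?J, Y - {?Ka, ?Kb})
      else if card (Y \<inter> {?Ka, ?Kb}) = 1 then frag_of (?J, (Y - {?Ka, ?Kb}) \<union> {?Ka \<union> ?Kb}) else 0)"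
    unfolding edge_map_def prod.case Let_def C old new using neq by simp
  note UQ = Union_quotient[OF Y' I]
  have W: "finite ?W" "closed I ?W" using UQ finite_arcs finite_subset by auto
  have mem: "?a \<in> ?W \<longleftrightarrow> ?Ka \<in> Y" "?b \<in> ?W \<longleftrightarrow> ?Kb \<in> Y" using class_Union[OF Y'] by blast+
  have img: "eq ?J `` ?W = ?W \<union> (if ?Ka \<in> Y \<or> ?Kb \<in> Y then ?Ka \<union> ?Kb else {})"
  proof (cases "?Ka \<in> Y \<or> ?Kb \<in> Y")
    case True
    have "?a \<in> ?Ka \<union> ?Kb" "?b \<in> ?Ka \<union> ?Kb" by simp_all
    moreover have "?a \<in> ?W \<or> ?b \<in> ?W" unfolding mem using True .
    ultimately obtain x0 where x0: "x0 \<in> ?W" "x0 \<in> ?Ka \<union> ?Kb" by blast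
    have "eq ?J `` ?W = ?W \<union> (?Ka \<union> ?Kb)"
    proof (intro equalityI subsetI)
      fix y assume "y \<in> eq ?J `` ?W"
      then obtain x where x: "x \<in> ?W" "y \<in> eq ?J `` {x}" by blast
      show "y \<in> ?W \<union> (?Ka \<union> ?Kb)"
      proof (cases "x \<in> ?Ka \<union> ?Kb")
        case False
        then have "(x, y) \<in> eq I" using x(2) cls[of x] by simp
        then show ?thesis using x(1) closedD[OF W(2)] by blast
      qed (use x(2) cls[of x] in simp)
    next
      fix y assume "y \<in> ?W \<union> (?Ka \<union> ?Kb)"
      then consider "y \<in> ?W" | "y \<in> eq ?J `` {x0}" using cls[of x0] x0(2) by auto
      then show "y \<in> eq ?J `` ?W"
      proof cases
        case 1
        then show ?thesis using Image_superset[of ?W ?J] by blast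
      qed (use x0(1) in blast)
    qed
    then show ?thesis using True by simp
  next
    case False
    then have "closed ?J ?W" using W mem by (simp add: closed_insert)
    then show ?thesis using False by (simp add: Image_closed)
  qed
  show ?thesis
  proof (cases "?Ka \<in> Y \<and> ?Kb \<in> Y")
    case True
    then have "Y \<inter> {?Ka, ?Kb} = {?Ka, ?Kb}" by blast
    then have "edge_map D r (I, Y) = 0" unfolding em using neq by simp
    moreover have "ncomp ?J (eq ?J `` ?W) < ncomp I ?W"
      by (rule ncomp_insert_less[OF W]) (use True mem nab in auto)
    ultimately show ?thesis by (simp add: push_def flatten_def Let_def)
  next
    case False
    have "ncomp ?J (eq ?J `` ?W) = ncomp I ?W"
      by (rule ncomp_insert_same[OF W]) (use False mem in blast)
    then have p: "push 0 {} ?J (flatten (I, Y)) = frag_of (?J, eq ?J `` ?W)"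
      by (simp add: push_def flatten_def Let_def)
    show ?thesis
    proof (cases "?Ka \<in> Y \<or> ?Kb \<in> Y")
      case True
      have c1: "Y \<inter> {?Ka, ?Kb} = {?Ka} \<or> Y \<inter> {?Ka, ?Kb} = {?Kb}" using True False by blast
      then have "card (Y \<inter> {?Ka, ?Kb}) = 1" by auto
      then have "edge_map D r (I, Y) = frag_of (?J, (Y - {?Ka, ?Kb}) \<union> {?Ka \<union> ?Kb})" unfolding em by simp
      moreover have "\<Union>((Y - {?Ka, ?Kb}) \<union> {?Ka \<union> ?Kb}) = ?W \<union> (?Ka \<union> ?Kb)" using True by blast
      ultimately show ?thesis unfolding p using True img by (simp add: flatten_def)
    next
      case none: False
      then have "Y \<inter> {?Ka, ?Kb} = {}" "Y - {?Ka, ?Kb} = Y" by auto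
      then have "edge_map D r (I, Y) = frag_of (?J, Y)" unfolding em by simp
      then show ?thesis unfolding p using none img by (simp add: flatten_def)
    qed
  qed
qed

text \<open>The polynomial degree read off from classes: circles labelled 1 minus circles labelled
  \<open>x\<close> is the number of all circles minus twice the latter.\<close>

definition quantum :: "nat set \<times> 'a set \<Rightarrow> int" where
  "quantum = (\<lambda>(P, W). int (ncomp P (arcs D)) - 2 * int (ncomp P W) + int (card P)
     + int (pos_crossings D) - 2 * int (neg_crossings D))"

definition graded_gens :: "int \<Rightarrow> int \<Rightarrow> (nat set \<times> 'a set) set" where
  "graded_gens i j = {(P, W) \<in> gens (arcs D) {} X {}. int (card P) - int (neg_crossings D) = i \<and> quantum (P, W) = j}"

lemma finite_components: "I \<subseteq> X \<Longrightarrow> forest I \<Longrightarrow> finite (components D I)"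
  using components_forest finite_quotient_eq[OF finite_arcs] by metis

lemma flatten_bij:
  assumes forest: "\<And>I. I \<subseteq> X \<Longrightarrow> int (card I) - int (neg_crossings D) = i \<Longrightarrow> forest I"
  shows "bij_betw flatten (generators D i j) (graded_gens i j)"
proof -
  have poly: "poly_degree D (I, Y) = quantum (flatten (I, Y))"
    if I: "I \<subseteq> X" "forest I" and Y: "Y \<subseteq> components D I" for I Y
  proof -
    have C: "components D I = arcs D // eq I" by (rule components_forest[OF I])
    have fin: "finite (components D I)" by (rule finite_components[OF I])
    have "card (components D I - Y) = card (components D I) - card Y"
      using Y fin finite_subset by (intro card_Diff_subset) auto
    moreover have "card Y \<le> card (components D I)" using Y fin by (rule card_mono[rotated])
    moreover have "ncomp I (\<Union>Y) = card Y" "ncomp I (arcs D) = card (components D I)"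
      unfolding ncomp_def using Union_quotient(1)[OF _ I(1), of Y] Y C by simp_all
    ultimately show ?thesis by (simp add: poly_degree_def quantum_def flatten_def)
  qed
  show ?thesis
  proof (rule bij_betw_byWitness[where f' = "\<lambda>(P, W). (P, W // eq P)"])
    show "\<forall>g\<in>generators D i j. (\<lambda>(P, W). (P, W // eq P)) (flatten g) = g"
    proof
      fix g assume g: "g \<in> generators D i j"
      obtain I Y where [simp]: "g = (I, Y)" by (cases g)
      have I: "I \<subseteq> X" "forest I" "Y \<subseteq> components D I"
        using g forest by (auto simp: generators_def hom_degree_def)
      then have "\<Union>Y // eq I = Y" using Union_quotient(1)[OF _ I(1)] components_forest by simp
      then show "(\<lambda>(P, W). (P, W // eq P)) (flatten g) = g" by (simp add: flatten_def)
    qed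
    have UW: "\<Union>(W // eq P) = W" if "closed P W" for P W
    proof -
      have "\<Union>(W // eq P) = eq P `` W" by (auto simp: quotient_def)
      then show ?thesis using Image_closed[OF that] by simp
    qed
    show "\<forall>g\<in>graded_gens i j. flatten ((\<lambda>(P, W). (P, W // eq P)) g) = g"
      using UW by (auto simp: graded_gens_def gens_def flatten_def)
    show "flatten ` generators D i j \<subseteq> graded_gens i j"
    proof clarify
      fix I Y P W assume g: "(I, Y) \<in> generators D i j" and f: "(P, W) = flatten (I, Y)"
      have I: "I \<subseteq> X" "forest I" "Y \<subseteq> components D I" "int (card I) - int (neg_crossings D) = i" "poly_degree D (I, Y) = j"
        using g forest by (auto simp: generators_def hom_degree_def)
      then have "closed I (\<Union>Y)" "\<Union>Y \<subseteq> arcs D"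
        using Union_quotient[OF _ I(1), of Y] components_forest by auto
      then show "(P, W) \<in> graded_gens i j"
        using I poly[of I Y] f by (simp add: graded_gens_def gens_def flatten_def)
    qed
    show "(\<lambda>(P, W). (P, W // eq P)) ` graded_gens i j \<subseteq> generators D i j"
    proof clarify
      fix P W assume g: "(P, W) \<in> graded_gens i j"
      have P: "P \<subseteq> X" "forest P" "W \<subseteq> arcs D" "closed P W" "int (card P) - int (neg_crossings D) = i" "quantum (P, W) = j"
        using g forest by (auto simp: graded_gens_def gens_def)
      have "W // eq P \<subseteq> components D P"
        unfolding components_forest[OF P(1,2)] using P(3) by (auto simp: quotient_def)
      then show "(P, W // eq P) \<in> generators D i j"
        using P poly[of P "W // eq P"] UW[OF P(4)] by (simp add: generators_def hom_degree_def flatten_def)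
    qed
  qed
qed

text \<open>With the labels kept, a gained edge compensates for a lost circle. This balance holds
  only within forests: an edge that closes a cycle leaves the number of components
  unchanged.\<close>

lemma push_graded:
  assumes g: "(P, W) \<in> gens (arcs D) {} X {}" and r: "r \<in> X - P" and forest: "forest (insert r P)"
  shows "push 0 {} (insert r P) (P, W) \<in> frags {(Q, W') \<in> gens (arcs D) {} X {}. card Q = Suc (card P) \<and> quantum (Q, W') = quantum (P, W)}"
proof -
  let ?Q = "insert r P" and ?a = "under_in (xing r)" and ?b = "under_out (xing r)"
  have P: "P \<subseteq> X" "finite P" using g finite_subset by (auto simp: gens_def)
  have QX: "?Q \<subseteq> X" using P r by auto
  have nab: "(?a, ?b) \<notin> eq P" using forest r by (auto simp: forest_def)
  have ab: "?a \<in> arcs D" "?b \<in> arcs D" using crossing_arcs[of r] r by auto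
  have "eq ?Q `` arcs D = arcs D" by (rule Image_closed[OF closed_arcs[OF QX]])
  then have n: "ncomp P (arcs D) = Suc (ncomp ?Q (arcs D))"
    using ncomp_insert_less[OF finite_arcs closed_arcs[OF P(1)] ab nab]
      ncomp_insert_ge[OF finite_arcs closed_arcs[OF P(1)], of r] by simp
  have card: "card ?Q = Suc (card P)" using P r by simp
  have fX: "finite X" by simp
  have in_gens: "push 0 {} ?Q (P, W) \<in> frags (gens (arcs D) {} X {})"
    by (rule push_in_gens[OF finite_arcs fX closed_arcs[OF order_refl] g _ QX]) auto
  show ?thesis
  proof (cases "ncomp P W - ncomp ?Q (eq ?Q `` W) = 0")
    case True
    have "finite W" using g finite_arcs finite_subset by (auto simp: gens_def)
    then have "ncomp ?Q (eq ?Q `` W) = ncomp P W" using True ncomp_Image_le[of W P ?Q] by auto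
    then have "push 0 {} ?Q (P, W) = frag_of (?Q, eq ?Q `` W)" "quantum (?Q, eq ?Q `` W) = quantum (P, W)"
      using n card by (simp_all add: push_def Let_def quantum_def)
    then show ?thesis using in_gens card by simp
  next
    case False
    then have "push 0 {} ?Q (P, W) = 0" by (simp add: push_def Let_def)
    then show ?thesis by simp
  qed
qed

text \<open>\<open>torsion_graph\<close> concerns all edge sets, whereas the two complexes are
  compared only up to degree \<open>i\<close>. The primitive it yields is cut down to bidegree (i -
  1, j), which is legitimate because the remaining generators are mapped away from bidegree (i,
  j).\<close>

lemma Khovanov_torsion:
  assumes forest: "\<And>I. I \<subseteq> X \<Longrightarrow> int (card I) - int (neg_crossings D) \<le> i \<Longrightarrow> forest I"
    and n: "0 < (n::int)" and z: "z \<in> frags (generators D i j)" and w: "w \<in> frags (generators D (i - 1) j)"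
    and eq: "frag_cmul n z = differential D w"
  shows "\<exists>y\<in>frags (generators D (i - 1) j). frag_cmul 2 z = differential D y"
proof -
  let ?T = "frag_extend (frag_of \<circ> flatten)" and ?d = "frag_extend (diff 0 X {})" and ?G = "gens (arcs D) {} X {}"
  let ?A = "generators D (i - 1) j" and ?S = "graded_gens (i - 1) j"
  have fX: "finite X" by simp
  have bij: "bij_betw flatten (generators D i j) (graded_gens i j)" "bij_betw flatten ?A ?S"
    by (rule flatten_bij, rule forest, auto)+
  have TA: "?T x \<in> frags ?S" if "x \<in> frags ?A" for x
    using that bij(2) by (auto simp: bij_betw_def elim!: frags_extend)
  have Tz: "?T z \<in> frags (graded_gens i j)"
    using z bij(1) by (auto simp: bij_betw_def elim!: frags_extend)
  have sub: "x \<in> frags (graded_gens i' j') \<Longrightarrow> x \<in> frags ?G" for x i' j'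
    by (erule frags_mono) (auto simp: graded_gens_def)
  define E where "E = {(I, Y). I \<subseteq> X \<and> int (card I) - int (neg_crossings D) = i \<and> Y \<subseteq> components D I}"
  have T_inj: "x = y" if "x \<in> frags E" "y \<in> frags E" "?T x = ?T y" for x y
  proof -
    let ?R = "frag_extend (\<lambda>(P, W). frag_of (P, W // eq P))"
    have RT: "?R (?T u) = u" if "u \<in> frags E" for u
      unfolding extend_compose using that
    proof (rule extend_id)
      fix g assume g: "g \<in> E"
      obtain I Y where [simp]: "g = (I, Y)" by (cases g)
      have I: "I \<subseteq> X" "forest I" "Y \<subseteq> components D I" using g forest by (auto simp: E_def)
      then have "\<Union>Y // eq I = Y" using Union_quotient(1)[OF _ I(1)] components_forest by simp
      then show "?R ((frag_of \<circ> flatten) g) = frag_of g" by (simp add: flatten_def)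
    qed
    have "?R (?T x) = ?R (?T y)" using that(3) by (rule arg_cong)
    then show ?thesis unfolding RT[OF that(1)] RT[OF that(2)] .
  qed
  have zE: "z \<in> frags E" using z by (rule frags_mono) (auto simp: generators_def hom_degree_def E_def)
  have T_surj: "\<exists>y\<in>frags ?A. ?T y = u" if u: "u \<in> frags ?S" for u
  proof
    let ?R = "frag_extend (frag_of \<circ> inv_into ?A flatten)"
    show "?T (?R u) = u"
      unfolding extend_compose using u bij(2) by (intro extend_id) (auto simp: bij_betw_def f_inv_into_f)
    show "?R u \<in> frags ?A"
      using u bij(2) by (auto simp: bij_betw_def inv_into_into elim!: frags_extend)
  qed
  have Td: "?T (differential D x) = ?d (?T x)" if "x \<in> frags ?A" for x
    unfolding differential_def extend_compose using that
  proof (rule extend_cong)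
    fix g assume g: "g \<in> ?A"
    obtain I Y where [simp]: "g = (I, Y)" by (cases g)
    have I: "I \<subseteq> X" "Y \<subseteq> components D I" "int (card I) - int (neg_crossings D) = i - 1"
      using g by (auto simp: generators_def hom_degree_def)
    have "frag_extend (frag_of \<circ> flatten) (edge_map D r (I, Y)) = push 0 {} (insert r I) (I, \<Union>Y)" if r: "r \<in> X - I" for r
    proof -
      have "card (insert r I) = Suc (card I)" using r I(1) finite_subset[OF I(1)] by simp
      then have "forest (insert r I)" using I r by (intro forest) auto
      then show ?thesis using edge_map_push[OF I(1) r _ I(2)] by (simp add: flatten_def)
    qed
    then show "?T (case g of (I, Y) \<Rightarrow> \<Sum>r\<in>X - I. frag_cmul ((- 1) ^ card {l \<in> I. l < r}) (edge_map D r (I, Y))) =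
       ?d ((frag_of \<circ> flatten) g)"
      by (simp add: flatten_def diff_def esign_def frag_extend_sum frag_extend_cmul)
  qed
  have dS: "?d x \<in> frags (graded_gens i j)" if "x \<in> frags ?S" for x
    using that
  proof (rule frags_extend)
    fix g assume g: "g \<in> ?S"
    obtain P W where [simp]: "g = (P, W)" by (cases g)
    have P: "(P, W) \<in> ?G" "int (card P) - int (neg_crossings D) = i - 1" "quantum (P, W) = j"
      using g by (auto simp: graded_gens_def)
    have "push 0 {} (insert r P) (P, W) \<in> frags (graded_gens i j)" if r: "r \<in> X - P" for r
    proof -
      have "P \<subseteq> X" using P(1) by (auto simp: gens_def)
      moreover have "card (insert r P) = Suc (card P)" using r \<open>P \<subseteq> X\<close> finite_subset by fastforce
      ultimately have "forest (insert r P)" using P r by (intro forest) auto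
      from push_graded[OF P(1) r this] show ?thesis
        by (rule frags_mono) (use P in \<open>auto simp: graded_gens_def\<close>)
    qed
    then show "diff 0 X {} g \<in> frags (graded_gens i j)" by (auto simp: diff_def intro!: frags_sum frags_cmul)
  qed
  \<comment> \<open>From homological degree \<open>i - 1\<close> the new edge set is a forest, so a
    wrong polynomial degree stays wrong; from other degrees the homological degree stays
    wrong.\<close>
  have dC: "?d x \<in> frags (?G - graded_gens i j)" if "x \<in> frags (?G - ?S)" for x
    using that
  proof (rule frags_extend)
    fix g assume g: "g \<in> ?G - ?S"
    obtain P W where [simp]: "g = (P, W)" by (cases g)
    have P: "(P, W) \<in> ?G" "\<not> (int (card P) - int (neg_crossings D) = i - 1 \<and> quantum (P, W) = j)"
      using g by (auto simp: graded_gens_def)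
    have PX: "P \<subseteq> X" "finite P" using P(1) finite_subset by (auto simp: gens_def)
    have "push 0 {} (insert r P) (P, W) \<in> frags (?G - graded_gens i j)" if r: "r \<in> X - P" for r
    proof (cases "int (card P) - int (neg_crossings D) = i - 1")
      case True
      have "card (insert r P) = Suc (card P)" using r PX by simp
      then have "forest (insert r P)" using PX r True by (intro forest) auto
      from push_graded[OF P(1) r this] show ?thesis
        by (rule frags_mono) (use P True in \<open>auto simp: graded_gens_def\<close>)
    next
      case False
      have "push 0 {} (insert r P) (P, W) \<in> frags ?G"
        by (rule push_in_gens[OF finite_arcs fX closed_arcs[OF order_refl] P(1)]) (use r PX in auto)
      moreover have "push 0 {} (insert r P) (P, W) \<in> frags (range (Pair (insert r P)))"
        by (auto simp: push_def Let_def intro!: frags_cmul)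
      ultimately have "push 0 {} (insert r P) (P, W) \<in> frags (?G \<inter> range (Pair (insert r P)))" by (rule frags_Int)
      then show ?thesis
        by (rule frags_mono) (use r PX False in \<open>auto simp: graded_gens_def\<close>)
    qed
    then show "diff 0 X {} g \<in> frags (?G - graded_gens i j)" by (auto simp: diff_def intro!: frags_sum frags_cmul)
  qed
  have ends: "under_in (xing r) \<in> arcs D \<and> under_out (xing r) \<in> arcs D" if "r \<in> X" for r
    using crossing_arcs[OF that] by blast
  have "frag_cmul n (?T z) = ?d (?T w)" using Td[OF w] eq by (metis frag_extend_cmul)
  moreover have "torsion_exponent_2 ?G (diff 0 X {})"
    by (rule torsion_graph[OF finite_arcs fX closed_arcs[OF order_refl] ends])
  ultimately obtain u where u: "u \<in> frags ?G" "frag_cmul 2 (?T z) = ?d u"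
    using n sub[OF Tz] sub[OF TA[OF w]] unfolding torsion_exponent_2_def by blast
  have "?G = ?S \<union> (?G - ?S)" by (auto simp: graded_gens_def)
  then have "u \<in> frags (?S \<union> (?G - ?S))" using u(1) by simp
  then obtain u0 u1 where u01: "u0 \<in> frags ?S" "u1 \<in> frags (?G - ?S)" "u = u0 + u1" by (rule frags_split)
  have "frag_cmul 2 (?T z) + 0 = ?d u0 + ?d u1" using u(2) u01(3) by (simp add: frag_extend_add)
  from frags_disjoint_cancel(1)[OF frags_cmul[OF Tz] dS[OF u01(1)] frags_0 dC[OF u01(2)] _ this]
  have "frag_cmul 2 (?T z) = ?d u0" by blast
  moreover obtain y where y: "y \<in> frags ?A" "?T y = u0" using T_surj[OF u01(1)] by blast
  ultimately have eq2: "?T (frag_cmul 2 z) = ?T (differential D y)" using Td[OF y(1)] by (simp add: frag_extend_cmul)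
  have "differential D y \<in> frags E"
    unfolding differential_def using y(1)
  proof (rule frags_extend)
    fix g assume g: "g \<in> ?A"
    obtain I Y where [simp]: "g = (I, Y)" by (cases g)
    have I: "I \<subseteq> X" "Y \<subseteq> components D I" "int (card I) - int (neg_crossings D) = i - 1"
      using g by (auto simp: generators_def hom_degree_def)
    have "edge_map D r (I, Y) \<in> frags E" if r: "r \<in> X - I" for r
    proof -
      let ?J = "insert r I"
      have "card ?J = Suc (card I)" using r I(1) finite_subset[OF I(1)] by simp
      then have JE: "(?J, Y') \<in> E" if "Y' \<subseteq> components D ?J" for Y'
        using that I r by (auto simp: E_def)
      have sub: "Y - (components D I - components D ?J) \<subseteq> components D ?J" using I(2) by blast
      have ifI: "x \<in> frags E \<Longrightarrow> y \<in> frags E \<Longrightarrow> (if b then x else y) \<in> frags E" for b x y by simp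
      have fr: "frag_of (?J, Y') \<in> frags E" if "Y' \<subseteq> components D ?J" for Y' using JE[OF that] by simp
      show ?thesis
        unfolding edge_map_def prod.case Let_def
        by (intro ifI frags_sum frags_0 fr) (use sub in blast)+
    qed
    then show "(case g of (I, Y) \<Rightarrow> \<Sum>r\<in>X - I. frag_cmul ((- 1) ^ card {l \<in> I. l < r}) (edge_map D r (I, Y))) \<in> frags E"
      by (auto intro!: frags_sum frags_cmul)
  qed
  then have "frag_cmul 2 z = differential D y" using T_inj[OF frags_cmul[OF zE] _ eq2] by blast
  then show ?thesis using y(1) by blast
qed

end


section \<open>Torsion in Khovanov homology\<close>

context
  fixes G :: "('g \<Rightarrow>\<^sub>0 int) monoid" and B :: "('g \<Rightarrow>\<^sub>0 int) set"
  assumes mult: "\<And>x y. x \<otimes>\<^bsub>G\<^esub> y = x + y" and B: "diff_closed B"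
begin

lemma r_coset_plus: "B #>\<^bsub>G\<^esub> z = (\<lambda>b. b + z) ` B"
  by (auto simp: r_coset_def mult)

lemma pow_FactGroup_plus: "(B #>\<^bsub>G\<^esub> z) [^]\<^bsub>G Mod B\<^esub> (n :: nat) = B #>\<^bsub>G\<^esub> frag_cmul (int n) z"
proof (induction n)
  case 0
  then show ?case by (simp add: r_coset_plus nat_pow_def)
next
  case (Suc n)
  have "(B #>\<^bsub>G\<^esub> z) [^]\<^bsub>G Mod B\<^esub> Suc n = (B #>\<^bsub>G\<^esub> frag_cmul (int n) z) <#>\<^bsub>G\<^esub> (B #>\<^bsub>G\<^esub> z)"
    using Suc by (simp add: nat_pow_def)
  also have "\<dots> = (\<lambda>b. b + frag_cmul (int (Suc n)) z) ` B"
  proof (intro equalityI subsetI)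
    fix x assume "x \<in> (B #>\<^bsub>G\<^esub> frag_cmul (int n) z) <#>\<^bsub>G\<^esub> (B #>\<^bsub>G\<^esub> z)"
    then obtain b c where bc: "b \<in> B" "c \<in> B" "x = b + frag_cmul (int n) z + (c + z)"
      by (auto simp: set_mult_def mult r_coset_plus)
    have "x = (b + c) + frag_cmul (int (Suc n)) z"
      unfolding bc(3) by (simp add: frag_cmul_distrib algebra_simps)
    then show "x \<in> (\<lambda>b. b + frag_cmul (int (Suc n)) z) ` B" using diff_closed_simps(4)[OF B bc(1,2)] by blast
  next
    fix x assume "x \<in> (\<lambda>b. b + frag_cmul (int (Suc n)) z) ` B"
    then obtain b where b: "b \<in> B" "x = b + frag_cmul (int (Suc n)) z" by blast
    have "x = (b + frag_cmul (int n) z) + (0 + z)"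
      unfolding b(2) by (simp add: frag_cmul_distrib algebra_simps)
    then show "x \<in> (B #>\<^bsub>G\<^esub> frag_cmul (int n) z) <#>\<^bsub>G\<^esub> (B #>\<^bsub>G\<^esub> z)"
    proof -
      have "b + frag_cmul (int n) z \<in> B #>\<^bsub>G\<^esub> frag_cmul (int n) z" "0 + z \<in> B #>\<^bsub>G\<^esub> z"
        unfolding r_coset_plus using b(1) diff_closed_simps(1)[OF B] by blast+
      then show ?thesis unfolding \<open>x = (b + frag_cmul (int n) z) + (0 + z)\<close> set_mult_def mult by blast
    qed
  qed
  finally show ?case by (simp add: r_coset_plus)
qed

lemma r_coset_eq_iff: "B #>\<^bsub>G\<^esub> z = B \<longleftrightarrow> z \<in> B"
proof
  assume "B #>\<^bsub>G\<^esub> z = B"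
  then show "z \<in> B" using diff_closed_simps(1)[OF B] unfolding r_coset_plus by force
next
  assume z: "z \<in> B"
  show "B #>\<^bsub>G\<^esub> z = B"
    unfolding r_coset_plus
  proof (intro equalityI subsetI)
    fix x assume "x \<in> B"
    then show "x \<in> (\<lambda>b. b + z) ` B" using diff_closed_simps(2)[OF B _ z] by (intro image_eqI[of _ _ "x - z"]) auto
  qed (use z diff_closed_simps(4)[OF B] in auto)
qed

end

theorem theorem1p1:
  fixes D :: "'a diagram" and i j :: int and g :: enat
  assumes "link_diagram D"
    and "g = girth (A_state_graph D)"
    and "2 \<le> g"
    and "- int (neg_crossings D) \<le> i"
    and "enat (nat (i + int (neg_crossings D))) \<le> g - 1"
  shows "\<forall>a. torsion_element (Khovanov_homology D i j) a \<longrightarrow>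
    a [^]\<^bsub>Khovanov_homology D i j\<^esub> (2::nat) = \<one>\<^bsub>Khovanov_homology D i j\<^esub>"
proof (intro allI impI)
  fix c assume tors: "torsion_element (Khovanov_homology D i j) c"
  interpret link D by unfold_locales (rule assms(1))
  let ?k = "nat (i + int (neg_crossings D))"
  \<comment> \<open>For finite \<open>g\<close> the bound \<open>2 \<le> g\<close> makes
    \<open>g - 1\<close> strictly smaller than \<open>g\<close>; for infinite \<open>g\<close>
    finiteness of \<open>?k\<close> suffices.\<close>
  have k: "enat ?k < g"
  proof (cases g)
    case (enat m)
    then have "2 \<le> m" "?k \<le> m - 1" using assms(3,5) by (simp_all add: numeral_eq_enat one_enat_def)
    then show ?thesis using enat by simp
  qed simp
  \<comment> \<open>Covers both ends of the differential into degree \<open>i\<close>, which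
    determines the torsion there.\<close>
  have forest: "forest I" if "I \<subseteq> {..<num_crossings D}" "int (card I) - int (neg_crossings D) \<le> i" for I
  proof (rule forest_girth[OF that(1)])
    have "card I \<le> ?k" using that(2) by linarith
    then show "enat (card I) < girth (A_state_graph D)" using k assms(2) by (metis enat_ord_simps(1) order_le_less_trans)
  qed
  let ?Z = "cycle_group D i j" and ?B = "boundaries D i j"
  have mult: "x \<otimes>\<^bsub>?Z\<^esub> y = x + y" for x y by (simp add: cycle_group_def chain_group_def)
  have B_eq: "?B = differential D ` frags (generators D (i - 1) j)"
    by (simp add: boundaries_def chain_group_def frags_def free_Abelian_group_def)
  have B: "diff_closed ?B"
    unfolding diff_closed_def
  proof (intro conjI ballI)
    show "0 \<in> ?B" unfolding B_eq by (rule image_eqI[of _ _ 0]) (simp_all add: differential_def)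
    fix x y assume "x \<in> ?B" "y \<in> ?B"
    then obtain u v where uv: "u \<in> frags (generators D (i - 1) j)" "v \<in> frags (generators D (i - 1) j)"
      "x = differential D u" "y = differential D v" unfolding B_eq by blast
    then have "x - y = differential D (u - v)" by (simp add: differential_def frag_extend_diff)
    then show "x - y \<in> ?B" unfolding B_eq using frags_diff[OF uv(1,2)] by blast
  qed
  have Kh: "Khovanov_homology D i j = ?Z Mod ?B" by (simp add: Khovanov_homology_def)
  obtain n :: nat where c: "c \<in> carrier (?Z Mod ?B)" and n: "0 < n" "c [^]\<^bsub>?Z Mod ?B\<^esub> n = ?B"
    using tors unfolding torsion_element_def Kh one_FactGroup by blast
  obtain z where z: "z \<in> carrier ?Z" "c = ?B #>\<^bsub>?Z\<^esub> z" using c unfolding carrier_FactGroup by blast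
  have zA: "z \<in> frags (generators D i j)"
    using z(1) by (simp add: cycle_group_def chain_group_def kernel_def frags_def)
  have "frag_cmul (int n) z \<in> ?B"
    using n(2) unfolding z(2) pow_FactGroup_plus[OF mult B] r_coset_eq_iff[OF mult B] .
  then obtain w where "w \<in> frags (generators D (i - 1) j)" "frag_cmul (int n) z = differential D w"
    unfolding B_eq by blast
  then obtain y where "y \<in> frags (generators D (i - 1) j)" "frag_cmul 2 z = differential D y"
    using Khovanov_torsion[OF forest _ zA, of "int n" w] n(1) by auto
  then have "frag_cmul (int 2) z \<in> ?B" unfolding B_eq by auto
  then show "c [^]\<^bsub>Khovanov_homology D i j\<^esub> (2::nat) = \<one>\<^bsub>Khovanov_homology D i j\<^esub>"
    unfolding Kh one_FactGroup z(2) pow_FactGroup_plus[OF mult B] r_coset_eq_iff[OF mult B] .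
qed

end
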